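(* Let $n\ge1$ be an integer, $\beta\ge\frac{n+1}{2}$ and $\beta^*=\beta+\frac{n+1}{2}$. For any Borel set $A$ in $\mathbb{R}^n$, $$\mathfrak{m}_{n,\beta}^+(A)\ge c\,\mathfrak{m}_{n,\beta^*}(A)\,\big(1-\mathfrak{m}_{n,\beta^*}(A)\big),$$ where one may take $c=\frac{d}{\sqrt\pi}\sqrt{2\beta}$ with $$d=\frac{\Gamma(\beta^*-\frac n2)^2}{\Gamma(\beta^*-n)\,\Gamma(\beta^* )}.$$ Moreover, if $\beta\ge n^2$, then this $c$ satisfies $c\ge\frac{1}{\sqrt{2\pi}}\sqrt\beta$.
   Context: For an integer $n\ge1$ and a real $\alpha>\frac n2$, the Cauchy measure $\mathfrak{m}_{n,\alpha}$ of order $\alpha$ on $\mathbb{R}^n$ is the probability measure with density $\frac{1}{c_{n,\alpha}}(1+|x|^2)^{-\alpha}$, $x\in\mathbb{R}^n$, with respect to Lebesgue measure, where $c_{n,\alpha}=\pi^{n/2}\,\Gamma(\alpha-\frac n2)/\Gamma(\alpha)$. For a Borel probability measure $\nu$ on $\mathbb{R}^n$ and a Borel set $A\subset\mathbb{R}^n$, the $\nu$-perimeter (outer Minkowski content) is $\nu^+(A)=\liminf_{\varepsilon\to0^+}\frac{\nu(A_\varepsilon)-\nu(A)}{\varepsilon}$, where $A_\varepsilon$ is the open $\varepsilon$-neighborhood of $A$ for the Euclidean distance. *)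

theory Defs
  imports "HOL-Analysis.Analysis"
begin

definition cauchy_const :: "nat \<Rightarrow> real \<Rightarrow> real" where
  "cauchy_const n \<alpha> = pi powr (real n / 2) * Gamma (\<alpha> - real n / 2) / Gamma \<alpha>"

text \<open>The dimension is carried by the type. Only the range \<open>\<alpha> > DIM('a) / 2\<close> is meaningful;
  there this is a probability measure.\<close>

definition cauchy_measure :: "real \<Rightarrow> 'a::euclidean_space measure" where
  "cauchy_measure \<alpha> =
     density lborel (\<lambda>x. ennreal (1 / cauchy_const DIM('a) \<alpha> * (1 + (norm x)\<^sup>2) powr (- \<alpha>)))"

text \<open>A union of balls rather than a condition on \<open>infdist\<close>, which is \<open>0\<close> for the empty set.\<close>

definition open_nbhd :: "real \<Rightarrow> 'a::metric_space set \<Rightarrow> 'a set" where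
  "open_nbhd \<epsilon> A = (\<Union>a\<in>A. ball a \<epsilon>)"

text \<open>The value is extended real: it is \<open>\<infinity>\<close> for a countable dense set, for instance.\<close>

definition perimeter :: "'a::metric_space measure \<Rightarrow> 'a set \<Rightarrow> ereal" where
  "perimeter \<nu> A =
     Liminf (at_right 0) (\<lambda>\<epsilon>::real. ereal ((measure \<nu> (open_nbhd \<epsilon> A) - measure \<nu> A) / \<epsilon>))"

end

theory Submission
  imports Defs "HOL-Probability.Distributions"
begin

text \<open>
  Write \<open>n\<close> for the dimension, \<open>b\<close> for \<open>\<beta>'\<close>, and give a pair \<open>(x, y)\<close> of points the weight
  \<open>((1 + |x|\<^sup>2) (1 + |y|\<^sup>2)) powr - b\<close>, so that weighted pairs are pairs of independent points of the
  Cauchy measure of order \<open>b\<close>, up to normalisation. The proof joins \<open>x\<close> to \<open>y\<close> by the quarter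
  turn \<open>t \<mapsto> cos t *\<^sub>R x + sin t *\<^sub>R y\<close> and integrates the slope of a function \<open>f\<close> along it. Let
  \<open>(z, w)\<close> be the position and the velocity at time \<open>t\<close>. The map from \<open>(x, y)\<close> to \<open>(z, w)\<close> is a
  rotation of the product space, so it preserves Lebesgue measure, and the integral of
  \<open>|f x - f y|\<close> over weighted pairs is at most the integral of \<open>|\<nabla>f(z) \<bullet> w|\<close> against the integral of
  the pair weight over all times (lemma \<open>pair_difference_le_gradient_flux\<close>). Integrating out \<open>w\<close>
  leaves a multiple of \<open>|\<nabla>f(z)| (1 + |z|\<^sup>2) powr - \<beta>\<close> (lemma \<open>flux_bound\<close>): the substitution
  \<open>w = sqrt (1 + |z|\<^sup>2) *\<^sub>R w'\<close> produces \<open>n/2\<close> in the exponent from the volume and \<open>1/2\<close> from the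
  factor \<open>w\<close>, and \<open>b = \<beta> + (n + 1) / 2\<close>. This is where the two orders come from.

  Taking for \<open>f\<close> a ramp that falls from 1 to 0 between two neighbourhoods of a set gives a bound for
  the mass of a neighbourhood of any width (lemma \<open>nbhd_inequality\<close>), and the bound for the
  perimeter follows on letting the width tend to 0. Distances are only ever taken to finite sets, by
  exhausting the set with a dense sequence: almost everywhere, the distance to a finite set is
  locally the distance to a single point, which makes its gradient explicit.

  The constant needs more care. The crude estimate of the pair weight by
  \<open>(1 + |x|\<^sup>2 + |y|\<^sup>2) powr - b\<close>, which no rotation changes, yields
  \<open>4 d / sqrt \<pi> * Gamma (a + 1/2) / Gamma a\<close> with \<open>a = \<beta> - n/2\<close>. This is at least
  \<open>d / sqrt \<pi> * sqrt (2 \<beta>)\<close> unless \<open>\<beta>\<close> is near its least value \<open>(n + 1) / 2\<close> and \<open>n \<ge> 5\<close>; at the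
  least value it is too small by a factor of order \<open>sqrt n\<close>. The loss is recovered from the product
  \<open>|x|\<^sup>2 |y|\<^sup>2\<close> in \<open>(1 + |x|\<^sup>2) (1 + |y|\<^sup>2)\<close>, which is small only for a short part of the quarter turn.
  With \<open>q = |z|\<^sup>2 + |w|\<^sup>2\<close> the pair weight is at most
  \<open>((1 + q) (1 + q\<^sup>2 / (4 (1 + q)) sin\<^sup>2 \<phi>)) powr - b\<close>, where \<open>\<phi>\<close> runs through an interval of length \<open>\<pi>\<close>
  (lemma \<open>pair_weight_rot_le\<close>). The mean over \<open>\<phi>\<close> is bounded by an expression \<open>A + B / q\<close>, chosen
  because its integral against the remaining radial density is explicit, and
  \<open>angular_bound_sufficient\<close> shows that \<open>A\<close> and \<open>B\<close> can be chosen to reach the stated constant.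
\<close>

section \<open>Quotients of Gamma values\<close>

text \<open>The quotient of the two sides increases with \<open>a\<close>, because the digamma function is concave, and
  they agree at \<open>a = 1/2\<close>.\<close>

lemma Gamma_half_step_lower:
  fixes a :: real
  assumes "a \<ge> 1/2"
  shows "2 * a / pi \<le> (Gamma (a + 1/2) / Gamma a)\<^sup>2"
proof -
  define \<phi> where "\<phi> = (\<lambda>t::real. 2 * ln_Gamma (t + 1/2) - ln_Gamma t - ln_Gamma (t + 1))"
  have "\<phi> (1/2) \<le> \<phi> a"
  proof (rule DERIV_nonneg_imp_nondecreasing[OF assms])
    fix t :: real assume "1/2 \<le> t" "t \<le> a"
    hence t: "t > 0" by simp
    have d: "(\<phi> has_real_derivative 2 * Digamma (t + 1/2) - Digamma t - Digamma (t + 1)) (at t)"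
      unfolding \<phi>_def using t by (auto intro!: derivative_eq_intros)
    have mvt: "\<exists>\<xi>. x < \<xi> \<and> \<xi> < y \<and> Digamma y - Digamma x = (y - x) * Polygamma 1 \<xi>"
      if "x > 0" "x < y" for x y :: real
      using that by (intro MVT2 derivative_eq_intros impI allI) (auto elim!: nonpos_Ints_cases)
    obtain \<xi> where \<xi>: "t < \<xi>" "\<xi> < t + 1/2"
      "Digamma (t + 1/2) - Digamma t = (t + 1/2 - t) * Polygamma 1 \<xi>"
      using mvt[of t "t + 1/2"] t by auto
    obtain \<zeta> where \<zeta>: "t + 1/2 < \<zeta>" "\<zeta> < t + 1"
      "Digamma (t + 1) - Digamma (t + 1/2) = (t + 1 - (t + 1/2)) * Polygamma 1 \<zeta>"
      using mvt[of "t + 1/2" "t + 1"] t by auto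
    have "Polygamma 1 \<zeta> < Polygamma 1 \<xi>"
      using \<xi> \<zeta> t by (intro Polygamma_real_strict_antimono) auto
    with d \<xi>(3) \<zeta>(3) show "\<exists>y. (\<phi> has_real_derivative y) (at t) \<and> 0 \<le> y"
      by (intro exI[of _ "2 * Digamma (t + 1/2) - Digamma t - Digamma (t + 1)"]) auto
  qed
  moreover have "\<phi> t = ln ((Gamma (t + 1/2) / Gamma t)\<^sup>2 / t)" if "t > 0" for t
  proof -
    have "Gamma (t + 1) = t * Gamma t"
      using that by (subst Gamma_plus1) auto
    then show ?thesis
      using that Gamma_real_pos[of t] Gamma_real_pos[of "t + 1/2"]
      by (simp add: \<phi>_def ln_Gamma_real_pos ln_div ln_mult ln_realpow less_imp_neq[symmetric])
  qed
  ultimately have "ln ((Gamma (1/2 + 1/2) / Gamma (1/2))\<^sup>2 / (1/2)) \<le> ln ((Gamma (a + 1/2) / Gamma a)\<^sup>2 / a)"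
    using assms by simp
  moreover have "Gamma (a + 1/2) > 0" "Gamma a > 0" "Gamma (1/2 :: real) > 0"
    using assms by (auto intro!: Gamma_real_pos)
  ultimately have "(Gamma (1/2 + 1/2 :: real) / Gamma (1/2))\<^sup>2 / (1/2) \<le> (Gamma (a + 1/2) / Gamma a)\<^sup>2 / a"
    using assms by (subst (asm) ln_le_cancel_iff) (auto intro!: divide_pos_pos zero_less_power
        simp: Gamma_one_half_real)
  moreover have "(Gamma (1/2 + 1/2 :: real) / Gamma (1/2))\<^sup>2 / (1/2) = 2 / pi"
    by (simp add: Gamma_one_half_real power_divide)
  ultimately have "2 / pi \<le> (Gamma (a + 1/2) / Gamma a)\<^sup>2 / a"
    by simp
  hence "2 / pi * a \<le> (Gamma (a + 1/2) / Gamma a)\<^sup>2"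
    using assms by (subst (asm) pos_le_divide_eq) auto
  thus ?thesis by (simp add: mult_ac)
qed

text \<open>Log-convexity of the Gamma function makes \<open>ln Gamma (x - s) + ln Gamma (x + s)\<close> a convex even
  function of \<open>s\<close>.\<close>

lemma Gamma_symmetric_product_mono:
  fixes x s t :: real
  assumes "0 \<le> s" "s \<le> t" "t < x"
  shows "Gamma (x - s) * Gamma (x + s) \<le> Gamma (x - t) * Gamma (x + t)"
proof (cases "t = 0")
  case False
  hence t: "t > 0" using assms by simp
  define u where "u = (t - s) / (2 * t)"
  have u: "0 \<le> u" "u \<le> 1" using assms t by (auto simp: u_def field_simps)
  have eq: "(1 - u) *\<^sub>R (x - t) + u *\<^sub>R (x + t) = x - s" "(1 - u) *\<^sub>R (x + t) + u *\<^sub>R (x - t) = x + s"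
    using t by (auto simp: u_def field_simps)
  have pos: "Gamma (x - t) > 0" "Gamma (x + t) > 0" "Gamma (x - s) > 0" "Gamma (x + s) > 0"
    using assms by (auto intro!: Gamma_real_pos)
  have 1: "ln (Gamma (x - s)) \<le> (1 - u) * ln (Gamma (x - t)) + u * ln (Gamma (x + t))"
    using convex_onD[OF log_convex_Gamma_real, of u "x - t" "x + t"] u assms unfolding eq by simp
  have 2: "ln (Gamma (x + s)) \<le> (1 - u) * ln (Gamma (x + t)) + u * ln (Gamma (x - t))"
    using convex_onD[OF log_convex_Gamma_real, of u "x + t" "x - t"] u assms unfolding eq by simp
  have "ln (Gamma (x - s) * Gamma (x + s)) \<le> ln (Gamma (x - t) * Gamma (x + t))"
    using 1 2 pos by (simp add: ln_mult algebra_simps)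
  thus ?thesis using pos by (subst (asm) ln_le_cancel_iff) auto
qed (use assms in auto)

text \<open>Both \<open>Gamma (x + k) / Gamma x\<close> and \<open>Gamma x / Gamma (x - k)\<close> are products of \<open>k\<close> factors, which
  are compared one by one; Bernoulli's inequality does the rest.\<close>

lemma Gamma_shift_product_bound:
  fixes x :: real and k :: nat
  assumes "real k < x"
  shows "(1 - (real k)\<^sup>2 / x) * (Gamma (x - k) * Gamma (x + k)) \<le> (Gamma x)\<^sup>2"
proof -
  have x: "x > 0" using assms by simp
  have G: "Gamma x > 0" "Gamma (x - k) > 0"
    using assms by (auto intro!: Gamma_real_pos)
  have n1: "x \<notin> \<int>\<^sub>\<le>\<^sub>0" "x - k \<notin> \<int>\<^sub>\<le>\<^sub>0"
    using assms by (auto elim!: nonpos_Ints_cases)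
  have p1: "Gamma (x + k) = pochhammer x k * Gamma x"
    using pochhammer_Gamma[OF n1(1), of k] G by simp
  have p2: "Gamma x = pochhammer (x - k) k * Gamma (x - k)"
    using pochhammer_Gamma[OF n1(2), of k] G by simp
  have "(1 - (real k)\<^sup>2 / x) \<le> (1 - real k / x) ^ k"
    using Bernoulli_inequality[of "- (real k / x)" k] assms x by (simp add: power2_eq_square)
  also have "(1 - real k / x) ^ k * pochhammer x k = (\<Prod>i<k. (1 - real k / x) * (x + real i))"
    by (simp add: pochhammer_prod prod.distrib atLeast0LessThan)
  then have "(1 - real k / x) ^ k * pochhammer x k \<le> pochhammer (x - k) k"
  proof (simp only:, unfold pochhammer_prod atLeast0LessThan, intro prod_mono conjI)
    fix i :: nat assume "i \<in> {..<k}"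
    show "0 \<le> (1 - real k / x) * (x + real i)"
      using assms x by (intro mult_nonneg_nonneg) (auto simp: field_simps)
    show "(1 - real k / x) * (x + real i) \<le> x - real k + of_nat i"
      using assms x by (simp add: field_simps)
  qed
  finally have "(1 - (real k)\<^sup>2 / x) * pochhammer x k \<le> pochhammer (x - k) k"
    using x pochhammer_pos[OF x, of k] by (meson mult_right_mono order_trans less_imp_le)
  hence "(1 - (real k)\<^sup>2 / x) * pochhammer x k * (Gamma (x - k) * Gamma x) \<le> pochhammer (x - k) k * (Gamma (x - k) * Gamma x)"
    using G by (intro mult_right_mono) auto
  also have "pochhammer (x - k) k * (Gamma (x - k) * Gamma x) = (Gamma x)\<^sup>2"
    by (simp add: power2_eq_square mult.assoc[symmetric] p2[symmetric])
  finally show ?thesis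
    unfolding p1 by (simp add: mult_ac)
qed

text \<open>The quotient is the constant \<open>d\<close> of the theorem. For \<open>n \<ge> 2\<close> the shift \<open>n/2\<close> is rounded up to an
  integer. For \<open>n = 1\<close> that would lose too much, and \<open>Gamma_half_step_lower\<close> applies instead.\<close>

lemma Gamma_quotient_ge_half:
  fixes \<beta> :: real
  assumes n: "n \<ge> 1" and \<beta>: "\<beta> \<ge> (real n)\<^sup>2"
  shows "(Gamma (\<beta> + 1/2))\<^sup>2 / (Gamma (\<beta> + 1/2 - n/2) * Gamma (\<beta> + 1/2 + n/2)) \<ge> 1/2"
proof (cases "n = 1")
  case True
  with \<beta> have b: "\<beta> \<ge> 1" by simp
  have G: "Gamma \<beta> > 0" "Gamma (\<beta> + 1) = \<beta> * Gamma \<beta>"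
    using b by (auto intro!: Gamma_real_pos Gamma_plus1 elim!: nonpos_Ints_cases)
  have "1/2 \<le> 2 / pi" using pi_less_4 by (simp add: field_simps)
  also have "2 / pi \<le> (Gamma (\<beta> + 1/2) / Gamma \<beta>)\<^sup>2 / \<beta>"
    using divide_right_mono[OF Gamma_half_step_lower[of \<beta>], of \<beta>] b by simp
  also have "\<dots> = (Gamma (\<beta> + 1/2))\<^sup>2 / (Gamma (\<beta> + 1/2 - n/2) * Gamma (\<beta> + 1/2 + n/2))"
    using True G by (simp add: power2_eq_square add.commute)
  finally show ?thesis .
next
  case False
  with n have n2: "n \<ge> 2" by simp
  define k where "k = (n + 1) div 2"
  have k: "real n / 2 \<le> k" "real k \<le> (real n + 1) / 2"
    unfolding k_def by (simp_all add: field_simps)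
  define x where "x = \<beta> + 1/2"
  have nn: "2 * real n \<le> (real n)\<^sup>2" using n2 by (simp add: power2_eq_square)
  have x: "x \<ge> (real n)\<^sup>2 + 1/2" using \<beta> by (simp add: x_def)
  have kx: "real k < x" using k x nn of_nat_mono[OF n2, where 'a=real] by simp
  have "(real k)\<^sup>2 \<le> ((real n + 1) / 2)\<^sup>2" using k by (intro power_mono) auto
  also have "\<dots> \<le> x / 2" using x nn by (simp add: power2_eq_square field_simps)
  finally have kk: "(real k)\<^sup>2 / x \<le> 1/2" using kx by (simp add: field_simps)
  have pos: "Gamma (x - n/2) > 0" "Gamma (x + n/2) > 0" "Gamma (x - k) > 0" "Gamma (x + k) > 0"
    using kx k by (auto intro!: Gamma_real_pos)
  have "1/2 * (Gamma (x - n/2) * Gamma (x + n/2)) \<le> (1 - (real k)\<^sup>2 / x) * (Gamma (x - k) * Gamma (x + k))"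
    by (rule mult_mono) (use kk pos Gamma_symmetric_product_mono[of "n/2" k x] k kx in auto)
  also have "\<dots> \<le> (Gamma x)\<^sup>2" by (rule Gamma_shift_product_bound[OF kx])
  finally show ?thesis using pos unfolding x_def by (simp add: field_simps)
qed

section \<open>Trigonometric means\<close>

text \<open>With \<open>k = sqrt (1 + \<mu>)\<close> the usual antiderivative \<open>arctan (k tan x) / k\<close> jumps. Its continuous
  branch is \<open>x / k\<close> plus a periodic function, so every interval of length \<open>\<pi>\<close> gives the same value.\<close>

lemma has_integral_inverse_one_plus_sin2:
  fixes \<mu> c :: real
  assumes "\<mu> \<ge> 0"
  shows "((\<lambda>x. 1 / (1 + \<mu> * (sin x)\<^sup>2)) has_integral pi / sqrt (1 + \<mu>)) {c..c+pi}"
proof -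
  define k where "k = sqrt (1 + \<mu>)"
  have k: "k \<ge> 1" "\<mu> = k\<^sup>2 - 1" using assms by (auto simp: k_def)
  \<comment> \<open>The continuous branch of \<open>arctan (k tan x) / k\<close>.\<close>
  define F where "F = (\<lambda>x. (x + arctan ((k - 1) * sin x * cos x / ((cos x)\<^sup>2 + k * (sin x)\<^sup>2))) / k)"
  have D: "(cos x)\<^sup>2 + k * (sin x)\<^sup>2 > 0" for x
  proof -
    have "(cos x)\<^sup>2 + k * (sin x)\<^sup>2 = 1 + (k - 1) * (sin x)\<^sup>2"
      by (simp add: cos_squared_eq algebra_simps)
    also have "\<dots> > 0" using k by (simp add: add_pos_nonneg)
    finally show ?thesis .
  qed
  have E: "1 + \<mu> * (sin x)\<^sup>2 > 0" for x
    using assms by (simp add: add_pos_nonneg)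
  have "((\<lambda>x. 1 / (1 + \<mu> * (sin x)\<^sup>2)) has_integral (F (c+pi) - F c)) {c..c+pi}"
  proof (rule fundamental_theorem_of_calculus)
    fix x assume "x \<in> {c..c+pi}"
    define S C where "S = sin x" and "C = cos x"
    have SC: "C\<^sup>2 = 1 - S\<^sup>2" by (simp add: S_def C_def cos_squared_eq)
    define d where "d = C\<^sup>2 + k * S\<^sup>2"
    have d: "d > 0" using D[of x] by (simp add: d_def S_def C_def)
    have d': "d = 1 + (k - 1) * S\<^sup>2" by (simp add: d_def SC algebra_simps)
    have num: "d\<^sup>2 + ((k - 1) * S * C)\<^sup>2 = 1 + \<mu> * S\<^sup>2"
      unfolding power_mult_distrib SC d' k(2) by (simp add: power2_eq_square algebra_simps)
    have der: "(F has_real_derivative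
        (1 + ((k - 1) * (C\<^sup>2 - S\<^sup>2) * d - (k - 1) * S * C * (2 * (k - 1) * S * C)) / d\<^sup>2
             / (1 + ((k - 1) * S * C / d)\<^sup>2)) / k) (at x)"
      unfolding F_def S_def C_def d_def using D[of x] k
      by (auto intro!: derivative_eq_intros simp: power2_eq_square field_simps)
    have "((k - 1) * (C\<^sup>2 - S\<^sup>2) * d - (k - 1) * S * C * (2 * (k - 1) * S * C)) / d\<^sup>2
             / (1 + ((k - 1) * S * C / d)\<^sup>2)
        = ((k - 1) * (C\<^sup>2 - S\<^sup>2) * d - 2 * (k - 1)\<^sup>2 * S\<^sup>2 * C\<^sup>2) / (1 + \<mu> * S\<^sup>2)"
    proof -
      have *: "N / d\<^sup>2 / (1 + (M / d)\<^sup>2) = N / (d\<^sup>2 + M\<^sup>2)" for N M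
      proof -
        have "1 + (M / d)\<^sup>2 = (d\<^sup>2 + M\<^sup>2) / d\<^sup>2"
          using d by (simp add: power_divide add_divide_distrib)
        thus ?thesis using d by simp
      qed
      show ?thesis unfolding num[symmetric] * by (simp add: power2_eq_square mult_ac)
    qed
    also have "1 + \<dots> = k / (1 + \<mu> * S\<^sup>2)"
    proof -
      have "1 + \<mu> * S\<^sup>2 + ((k - 1) * (C\<^sup>2 - S\<^sup>2) * d - 2 * (k - 1)\<^sup>2 * S\<^sup>2 * C\<^sup>2) = k"
        unfolding SC d' k(2) by (simp add: power2_eq_square algebra_simps)
      thus ?thesis using E[of x] by (simp add: S_def field_simps)
    qed
    finally have "(F has_real_derivative 1 / (1 + \<mu> * (sin x)\<^sup>2)) (at x)"
      using der k by (simp add: S_def)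
    thus "(F has_vector_derivative 1 / (1 + \<mu> * (sin x)\<^sup>2)) (at x within {c..c+pi})"
      by (simp add: has_real_derivative_iff_has_vector_derivative has_vector_derivative_at_within)
  qed auto
  also have "F (c + pi) - F c = pi / k"
    using k by (simp add: F_def field_simps)
  finally show ?thesis by (simp add: k_def)
qed

text \<open>The reduction formula comes from integrating the derivative of the periodic function
  \<open>sin x cos x / (1 + \<mu> sin\<^sup>2 x) ^ k\<close>, with \<open>sin\<^sup>2\<close> and \<open>cos\<^sup>2\<close> expressed through the denominator.\<close>

lemma has_integral_inverse_power_one_plus_sin2_step:
  fixes \<mu> c :: real
  assumes \<mu>: "\<mu> \<ge> 0" and k: "k > 0"
    and A: "((\<lambda>x. 1 / (1 + \<mu> * (sin x)\<^sup>2) ^ (k - 1)) has_integral A) {c..c+pi}"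
    and B: "((\<lambda>x. 1 / (1 + \<mu> * (sin x)\<^sup>2) ^ k) has_integral B) {c..c+pi}"
  shows "((\<lambda>x. 1 / (1 + \<mu> * (sin x)\<^sup>2) ^ (k + 1)) has_integral
    ((2 * real k - 1) * (2 + \<mu>) * B - (2 * real k - 2) * A) / (2 * real k * (1 + \<mu>))) {c..c+pi}"
proof -
  define D where "D = (\<lambda>x. 1 + \<mu> * (sin x)\<^sup>2)"
  have D: "D x > 0" for x using \<mu> by (simp add: D_def add_pos_nonneg)
  define F where "F = (\<lambda>x. sin x * cos x / D x ^ k)"
  define f where "f = (\<lambda>x. (2 * real k - 1) * (2 + \<mu>) * (1 / D x ^ k) - (2 * real k - 2) * (1 / D x ^ (k - 1))
      - 2 * real k * (1 + \<mu>) * (1 / D x ^ (k + 1)))"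
  have "((\<lambda>x. - f x) has_integral (\<mu> * F (c + pi) - \<mu> * F c)) {c..c+pi}"
  proof (rule fundamental_theorem_of_calculus)
    fix x assume "x \<in> {c..c+pi}"
    obtain j where j: "k = Suc j" using k gr0_implies_Suc by blast
    define d where "d = D x"
    have d: "d > 0" using D by (simp add: d_def)
    have S: "\<mu> * (sin x)\<^sup>2 = d - 1" by (simp add: d_def D_def)
    have C: "\<mu> * (cos x)\<^sup>2 = 1 + \<mu> - d" by (simp add: d_def D_def cos_squared_eq algebra_simps)
    have DD: "(D has_real_derivative 2 * \<mu> * sin x * cos x) (at x)"
      unfolding D_def by (auto intro!: derivative_eq_intros simp: power2_eq_square)
    have SC: "((\<lambda>x. sin x * cos x) has_real_derivative (cos x)\<^sup>2 - (sin x)\<^sup>2) (at x)"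
      by (auto intro!: derivative_eq_intros simp: power2_eq_square)
    have "(F has_real_derivative
        (((cos x)\<^sup>2 - (sin x)\<^sup>2) * d ^ k - sin x * cos x * (real k * d ^ j * (2 * \<mu> * sin x * cos x))) / (d ^ k * d ^ k)) (at x)"
      using DERIV_divide[OF SC DERIV_power[OF DD, of k]] D[of x] unfolding F_def d_def j
      by (simp add: mult_ac)
    from DERIV_cmult[OF this, of \<mu>]
    have "((\<lambda>x. \<mu> * F x) has_real_derivative
        ((\<mu> * (cos x)\<^sup>2 - \<mu> * (sin x)\<^sup>2) * d ^ k - 2 * real k * d ^ j * (\<mu> * (sin x)\<^sup>2) * (\<mu> * (cos x)\<^sup>2)) / (d ^ k * d ^ k)) (at x)"
      by (rule DERIV_cong) (simp add: field_simps power2_eq_square)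
    also have "((\<mu> * (cos x)\<^sup>2 - \<mu> * (sin x)\<^sup>2) * d ^ k - 2 * real k * d ^ j * (\<mu> * (sin x)\<^sup>2) * (\<mu> * (cos x)\<^sup>2)) / (d ^ k * d ^ k)
        = - f x"
      unfolding S C f_def d_def[symmetric] j using d
      by (simp add: field_simps power2_eq_square)
    finally show "((\<lambda>x. \<mu> * F x) has_vector_derivative - f x) (at x within {c..c+pi})"
      by (simp add: has_real_derivative_iff_has_vector_derivative has_vector_derivative_at_within)
  qed auto
  also have "F (c + pi) = F c" by (simp add: F_def D_def)
  finally have "((\<lambda>x. - f x) has_integral 0) {c..c+pi}"
    by simp
  from has_integral_neg[OF this] have 0: "(f has_integral 0) {c..c+pi}"
    by simp
  have "((\<lambda>x. ((2 * real k - 1) * (2 + \<mu>) * (1 / D x ^ k) - (2 * real k - 2) * (1 / D x ^ (k - 1)) - f x) * (1 / (2 * real k * (1 + \<mu>))))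
      has_integral ((2 * real k - 1) * (2 + \<mu>) * B - (2 * real k - 2) * A - 0) * (1 / (2 * real k * (1 + \<mu>)))) {c..c+pi}"
    by (intro has_integral_mult_left has_integral_diff has_integral_mult_right 0)
       (use A B in \<open>simp_all add: D_def\<close>)
  moreover have "((2 * real k - 1) * (2 + \<mu>) * (1 / D x ^ k) - (2 * real k - 2) * (1 / D x ^ (k - 1)) - f x) * (1 / (2 * real k * (1 + \<mu>)))
       = 1 / D x ^ (k + 1)" for x
  proof -
    have "1 + \<mu> \<noteq> 0" "k \<noteq> 0" using k \<mu> by auto
    thus ?thesis unfolding f_def by (simp del: power_Suc add: mult.assoc[symmetric])
  qed
  ultimately show ?thesis by (simp add: D_def)
qed

lemma has_integral_inverse_power4_one_plus_sin2:
  fixes \<mu> c :: real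
  assumes "\<mu> \<ge> 0"
  defines "s \<equiv> 1 / sqrt (1 + \<mu>)"
  shows "((\<lambda>x. 1 / (1 + \<mu> * (sin x)\<^sup>2) ^ 4) has_integral
     pi * (5 * s + 3 * s ^ 3 + 3 * s ^ 5 + 5 * s ^ 7) / 16) {c..c+pi}"
proof -
  have s: "s > 0" "\<mu> = 1 / s\<^sup>2 - 1" using assms by (auto simp: s_def power_divide)
  have s': "1 + \<mu> = 1 / s\<^sup>2" "2 + \<mu> = (1 + s\<^sup>2) / s\<^sup>2" using s by (simp_all add: field_simps)
  have 0: "((\<lambda>x. 1 / (1 + \<mu> * (sin x)\<^sup>2) ^ 0) has_integral pi) {c..c+pi}"
    using has_integral_const_real[of "1::real" c "c+pi"] by simp
  have 1: "((\<lambda>x. 1 / (1 + \<mu> * (sin x)\<^sup>2) ^ 1) has_integral pi * s) {c..c+pi}"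
    using has_integral_inverse_one_plus_sin2[OF assms(1), of c] by (simp add: s_def)
  have step: "((\<lambda>x. 1 / (1 + \<mu> * (sin x)\<^sup>2) ^ (k + 1)) has_integral C) {c..c+pi}"
    if "k > 0" "((\<lambda>x. 1 / (1 + \<mu> * (sin x)\<^sup>2) ^ (k - 1)) has_integral A) {c..c+pi}"
      "((\<lambda>x. 1 / (1 + \<mu> * (sin x)\<^sup>2) ^ k) has_integral B) {c..c+pi}"
      "C = ((2 * real k - 1) * (1 + s\<^sup>2) * B - (2 * real k - 2) * s\<^sup>2 * A) / (2 * real k)" for k A B C
  proof -
    have "((2 * real k - 1) * (2 + \<mu>) * B - (2 * real k - 2) * A) / (2 * real k * (1 + \<mu>)) = C"
      unfolding s' that(4) using s(1) that(1) by (simp add: field_simps)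
    thus ?thesis
      using has_integral_inverse_power_one_plus_sin2_step[OF assms(1) that(1-3)] by simp
  qed
  have 2: "((\<lambda>x. 1 / (1 + \<mu> * (sin x)\<^sup>2) ^ 2) has_integral pi * (s + s ^ 3) / 2) {c..c+pi}"
    using step[of 1 pi "pi * s" "pi * (s + s ^ 3) / 2"] 0 1
    by (simp add: algebra_simps power3_eq_cube power2_eq_square)
  have e3: "pi * (3 * s + 2 * s ^ 3 + 3 * s ^ 5) / 8
      = ((2 * real 2 - 1) * (1 + s\<^sup>2) * (pi * (s + s ^ 3) / 2) - (2 * real 2 - 2) * s\<^sup>2 * (pi * s)) / (2 * real 2)"
    by (simp add: eval_nat_numeral algebra_simps)
  have 3: "((\<lambda>x. 1 / (1 + \<mu> * (sin x)\<^sup>2) ^ (2 + 1)) has_integral pi * (3 * s + 2 * s ^ 3 + 3 * s ^ 5) / 8) {c..c+pi}"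
    by (rule step[OF _ _ 2 e3]) (use 1 in simp_all)
  have e4: "pi * (5 * s + 3 * s ^ 3 + 3 * s ^ 5 + 5 * s ^ 7) / 16
      = ((2 * real 3 - 1) * (1 + s\<^sup>2) * (pi * (3 * s + 2 * s ^ 3 + 3 * s ^ 5) / 8)
          - (2 * real 3 - 2) * s\<^sup>2 * (pi * (s + s ^ 3) / 2)) / (2 * real 3)"
    by (simp add: eval_nat_numeral algebra_simps add_divide_distrib)
  have "((\<lambda>x. 1 / (1 + \<mu> * (sin x)\<^sup>2) ^ (3 + 1)) has_integral
     pi * (5 * s + 3 * s ^ 3 + 3 * s ^ 5 + 5 * s ^ 7) / 16) {c..c+pi}"
    by (rule step[OF _ _ _ e4]) (use 2 3 in simp_all)
  thus ?thesis by simp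
qed

section \<open>Bounds for the angular mean\<close>

text \<open>The left side is \<open>16 t / s\<close> times the mean of \<open>1 / (1 + \<mu> sin\<^sup>2 x) ^ 4\<close>, called the profile, with
  \<open>s\<close> as in \<open>has_integral_inverse_power4_one_plus_sin2\<close> and \<open>s\<^sup>2 + t\<^sup>2 = 1\<close>; see
  \<open>profile_complement_form\<close>. Its maximum is near \<open>t = 3/5\<close>, so the difference of the two sides is
  divided by \<open>(t - 3/5)\<^sup>2\<close>. The quotient is \<open>Q + 4\<close>, and \<open>Q\<close> has positive coefficients in the
  Bernstein basis.\<close>

lemma flat_profile_bound:
  fixes t :: real
  assumes "0 \<le> t" "t \<le> 1"
  shows "16 * t - 24 * t ^ 3 + 18 * t ^ 5 - 5 * t ^ 7 \<le> 5712 / 1000"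
proof -
  define u where "u = 1 - t"
  have u: "u \<ge> 0" using assms by (simp add: u_def)
  define Q where "Q = (7238/625) * u^5 + (8213/125) * t * u^4 + (16216/125) * t^2 * u^3 + (12271/125) * t^3 * u^2
       + (2258/125) * t^4 * u + (313/625) * t^5"
  have q: "Q \<ge> 0" unfolding Q_def
    using assms u by (intro add_nonneg_nonneg mult_nonneg_nonneg) auto
  have "5712 / 1000 - (16 * t - 24 * t ^ 3 + 18 * t ^ 5 - 5 * t ^ 7)
      = (t - 3/5)\<^sup>2 * Q + (4 * (t - 3/5)\<^sup>2 + 1608/15625 - (347/3125) * t)"
    unfolding Q_def u_def by algebra
  also have "4 * (t - 3/5)\<^sup>2 + 1608/15625 - (347/3125) * t
      = (2 * t - 6/5 - 347/12500)\<^sup>2 + (1608/15625 - 347/3125 * (3/5) - (347/12500)\<^sup>2)"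
    by (simp add: power2_eq_square algebra_simps)
  also have "(t - 3/5)\<^sup>2 * Q + \<dots> \<ge> 0"
  proof (intro add_nonneg_nonneg mult_nonneg_nonneg q)
    show "(1608/15625 - 347/3125 * (3/5) - (347/12500)\<^sup>2 :: real) \<ge> 0"
      by (simp add: power2_eq_square)
  qed auto
  finally show ?thesis by simp
qed

text \<open>The two sides almost touch near \<open>t = 11/25\<close>, hence again a division by a square. The
  quotient \<open>Q\<close> is written in the Bernstein basis, where its coefficients are positive.\<close>

lemma tilted_profile_bound:
  fixes t :: real
  assumes "0 \<le> t" "t \<le> 1"
  shows "(181/100 - t\<^sup>2) * (16 * t - 24 * t ^ 3 + 18 * t ^ 5 - 5 * t ^ 7 - 344/100) \<le> 67968/10000 * t"
proof -
  define u where "u = 1 - t"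
  have u: "u \<ge> 0" using assms by (simp add: u_def)
  define Q where "Q = (78460049589/2441406250) * u^7 + (1251730073421/4882812500) * t * u^6
      + (1003632460697/1220703125) * t^2 * u^5 + (329238442474/244140625) * t^3 * u^4
      + (292204334299/244140625) * t^4 * u^3 + (701554190247/1220703125) * t^5 * u^2
      + (184263754824/1220703125) * t^6 * u + (85461900853/4882812500) * t^7"
  have q: "Q \<ge> 0" unfolding Q_def
    using assms u by (intro add_nonneg_nonneg mult_nonneg_nonneg) auto
  have "67968/10000 * t - (181/100 - t\<^sup>2) * (16 * t - 24 * t ^ 3 + 18 * t ^ 5 - 5 * t ^ 7 - 344/100)
     = (t - 11/25)\<^sup>2 * Q + (3533210803/762939453125 + 4852836709/122070312500 * t)"
    unfolding Q_def u_def by algebra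
  also have "\<dots> \<ge> 0" using q assms by (intro add_nonneg_nonneg mult_nonneg_nonneg) auto
  finally show ?thesis by simp
qed

lemma profile_complement_form:
  fixes s t :: real
  assumes "s\<^sup>2 + t\<^sup>2 = 1"
  shows "5 * s + 3 * s ^ 3 + 3 * s ^ 5 + 5 * s ^ 7 = s * (16 - 24 * t ^ 2 + 18 * t ^ 4 - 5 * t ^ 6)"
  using assms by algebra

text \<open>Both lines are nearly tangent to the left side, seen as a function of \<open>s / (2 t)\<close>. The line with \<open>\<alpha> = 0\<close> serves dimensions from 14 on, the other one the dimensions
  from 5 to 13. For the latter, \<open>s\<close> is bounded by the tangent
  \<open>(81/100 + s\<^sup>2) / (18/10)\<close> of the square root, which turns the claim into a polynomial
  inequality in \<open>t\<close>.\<close>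

lemma profile_le_line:
  fixes s t \<alpha> \<gamma> :: real
  assumes st: "s\<^sup>2 + t\<^sup>2 = 1" "s > 0" "t > 0"
    and line: "(\<alpha>, \<gamma>) \<in> {(59/250, 43/100), (0, 357/500)}"
  shows "(5 * s + 3 * s ^ 3 + 3 * s ^ 5 + 5 * s ^ 7) / 16 \<le> \<alpha> + \<gamma> * (s / (2 * t))"
proof -
  define h where "h = 16 * t - 24 * t ^ 3 + 18 * t ^ 5 - 5 * t ^ 7"
  have t1: "t \<le> 1"
    using st by (metis abs_le_square_iff abs_of_pos abs_one add.commute less_eq_real_def one_power2 less_add_same_cancel1 zero_less_power2 not_le)
  have eq: "(5 * s + 3 * s ^ 3 + 3 * s ^ 5 + 5 * s ^ 7) * t = s * h"
    unfolding profile_complement_form[OF st(1)] h_def by (simp add: eval_nat_numeral algebra_simps)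
  have "s * (h - 8 * \<gamma>) \<le> 16 * \<alpha> * t"
  proof (cases "h \<le> 8 * \<gamma>")
    case True
    have "s * (h - 8 * \<gamma>) \<le> 0" using True st by (simp add: mult_nonneg_nonpos)
    also have "0 \<le> 16 * \<alpha> * t" using line st by auto
    finally show ?thesis .
  next
    case False
    have ab: "\<alpha> = 59/250" "\<gamma> = 43/100"
      using False line flat_profile_bound[of t] st t1 by (auto simp: h_def)
    \<comment> \<open>The tangent of the square root at \<open>81/100\<close>, taken at \<open>s\<^sup>2 = 1 - t\<^sup>2\<close>.\<close>
    have "0 \<le> (s - 9/10)\<^sup>2" by simp
    hence "18/10 * s \<le> 181/100 - t\<^sup>2" using st(1) by (simp add: power2_eq_square algebra_simps)
    hence "18/10 * s * (h - 8 * \<gamma>) \<le> (181/100 - t\<^sup>2) * (h - 8 * \<gamma>)"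
      using False by (intro mult_right_mono) auto
    also have "\<dots> \<le> 67968/10000 * t"
      using tilted_profile_bound[of t] st t1 by (simp add: h_def ab)
    finally show ?thesis by (simp add: ab)
  qed
  moreover have "(16 * \<alpha> + 8 * \<gamma> * (s / t)) * t = 16 * \<alpha> * t + 8 * \<gamma> * s"
    using st by (simp add: distrib_right)
  ultimately have "s * h \<le> (16 * \<alpha> + 8 * \<gamma> * (s / t)) * t"
    by (simp add: algebra_simps)
  hence "5 * s + 3 * s ^ 3 + 3 * s ^ 5 + 5 * s ^ 7 \<le> 16 * \<alpha> + 8 * \<gamma> * (s / t)"
    unfolding eq[symmetric] using st by (subst (asm) mult_le_cancel_right_pos) auto
  thus ?thesis using st by (simp add: field_simps)
qed

text \<open>The mean over the angle of the excess factor, for every phase \<open>c\<close>, in the form in which it occurs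
  after a quarter turn; \<open>q\<close> is the squared norm of the pair.\<close>

definition angular_bound :: "real \<Rightarrow> real \<Rightarrow> real \<Rightarrow> bool" where
  "angular_bound b A B \<longleftrightarrow> (\<forall>q>0. \<forall>c.
     integral {c..c+pi} (\<lambda>x. (1 + q\<^sup>2 / (4 * (1 + q)) * (sin x)\<^sup>2) powr (- b)) \<le> pi * (A + B / q))"

lemma one_plus_sin2_powr_integrable:
  fixes \<kappa> b c d :: real
  assumes "\<kappa> \<ge> 0"
  shows "(\<lambda>x. (1 + \<kappa> * (sin x)\<^sup>2) powr (- b)) integrable_on {c..d}"
proof (rule integrable_continuous_real, intro continuous_intros ballI)
  fix x :: real
  have "0 < 1 + \<kappa> * (sin x)\<^sup>2" using assms by (simp add: add_pos_nonneg)
  thus "1 + \<kappa> * (sin x)\<^sup>2 \<noteq> 0" by simp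
qed

lemma angular_bound_trivial:
  assumes "b \<ge> 0"
  shows "angular_bound b 1 0"
  unfolding angular_bound_def
proof (intro allI impI)
  fix q c :: real assume q: "q > 0"
  have "integral {c..c+pi} (\<lambda>x. (1 + q\<^sup>2 / (4 * (1 + q)) * (sin x)\<^sup>2) powr (- b)) \<le> integral {c..c+pi} (\<lambda>x. 1)"
    using assms q
    by (intro integral_le one_plus_sin2_powr_integrable) (auto simp: powr_minus_divide divide_le_eq_1 intro!: ge_one_powr_ge_zero)
  thus "integral {c..c+pi} (\<lambda>x. (1 + q\<^sup>2 / (4 * (1 + q)) * (sin x)\<^sup>2) powr (- b)) \<le> pi * (1 + 0 / q)"
    by simp
qed

text \<open>Bernoulli's inequality for the exponent \<open>b / 4\<close>. Four factors are kept, since a single one would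
  lose too much in the mean over the angle.\<close>

lemma powr_ge_linear_power4:
  fixes b x :: real
  assumes b: "b \<ge> 4" and x: "x \<ge> 0"
  shows "(1 + b / 4 * x) ^ 4 \<le> (1 + x) powr b"
proof -
  have "1 + b / 4 * x \<le> (1 + x) powr (b / 4)"
  proof (cases "x = 0")
    case False
    hence x: "x > 0" using x by simp
    have "\<exists>z>0. z < x \<and> (1 + x) powr (b/4) - (1 + 0) powr (b/4) = (x - 0) * (b / 4 * (1 + z) powr (b / 4 - 1))"
      by (rule MVT2[OF x]) (auto intro!: derivative_eq_intros)
    then obtain z where z: "z > 0" "z < x" "(1 + x) powr (b/4) - 1 = x * (b / 4 * (1 + z) powr (b / 4 - 1))"
      by auto
    have "1 \<le> (1 + z) powr (b / 4 - 1)" using z b by (intro ge_one_powr_ge_zero) auto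
    hence "x * (b / 4 * 1) \<le> x * (b / 4 * (1 + z) powr (b / 4 - 1))"
      using x b by (intro mult_left_mono) auto
    thus ?thesis using z(3) by (simp add: mult_ac)
  qed auto
  hence "(1 + b / 4 * x) ^ 4 \<le> ((1 + x) powr (b / 4)) ^ 4"
    using b x by (intro power_mono) auto
  also have "\<dots> = (1 + x) powr b"
    using x by (simp add: powr_powr powr_realpow[symmetric] powr_def exp_of_nat_mult[symmetric])
  finally show ?thesis .
qed

text \<open>The mean is at most \<open>\<alpha> + \<gamma> / sqrt (b \<kappa>)\<close> with \<open>1 / sqrt \<kappa> = 2 sqrt ((1 / q) (1 + 1 / q))\<close>. The
  inequality of the means, with a free parameter \<open>\<tau>\<close>, makes this affine in \<open>1 / q\<close>.\<close>

lemma angular_bound_line: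
  fixes b \<tau> \<alpha> \<gamma> :: real
  assumes b: "b \<ge> 4" and \<tau>: "\<tau> > 0"
    and line: "(\<alpha>, \<gamma>) \<in> {(59/250, 43/100), (0, 357/500)}"
  shows "angular_bound b (\<alpha> + \<gamma> / (sqrt b * \<tau>)) (\<gamma> * (\<tau> + 1 / \<tau>) / sqrt b)"
  unfolding angular_bound_def
proof (intro allI impI)
  fix q c :: real assume q: "q > 0"
  define \<kappa> where "\<kappa> = q\<^sup>2 / (4 * (1 + q))"
  define \<mu> where "\<mu> = b / 4 * \<kappa>"
  have \<kappa>: "\<kappa> > 0" and \<mu>: "\<mu> > 0" using q b by (auto simp: \<kappa>_def \<mu>_def)
  define s where "s = 1 / sqrt (1 + \<mu>)"
  define t where "t = sqrt \<mu> / sqrt (1 + \<mu>)"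
  have st: "s\<^sup>2 + t\<^sup>2 = 1" "s > 0" "t > 0"
    using \<mu> by (auto simp: s_def t_def power_divide add_divide_distrib[symmetric])
  have pos: "0 < 1 + y * (sin x)\<^sup>2" if "y > 0" for x y :: real
    using that by (simp add: add_pos_nonneg)
  note I4 = has_integral_inverse_power4_one_plus_sin2[of \<mu> c, folded s_def]
  have "integral {c..c+pi} (\<lambda>x. (1 + \<kappa> * (sin x)\<^sup>2) powr (- b)) \<le> integral {c..c+pi} (\<lambda>x. 1 / (1 + \<mu> * (sin x)\<^sup>2) ^ 4)"
  proof (intro integral_le one_plus_sin2_powr_integrable)
    fix x
    show "(1 + \<kappa> * (sin x)\<^sup>2) powr (- b) \<le> 1 / (1 + \<mu> * (sin x)\<^sup>2) ^ 4"
      using powr_ge_linear_power4[OF b, of "\<kappa> * (sin x)\<^sup>2"] pos[OF \<kappa>, of x] pos[OF \<mu>, of x] \<kappa>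
      by (simp add: powr_minus_divide \<mu>_def mult.assoc field_simps)
  qed (use I4 \<mu> \<kappa> in auto)
  also have "\<dots> = pi * ((5 * s + 3 * s ^ 3 + 3 * s ^ 5 + 5 * s ^ 7) / 16)"
    using I4 \<mu> by (simp add: integral_unique)
  also have "\<dots> \<le> pi * (\<alpha> + \<gamma> * (s / (2 * t)))"
    using profile_le_line[OF st line] by (intro mult_left_mono) auto
  finally have 1: "integral {c..c+pi} (\<lambda>x. (1 + \<kappa> * (sin x)\<^sup>2) powr (- b)) \<le> pi * (\<alpha> + \<gamma> * (s / (2 * t)))" .
  have "s / (2 * t) = 2 * sqrt (1 + q) / (sqrt b * q)"
  proof -
    have "\<mu> = (sqrt b * q / (4 * sqrt (1 + q)))\<^sup>2"
      using q b by (simp add: \<mu>_def \<kappa>_def power_divide power_mult_distrib)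
    hence "sqrt \<mu> = sqrt b * q / (4 * sqrt (1 + q))"
      using q b by (simp add: real_sqrt_unique)
    moreover have "s / (2 * t) = 1 / (2 * sqrt \<mu>)"
      using \<mu> by (simp add: s_def t_def)
    ultimately show ?thesis by simp
  qed
  also have "\<dots> \<le> (\<tau> / q + (1 + 1 / q) / \<tau>) / sqrt b"
  proof -
    have "2 * sqrt (1 + q) \<le> \<tau> + (1 + q) / \<tau>"
    proof -
      have "0 \<le> (\<tau> - sqrt (1 + q))\<^sup>2 / \<tau>" using \<tau> by simp
      also have "\<dots> = \<tau> + (1 + q) / \<tau> - 2 * sqrt (1 + q)"
        using \<tau> q by (simp add: power2_eq_square field_simps)
      finally show ?thesis by simp
    qed
    hence "2 * sqrt (1 + q) / (sqrt b * q) \<le> (\<tau> + (1 + q) / \<tau>) / (sqrt b * q)"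
      using b q by (intro divide_right_mono) auto
    also have "\<dots> = (\<tau> / q + (1 + 1 / q) / \<tau>) / sqrt b"
      using q \<tau> b by (simp add: field_simps)
    finally show ?thesis .
  qed
  finally have 2: "\<gamma> * (s / (2 * t)) \<le> \<gamma> * ((\<tau> / q + (1 + 1 / q) / \<tau>) / sqrt b)"
    using line by (intro mult_left_mono) auto
  have "\<alpha> + \<gamma> * ((\<tau> / q + (1 + 1 / q) / \<tau>) / sqrt b) = \<alpha> + \<gamma> / (sqrt b * \<tau>) + \<gamma> * (\<tau> + 1 / \<tau>) / sqrt b / q"
    using q \<tau> b by (simp add: field_simps)
  with 2 have "\<alpha> + \<gamma> * (s / (2 * t)) \<le> \<alpha> + \<gamma> / (sqrt b * \<tau>) + \<gamma> * (\<tau> + 1 / \<tau>) / sqrt b / q"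
    by linarith
  from order_trans[OF 1 mult_left_mono[OF this, of pi]]
  show "integral {c..c+pi} (\<lambda>x. (1 + q\<^sup>2 / (4 * (1 + q)) * (sin x)\<^sup>2) powr (- b))
      \<le> pi * (\<alpha> + \<gamma> / (sqrt b * \<tau>) + \<gamma> * (\<tau> + 1 / \<tau>) / sqrt b / q)"
    by (simp add: \<kappa>_def)
qed

text \<open>The number \<open>1.5954\<close> is just below \<open>4 / sqrt (2 \<pi>)\<close>.\<close>

lemma line_value_bound:
  fixes n :: nat
  assumes n: "n \<ge> 5"
  defines "m \<equiv> (real n - 1) / 2"
  obtains \<alpha> \<gamma> :: real where "(\<alpha>, \<gamma>) \<in> {(59/250, 43/100), (0, 357/500)}"
    "\<alpha> * sqrt (m + 1) + 2 * \<gamma> * (1 + 3 / (4 * m)) \<le> 1.5954"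
proof (cases "n \<ge> 14")
  case True
  hence "m \<ge> 13/2" by (simp add: m_def)
  hence "3 / (4 * m) \<le> 3 / (4 * (13/2))" by (intro divide_left_mono) auto
  thus ?thesis by (intro that[of 0 "357/500"]) auto
next
  case False
  have sq: "sqrt (m + 1) \<le> r" if "m + 1 \<le> r\<^sup>2" "r \<ge> 0" for r
    using that by (simp add: real_le_lsqrt m_def)
  from False n have "n = 5 \<or> n = 6 \<or> n = 7 \<or> n = 8 \<or> n = 9 \<or> n = 10 \<or> n = 11 \<or> n = 12 \<or> n = 13"
    by arith
  hence "59/250 * sqrt (m + 1) + 2 * (43/100) * (1 + 3 / (4 * m)) \<le> 1.5954"
    apply (elim disjE)
    using sq[of "1.7321"] apply (simp add: m_def power2_eq_square)
    using sq[of "1.871"] apply (simp add: m_def power2_eq_square)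
    using sq[of "2"] apply (simp add: m_def power2_eq_square)
    using sq[of "2.1214"] apply (simp add: m_def power2_eq_square)
    using sq[of "2.2361"] apply (simp add: m_def power2_eq_square)
    using sq[of "2.3453"] apply (simp add: m_def power2_eq_square)
    using sq[of "2.4495"] apply (simp add: m_def power2_eq_square)
    using sq[of "2.5496"] apply (simp add: m_def power2_eq_square)
    using sq[of "2.6458"] apply (simp add: m_def power2_eq_square)
    done
  thus ?thesis by (intro that[of "59/250" "43/100"]) auto
qed

text \<open>Since \<open>Gamma (a + 1/2) / Gamma a \<ge> sqrt (2 a / \<pi>)\<close>, the choice \<open>A = 1\<close>, \<open>B = 0\<close> works as soon as
  \<open>\<pi> \<beta> \<le> 16 a\<close>. Otherwise \<open>n \<ge> 5\<close> and \<open>\<beta> = (1 + x) (n + 1) / 2\<close> with \<open>x \<le> 1/4\<close>. Passing from \<open>x = 0\<close> to \<open>x\<close>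
  multiplies the left side by at most \<open>(1 + x) powr (3/2)\<close> and the lower bound for the right side by at
  least as much, so the case \<open>x = 0\<close> decides; that one is \<open>line_value_bound\<close>.\<close>

lemma angular_bound_sufficient:
  fixes \<beta> b :: real and n :: nat
  assumes n: "n \<ge> 1" and \<beta>: "\<beta> \<ge> (real n + 1) / 2" and b: "b = \<beta> + (real n + 1) / 2"
  defines "m \<equiv> (real n - 1) / 2"
  obtains A B where "A \<ge> 0" "B \<ge> 0" "n = 1 \<Longrightarrow> B = 0" "angular_bound b A B"
    "sqrt (2 * \<beta>) * (A + B * \<beta> / m) \<le> 4 * (Gamma (\<beta> - n / 2 + 1/2) / Gamma (\<beta> - n / 2))"
proof -
  define a where "a = \<beta> - n / 2"
  define R where "R = Gamma (a + 1/2) / Gamma a"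
  have a: "a \<ge> 1/2" using \<beta> by (simp add: a_def field_simps)
  have "R > 0" unfolding R_def using a by (intro divide_pos_pos Gamma_real_pos) auto
  moreover have "2 * a / pi \<le> R\<^sup>2" unfolding R_def by (rule Gamma_half_step_lower[OF a])
  ultimately have R: "sqrt (2 * a / pi) \<le> R" by (simp add: real_le_lsqrt)
  have \<beta>0: "\<beta> \<ge> 1" using \<beta> n by simp
  show thesis
  proof (cases "pi * \<beta> \<le> 16 * a")
    case True
    have "sqrt (2 * \<beta>) \<le> sqrt (16 * (2 * a / pi))"
      using True by (simp add: field_simps)
    also have "\<dots> = 4 * sqrt (2 * a / pi)" by (subst real_sqrt_mult) simp
    also have "\<dots> \<le> 4 * R" using R by simp
    finally show ?thesis
      using n \<beta> b by (intro that[of 1 0] angular_bound_trivial) (auto simp: R_def a_def)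
  next
    case False
    have "16 * a < pi * \<beta>" using False by simp
    also have "\<dots> \<le> 3.1416 * \<beta>" using pi_approx \<beta>0 by (intro mult_right_mono) auto
    finally have small: "12.8584 * \<beta> < 8 * real n" by (simp add: a_def)
    have n5: "n \<ge> 5"
    proof (rule ccontr)
      assume "\<not> n \<ge> 5"
      hence "real n \<le> 4" by simp
      with small \<beta> show False by simp
    qed
    have m: "m \<ge> 2" using n5 by (simp add: m_def)
    define x where "x = \<beta> / (m + 1) - 1"
    have bx: "\<beta> = (m + 1) * (1 + x)" using m by (simp add: x_def)
    have bm: "b = \<beta> + m + 1" by (simp add: b m_def field_simps)
    have ax: "2 * a = 1 + 2 * (m + 1) * x"
      unfolding a_def bx by (simp add: m_def field_simps)
    have x0: "x \<ge> 0" using \<beta> m unfolding x_def by (simp add: m_def field_simps)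
    have x1: "x \<le> 1/4"
    proof -
      have "\<beta> \<le> 5/4 * (m + 1)" using small of_nat_0_le_iff[of n, where 'a=real] by (simp add: m_def field_simps)
      thus ?thesis using m unfolding x_def by (simp add: field_simps)
    qed
    obtain \<alpha> \<gamma> :: real where line: "(\<alpha>, \<gamma>) \<in> {(59/250, 43/100), (0, 357/500)}"
      and val: "\<alpha> * sqrt (m + 1) + 2 * \<gamma> * (1 + 3 / (4 * m)) \<le> 1.5954"
      using line_value_bound[OF n5] unfolding m_def by blast
    have ag: "\<alpha> \<ge> 0" "\<gamma> \<ge> 0" using line by auto
    \<comment> \<open>The choice of \<open>\<tau>\<close> that minimises \<open>A + B * \<beta> / m\<close>.\<close>
    define \<tau> where "\<tau> = sqrt ((\<beta> + m) / \<beta>)"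
    have \<tau>: "\<tau> > 0" "\<tau>\<^sup>2 = (\<beta> + m) / \<beta>" using \<beta>0 m by (auto simp: \<tau>_def)
    have b4: "b \<ge> 4" using m \<beta>0 bm by simp
    define A B where "A = \<alpha> + \<gamma> / (sqrt b * \<tau>)" and "B = \<gamma> * (\<tau> + 1 / \<tau>) / sqrt b"
    have ang: "angular_bound b A B" unfolding A_def B_def by (rule angular_bound_line[OF b4 \<tau>(1) line])
    have "A + B * \<beta> / m = \<alpha> + \<gamma> / sqrt b * (1 / \<tau> + (\<tau> + 1 / \<tau>) * \<beta> / m)"
      unfolding A_def B_def using \<tau> b4 m by (simp add: field_simps)
    also have "1 / \<tau> + (\<tau> + 1 / \<tau>) * \<beta> / m = 2 * \<beta> * \<tau> / m"
    proof -
      have q2: "m + \<tau>\<^sup>2 * \<beta> + \<beta> = 2 * \<beta> * \<tau>\<^sup>2" unfolding \<tau>(2) using \<beta>0 by (simp add: field_simps)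
      have q1: "1 / \<tau> + (\<tau> + 1 / \<tau>) * \<beta> / m = (m + \<tau>\<^sup>2 * \<beta> + \<beta>) / (\<tau> * m)"
        using \<tau>(1) m by (simp add: add_divide_distrib power2_eq_square distrib_right)
      show ?thesis unfolding q1 q2 using \<tau>(1) by (simp add: power2_eq_square)
    qed
    finally have E: "A + B * \<beta> / m = \<alpha> + 2 * \<gamma> / m * (\<beta> * \<tau> / sqrt b)"
      by (simp add: field_simps)
    define w where "w = sqrt ((1 + x) ^ 3)"
    have w0: "w \<ge> 0" using x0 by (simp add: w_def)
    have w1: "sqrt \<beta> \<le> sqrt (m + 1) * w"
    proof -
      have "(1 + x) ^ 1 \<le> (1 + x) ^ 3" using x0 by (intro power_increasing) auto
      hence "\<beta> \<le> (m + 1) * (1 + x) ^ 3" unfolding bx using m by (intro mult_left_mono) auto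
      thus ?thesis unfolding w_def real_sqrt_mult[symmetric] by simp
    qed
    have w2: "sqrt \<beta> * (\<beta> * \<tau> / sqrt b) \<le> (m + 3/4) * w"
    proof -
      have "\<beta> + m \<le> (2 * m + 1) * (1 + x)" unfolding bx using m x0 by (simp add: algebra_simps)
      hence "\<beta>\<^sup>2 * (\<beta> + m) \<le> \<beta>\<^sup>2 * ((2 * m + 1) * (1 + x))" by (intro mult_left_mono) auto
      also have "\<dots> = (m + 1) * (m + 1/2) * (1 + x) ^ 3 * (2 * m + 2)"
        unfolding bx by algebra
      also have "\<dots> \<le> (m + 3/4)\<^sup>2 * (1 + x) ^ 3 * b"
      proof (intro mult_mono)
        show "(m + 1) * (m + 1/2) \<le> (m + 3/4)\<^sup>2" by (simp add: power2_eq_square field_simps)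
        show "2 * m + 2 \<le> b" using bm bx x0 m by (simp add: algebra_simps)
      qed (use m x0 in auto)
      finally have "\<beta>\<^sup>2 * (\<beta> + m) / b \<le> (m + 3/4)\<^sup>2 * (1 + x) ^ 3"
        using b4 by (simp add: divide_le_eq)
      hence "sqrt (\<beta>\<^sup>2 * (\<beta> + m) / b) \<le> sqrt ((m + 3/4)\<^sup>2 * (1 + x) ^ 3)"
        by (rule real_sqrt_le_mono)
      moreover have "sqrt (\<beta>\<^sup>2 * (\<beta> + m) / b) = sqrt \<beta> * (\<beta> * \<tau> / sqrt b)"
        using \<beta>0 by (simp add: \<tau>_def real_sqrt_mult real_sqrt_divide)
      ultimately show ?thesis using m by (simp add: real_sqrt_mult w_def)
    qed
    have "sqrt \<beta> * (A + B * \<beta> / m) = \<alpha> * sqrt \<beta> + 2 * \<gamma> / m * (sqrt \<beta> * (\<beta> * \<tau> / sqrt b))"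
      unfolding E by (simp add: algebra_simps)
    also have "\<dots> \<le> \<alpha> * (sqrt (m + 1) * w) + 2 * \<gamma> / m * ((m + 3/4) * w)"
      using ag m w1 w2 by (intro add_mono mult_left_mono) auto
    also have "\<dots> = (\<alpha> * sqrt (m + 1) + 2 * \<gamma> * (1 + 3 / (4 * m))) * w"
      using m by (simp add: field_simps)
    also have "\<dots> \<le> 1.5954 * w" using val w0 by (intro mult_right_mono) auto
    finally have 1: "sqrt \<beta> * (A + B * \<beta> / m) \<le> 1.5954 * w" .
    have "2 * (1.5954\<^sup>2) * pi \<le> 16" using pi_approx by (simp add: power2_eq_square)
    hence "2 * 1.5954\<^sup>2 * (1 + x) ^ 3 \<le> 16 / pi * (1 + x) ^ 3"
      using x0 by (intro mult_right_mono) (auto simp: field_simps)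
    also have "\<dots> \<le> 16 / pi * (2 * a)"
    proof (intro mult_left_mono)
      have "x * x \<le> x * (1/4)" using x0 x1 by (intro mult_left_mono) auto
      moreover have "x * x * x \<le> (x * (1/4)) * (1/4)" using calculation x0 x1 by (intro mult_mono) auto
      moreover have "2 * 3 * x \<le> 2 * (m + 1) * x" using m x0 by (intro mult_right_mono) auto
      moreover have "(1 + x) ^ 3 = 1 + 3 * x + 3 * (x * x) + x * x * x"
        by (simp add: power3_eq_cube algebra_simps)
      ultimately show "(1 + x) ^ 3 \<le> 2 * a" unfolding ax using x0 by linarith
    qed auto
    finally have "sqrt (2 * 1.5954\<^sup>2 * (1 + x) ^ 3) \<le> sqrt (16 * (2 * a / pi))"
      by (intro real_sqrt_le_mono) (simp add: field_simps)
    also have "\<dots> = 4 * sqrt (2 * a / pi)" by (subst real_sqrt_mult) simp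
    finally have 2: "sqrt 2 * (1.5954 * w) \<le> 4 * R"
      using R by (simp add: real_sqrt_mult w_def)
    have "sqrt (2 * \<beta>) * (A + B * \<beta> / m) = sqrt 2 * (sqrt \<beta> * (A + B * \<beta> / m))"
      by (simp add: real_sqrt_mult)
    also have "\<dots> \<le> sqrt 2 * (1.5954 * w)" using 1 by (intro mult_left_mono) auto
    finally have "sqrt (2 * \<beta>) * (A + B * \<beta> / m) \<le> 4 * R" using 2 by linarith
    moreover have "A \<ge> 0" "B \<ge> 0" unfolding A_def B_def using ag b4 \<tau> by auto
    ultimately show ?thesis
      using ang n5 by (intro that[of A B]) (auto simp: R_def a_def)
  qed
qed

section \<open>Gaussian integrals and orthogonal invariance\<close>

lemma nn_integral_lborel_translate:
  fixes h :: "'a::euclidean_space \<Rightarrow> ennreal"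
  assumes [measurable]: "h \<in> borel_measurable borel"
  shows "(\<integral>\<^sup>+x. h (c + x) \<partial>lborel) = (\<integral>\<^sup>+x. h x \<partial>lborel)"
proof -
  have "(\<integral>\<^sup>+x. h x \<partial>lborel) = (\<integral>\<^sup>+x. h x \<partial>distr lborel borel ((+) c))"
    by (simp add: lborel_distr_plus)
  also have "\<dots> = (\<integral>\<^sup>+x. h (c + x) \<partial>lborel)" by (subst nn_integral_distr) auto
  finally show ?thesis ..
qed

lemma nn_integral_lborel_scale:
  fixes h :: "'a::euclidean_space \<Rightarrow> ennreal"
  assumes [measurable]: "h \<in> borel_measurable borel" and c: "c > 0"
  shows "(\<integral>\<^sup>+x. h x \<partial>lborel) = ennreal (c ^ DIM('a)) * (\<integral>\<^sup>+x. h (c *\<^sub>R x) \<partial>lborel)"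
  using c by (subst lborel_affine[of c 0]) (simp_all add: nn_integral_density nn_integral_distr nn_integral_cmult)

lemma gaussian_nn_integral_real:
  fixes s :: real
  assumes "s > 0"
  shows "(\<integral>\<^sup>+x. ennreal (exp (- s * x\<^sup>2)) \<partial>lborel) = ennreal (sqrt (pi / s))"
    and "(\<integral>\<^sup>+x. ennreal (\<bar>x\<bar> * exp (- s * x\<^sup>2)) \<partial>lborel) = ennreal (1 / s)"
proof -
  define \<sigma> where "\<sigma> = sqrt (1 / (2 * s))"
  have \<sigma>: "\<sigma> > 0" "2 * \<sigma>\<^sup>2 = 1 / s" using assms by (auto simp: \<sigma>_def)
  have nd: "exp (- s * x\<^sup>2) = sqrt (pi / s) * normal_density 0 \<sigma> x" for x
  proof -
    have "2 * pi * \<sigma>\<^sup>2 = pi / s" using \<sigma>(2) by (simp add: field_simps)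
    moreover have "x\<^sup>2 / (2 * \<sigma>\<^sup>2) = s * x\<^sup>2" unfolding \<sigma>(2) by simp
    ultimately show ?thesis using assms by (simp add: normal_density_def)
  qed
  have "(\<integral>\<^sup>+x. ennreal (exp (- s * x\<^sup>2)) \<partial>lborel) = (\<integral>\<^sup>+x. ennreal (sqrt (pi / s)) * ennreal (normal_density 0 \<sigma> x) \<partial>lborel)"
    unfolding nd using assms by (simp add: ennreal_mult)
  also have "\<dots> = ennreal (sqrt (pi / s)) * ennreal (integral\<^sup>L lborel (normal_density 0 \<sigma>))"
    using \<sigma> by (subst nn_integral_cmult) (simp_all add: nn_integral_eq_integral)
  also have "\<dots> = ennreal (sqrt (pi / s))" using \<sigma> by simp
  finally show "(\<integral>\<^sup>+x. ennreal (exp (- s * x\<^sup>2)) \<partial>lborel) = ennreal (sqrt (pi / s))" .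
  have "(\<integral>\<^sup>+x. ennreal (\<bar>x\<bar> * exp (- s * x\<^sup>2)) \<partial>lborel)
      = (\<integral>\<^sup>+x. ennreal (sqrt (pi / s)) * ennreal (normal_density 0 \<sigma> x * \<bar>x - 0\<bar> ^ (2 * 0 + 1)) \<partial>lborel)"
    unfolding nd using assms by (simp add: ennreal_mult[symmetric] mult_ac)
  also have "\<dots> = ennreal (sqrt (pi / s)) * ennreal (2 ^ 0 * \<sigma> ^ (2 * 0 + 1) * fact 0 * sqrt (2 / pi))"
    using \<sigma> normal_moment_abs_odd[of \<sigma> 0 0]
    by (subst nn_integral_cmult) (auto simp: nn_integral_eq_integral has_bochner_integral_iff)
  also have "\<dots> = ennreal (sqrt (pi / s) * (\<sigma> * sqrt (2 / pi)))"
    using assms by (simp add: ennreal_mult[symmetric] \<sigma>_def)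
  also have "sqrt (pi / s) * (\<sigma> * sqrt (2 / pi)) = sqrt ((1 / s)\<^sup>2)"
    unfolding \<sigma>_def real_sqrt_mult[symmetric] using assms by (simp add: power2_eq_square)
  finally show "(\<integral>\<^sup>+x. ennreal (\<bar>x\<bar> * exp (- s * x\<^sup>2)) \<partial>lborel) = ennreal (1 / s)" using assms by simp
qed

lemma exp_norm_prod:
  fixes x :: "'a::euclidean_space"
  shows "exp (- s * (norm x)\<^sup>2) = (\<Prod>b\<in>Basis. exp (- s * (x \<bullet> b)\<^sup>2))"
proof -
  have "(norm x)\<^sup>2 = (\<Sum>b\<in>Basis. (x \<bullet> b)\<^sup>2)"
    unfolding power2_norm_eq_inner euclidean_inner[of x x] by (simp add: power2_eq_square)
  thus ?thesis by (simp add: exp_sum[symmetric] sum_distrib_left sum_negf)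
qed

lemma sqrt_powr_half: "x > 0 \<Longrightarrow> sqrt x ^ k = x powr (real k / 2)"
  by (simp add: powr_half_sqrt[symmetric] powr_realpow[symmetric] powr_powr)

lemma gaussian_nn_integral:
  fixes s :: real
  assumes s: "s > 0"
  shows "(\<integral>\<^sup>+(x::'a::euclidean_space). ennreal (exp (- s * (norm x)\<^sup>2)) \<partial>lborel)
     = ennreal ((pi / s) powr (DIM('a) / 2))"
proof -
  have "(\<integral>\<^sup>+(x::'a). ennreal (exp (- s * (norm x)\<^sup>2)) \<partial>lborel)
      = (\<integral>\<^sup>+(x::'a). (\<Prod>b\<in>Basis. ennreal (exp (- s * (x \<bullet> b)\<^sup>2))) \<partial>lborel)"
    unfolding exp_norm_prod by (simp add: prod_ennreal)
  also have "\<dots> = (\<Prod>b\<in>(Basis::'a set). \<integral>\<^sup>+x. ennreal (exp (- s * x\<^sup>2)) \<partial>lborel)"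
    by (rule nn_integral_lborel_prod) simp_all
  also have "\<dots> = (\<Prod>b\<in>(Basis::'a set). ennreal (sqrt (pi / s)))"
    unfolding gaussian_nn_integral_real(1)[OF s] ..
  also have "\<dots> = ennreal ((pi / s) powr (DIM('a) / 2))"
    using s by (simp add: ennreal_power sqrt_powr_half)
  finally show ?thesis .
qed

lemma gaussian_abs_coord_nn_integral:
  fixes s :: real and i :: "'a::euclidean_space"
  assumes s: "s > 0" and i: "i \<in> Basis"
  shows "(\<integral>\<^sup>+(x::'a). ennreal (\<bar>x \<bullet> i\<bar> * exp (- s * (norm x)\<^sup>2)) \<partial>lborel)
     = ennreal (pi powr ((real DIM('a) - 1) / 2) * s powr (- ((real DIM('a) - 1) / 2 + 1)))"
proof -
  have "(\<integral>\<^sup>+(x::'a). ennreal (\<bar>x \<bullet> i\<bar> * exp (- s * (norm x)\<^sup>2)) \<partial>lborel)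
      = (\<integral>\<^sup>+(x::'a). (\<Prod>b\<in>Basis. ennreal ((if b = i then \<bar>x \<bullet> b\<bar> else 1) * exp (- s * (x \<bullet> b)\<^sup>2))) \<partial>lborel)"
    unfolding exp_norm_prod using i by (simp add: prod_ennreal prod.distrib prod.delta)
  also have "\<dots> = (\<Prod>b\<in>(Basis::'a set). \<integral>\<^sup>+x. ennreal ((if b = i then \<bar>x\<bar> else 1) * exp (- s * x\<^sup>2)) \<partial>lborel)"
    by (subst nn_integral_lborel_prod[where f="\<lambda>b x. ennreal ((if b = i then \<bar>x\<bar> else 1) * exp (- s * x\<^sup>2))"]) simp_all
  also have "\<dots> = (\<Prod>b\<in>(Basis::'a set). if b = i then ennreal (1 / s) else ennreal (sqrt (pi / s)))"
    using gaussian_nn_integral_real[OF s] by (intro prod.cong) auto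
  also have "\<dots> = ennreal (1 / s) * (\<Prod>b\<in>(Basis::'a set) - {i}. ennreal (sqrt (pi / s)))"
    using i by (subst prod.remove[of _ i]) (auto intro!: prod.cong arg_cong2[where f="(*)"])
  also have "\<dots> = ennreal (1 / s * (pi / s) powr (real (DIM('a) - 1) / 2))"
    using s i by (simp add: ennreal_power sqrt_powr_half ennreal_mult[symmetric])
  also have "1 / s * (pi / s) powr (real (DIM('a) - 1) / 2)
      = pi powr ((real DIM('a) - 1) / 2) * s powr (- ((real DIM('a) - 1) / 2 + 1))"
  proof -
    have "s powr (- (m + 1)) = 1 / (s powr m * s)" for m
      using s by (simp only: powr_minus_divide powr_add powr_one less_imp_le)
    thus ?thesis
      using s by (simp only:) (simp add: powr_divide of_nat_diff DIM_positive Suc_leI)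
  qed
  finally show ?thesis .
qed

text \<open>A translation invariant measure is a multiple of Lebesgue measure, and the multiple is found by
  testing a function that \<open>f\<close> preserves. Concretely, the integral of \<open>h (f x)\<close> is multiplied by that
  of the Gaussian \<open>G\<close>, and Tonelli's theorem with two translations moves \<open>f\<close> from \<open>h\<close> to \<open>G\<close>.\<close>

lemma nn_integral_lborel_orthogonal:
  fixes f :: "'a::euclidean_space \<Rightarrow> 'a" and h :: "'a \<Rightarrow> ennreal"
  assumes f: "orthogonal_transformation f" and [measurable]: "h \<in> borel_measurable borel"
  shows "(\<integral>\<^sup>+x. h (f x) \<partial>lborel) = (\<integral>\<^sup>+x. h x \<partial>lborel)"
proof -
  have lin: "linear f" and nf: "norm (f v) = norm v" for v
    using f by (auto simp: orthogonal_transformation)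
  have inj: "inj f"
    using lin nf by (metis linear_injective_0 norm_eq_zero)
  hence surj: "surj f" by (rule linear_injective_imp_surjective[OF lin _ refl])
  have [measurable]: "f \<in> borel_measurable borel"
    using lin by (intro borel_measurable_continuous_onI linear_continuous_on linear_linear[THEN iffD1])
                 (auto simp: linear_conv_bounded_linear)
  define G :: "'a \<Rightarrow> ennreal" where "G = (\<lambda>x. ennreal (exp (- 1 * (norm x)\<^sup>2)))"
  have [measurable]: "G \<in> borel_measurable borel" unfolding G_def by measurable
  define Z where "Z = (\<integral>\<^sup>+x. G x \<partial>lborel)"
  have Z: "Z = ennreal (pi powr (DIM('a) / 2))"
    unfolding Z_def G_def by (subst gaussian_nn_integral) auto
  have Gt: "(\<integral>\<^sup>+x. G (y - f x) \<partial>lborel) = Z" for y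
  proof -
    obtain u where u: "y = f u" using surj by blast
    have "G (y - f x) = G (- u + x)" for x
      unfolding u G_def using nf[of "u - x"] lin by (simp add: linear_diff norm_minus_commute)
    thus ?thesis unfolding Z_def by (simp only: nn_integral_lborel_translate[OF \<open>G \<in> borel_measurable borel\<close>])
  qed
  have ht: "(\<integral>\<^sup>+x. h (f x + y) \<partial>lborel) = (\<integral>\<^sup>+x. h (f x) \<partial>lborel)" for y
  proof -
    obtain u where u: "y = f u" using surj by blast
    have "(\<integral>\<^sup>+x. h (f x + y) \<partial>lborel) = (\<integral>\<^sup>+x. h (f (u + x)) \<partial>lborel)"
      unfolding u using lin by (simp add: linear_add add.commute)
    also have "\<dots> = (\<integral>\<^sup>+x. h (f x) \<partial>lborel)"
      by (rule nn_integral_lborel_translate) simp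
    finally show ?thesis .
  qed
  have "(\<integral>\<^sup>+x. h (f x) \<partial>lborel) * Z = (\<integral>\<^sup>+y. \<integral>\<^sup>+x. G y * h (f x + y) \<partial>lborel \<partial>lborel)"
    unfolding Z_def by (simp add: nn_integral_cmult nn_integral_multc ht mult.commute)
  also have "\<dots> = (\<integral>\<^sup>+x. \<integral>\<^sup>+y. G y * h (f x + y) \<partial>lborel \<partial>lborel)"
    by (rule lborel_pair.Fubini') simp
  also have "\<dots> = (\<integral>\<^sup>+x. \<integral>\<^sup>+y. G (y - f x) * h y \<partial>lborel \<partial>lborel)"
  proof (rule nn_integral_cong)
    fix x
    show "(\<integral>\<^sup>+y. G y * h (f x + y) \<partial>lborel) = (\<integral>\<^sup>+y. G (y - f x) * h y \<partial>lborel)"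
      using nn_integral_lborel_translate[of "\<lambda>y. G (y - f x) * h y" "f x"] by simp
  qed
  also have "\<dots> = (\<integral>\<^sup>+y. \<integral>\<^sup>+x. G (y - f x) * h y \<partial>lborel \<partial>lborel)"
    by (rule lborel_pair.Fubini') simp
  also have "\<dots> = Z * (\<integral>\<^sup>+y. h y \<partial>lborel)"
    by (simp add: nn_integral_multc Gt nn_integral_cmult)
  finally have "Z * (\<integral>\<^sup>+x. h (f x) \<partial>lborel) = Z * (\<integral>\<^sup>+y. h y \<partial>lborel)" by (simp add: mult.commute)
  moreover have "Z \<noteq> 0" "Z \<noteq> top" unfolding Z by auto
  ultimately show ?thesis by (metis ennreal_mult_cancel_left)
qed

text \<open>The reflection in the hyperplane orthogonal to \<open>a - b\<close>.\<close>

lemma orthogonal_transformation_between_units: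
  fixes a b :: "'a::euclidean_space"
  assumes "norm a = 1" "norm b = 1"
  obtains f where "orthogonal_transformation f" "f a = b"
proof (cases "a = b")
  case True
  show ?thesis by (rule that[of id]) (use True in \<open>auto simp: orthogonal_transformation_def linear_iff\<close>)
next
  case False
  define v where "v = a - b"
  have vv: "v \<bullet> v \<noteq> 0" using False by (simp add: v_def)
  have ab: "a \<bullet> a = 1" "b \<bullet> b = 1" using assms by (auto simp: norm_eq_1)
  define f where "f x = x - (2 * (x \<bullet> v) / (v \<bullet> v)) *\<^sub>R v" for x
  have "linear f"
    by (rule linearI) (simp_all add: f_def inner_add_left algebra_simps add_divide_distrib)
  moreover have "f x \<bullet> f y = x \<bullet> y" for x y
    using vv by (simp add: f_def inner_diff_left inner_diff_right inner_commute field_simps)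
  moreover have "2 * (a \<bullet> v) = v \<bullet> v"
    by (simp add: v_def inner_diff_left inner_diff_right ab inner_commute)
  hence "f a = b" using vv by (simp add: f_def v_def)
  ultimately show ?thesis by (intro that[of f]) (auto simp: orthogonal_transformation_def)
qed

lemma Gamma_nn_integral_scaled:
  fixes c \<alpha> :: real
  assumes "c > 0" "\<alpha> > 0"
  shows "(\<integral>\<^sup>+t. ennreal (indicator {0..} t * t powr (\<alpha> - 1) * exp (- c * t)) \<partial>lborel) = ennreal (Gamma \<alpha> * c powr (- \<alpha>))"
proof -
  have "ennreal (Gamma \<alpha>) = (\<integral>\<^sup>+t. ennreal (indicator {0..} t * t powr (\<alpha> - 1) / exp t) \<partial>lborel)"
    by (rule Gamma_conv_nn_integral_real) fact
  also have "\<dots> = ennreal \<bar>c\<bar> * (\<integral>\<^sup>+t. ennreal (indicator {0..} (0 + c * t) * (0 + c * t) powr (\<alpha> - 1) / exp (0 + c * t)) \<partial>lborel)"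
    using assms by (intro nn_integral_real_affine) auto
  also have "(\<integral>\<^sup>+t. ennreal (indicator {0..} (0 + c * t) * (0 + c * t) powr (\<alpha> - 1) / exp (0 + c * t)) \<partial>lborel)
     = (\<integral>\<^sup>+t. ennreal (c powr (\<alpha> - 1)) * ennreal (indicator {0..} t * t powr (\<alpha> - 1) * exp (- c * t)) \<partial>lborel)"
    using assms by (intro nn_integral_cong)
      (auto simp: ennreal_mult[symmetric] indicator_def powr_mult exp_minus field_simps zero_le_mult_iff)
  also have "\<dots> = ennreal (c powr (\<alpha> - 1)) * (\<integral>\<^sup>+t. ennreal (indicator {0..} t * t powr (\<alpha> - 1) * exp (- c * t)) \<partial>lborel)"
    by (rule nn_integral_cmult) simp
  finally have "ennreal (Gamma \<alpha>) = ennreal (c powr \<alpha>) * (\<integral>\<^sup>+t. ennreal (indicator {0..} t * t powr (\<alpha> - 1) * exp (- c * t)) \<partial>lborel)"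
    using assms by (simp add: mult.assoc[symmetric] ennreal_mult[symmetric] powr_diff)
  hence "ennreal (c powr (- \<alpha>)) * ennreal (Gamma \<alpha>)
      = ennreal (c powr (- \<alpha>) * c powr \<alpha>) * (\<integral>\<^sup>+t. ennreal (indicator {0..} t * t powr (\<alpha> - 1) * exp (- c * t)) \<partial>lborel)"
    by (simp add: ennreal_mult mult.assoc)
  thus ?thesis using assms Gamma_real_pos[of \<alpha>]
    by (simp add: powr_minus ennreal_mult[symmetric] mult.commute)
qed

text \<open>The weight \<open>(1 + |x|\<^sup>2) powr - \<alpha>\<close> is a Gamma mixture of the Gaussians \<open>exp (- s |x|\<^sup>2)\<close>, so an
  integral against it follows from the Gaussian integrals.\<close>

lemma nn_integral_inverse_power_weight:
  fixes h :: "'a::euclidean_space \<Rightarrow> real"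
  assumes [measurable]: "h \<in> borel_measurable borel" and h: "\<And>x. h x \<ge> 0"
    and \<alpha>: "\<alpha> > k" "\<alpha> > 0" and C: "C \<ge> 0"
    and gauss: "\<And>s. s > 0 \<Longrightarrow> (\<integral>\<^sup>+x. ennreal (h x * exp (- s * (norm x)\<^sup>2)) \<partial>lborel) = ennreal (C * s powr (- k))"
  shows "(\<integral>\<^sup>+x. ennreal (h x * (1 + (norm x)\<^sup>2) powr (- \<alpha>)) \<partial>lborel) = ennreal (C * Gamma (\<alpha> - k) / Gamma \<alpha>)"
proof -
  have G: "Gamma \<alpha> > 0" "Gamma (\<alpha> - k) > 0" using \<alpha> by (auto intro!: Gamma_real_pos)
  define w where "w = (\<lambda>t::real. indicator {0..} t * t powr (\<alpha> - 1) * exp (- t))"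
  have [measurable]: "w \<in> borel_measurable borel" unfolding w_def by measurable
  have w: "w t \<ge> 0" for t by (simp add: w_def)
  have "ennreal (Gamma \<alpha>) * (\<integral>\<^sup>+x. ennreal (h x * (1 + (norm x)\<^sup>2) powr (- \<alpha>)) \<partial>lborel)
      = (\<integral>\<^sup>+x. ennreal (h x) * ennreal (Gamma \<alpha> * (1 + (norm x)\<^sup>2) powr (- \<alpha>)) \<partial>lborel)"
    using h G by (subst nn_integral_cmult[symmetric]) (auto simp: ennreal_mult[symmetric] mult_ac)
  also have "\<dots> = (\<integral>\<^sup>+x. \<integral>\<^sup>+t. ennreal (h x * exp (- t * (norm x)\<^sup>2)) * ennreal (w t) \<partial>lborel \<partial>lborel)"
  proof (rule nn_integral_cong)
    fix x :: 'a
    have "1 + (norm x)\<^sup>2 > 0" by (simp add: add_pos_nonneg)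
    hence "ennreal (h x) * ennreal (Gamma \<alpha> * (1 + (norm x)\<^sup>2) powr (- \<alpha>))
      = (\<integral>\<^sup>+t. ennreal (h x) * ennreal (indicator {0..} t * t powr (\<alpha> - 1) * exp (- (1 + (norm x)\<^sup>2) * t)) \<partial>lborel)"
      using \<alpha> by (subst Gamma_nn_integral_scaled[symmetric]) (auto simp: nn_integral_cmult)
    also have "\<dots> = (\<integral>\<^sup>+t. ennreal (h x * exp (- t * (norm x)\<^sup>2)) * ennreal (w t) \<partial>lborel)"
      using h by (intro nn_integral_cong)
        (auto simp: ennreal_mult[symmetric] w_def indicator_def exp_add[symmetric] algebra_simps)
    finally show "ennreal (h x) * ennreal (Gamma \<alpha> * (1 + (norm x)\<^sup>2) powr (- \<alpha>)) = \<dots>" .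
  qed
  also have "\<dots> = (\<integral>\<^sup>+t. \<integral>\<^sup>+x. ennreal (h x * exp (- t * (norm x)\<^sup>2)) * ennreal (w t) \<partial>lborel \<partial>lborel)"
    by (rule lborel_pair.Fubini') simp
  also have "\<dots> = (\<integral>\<^sup>+t. ennreal C * ennreal (indicator {0..} t * t powr (\<alpha> - k - 1) * exp (- 1 * t)) \<partial>lborel)"
  proof (rule nn_integral_cong_AE)
    show "AE t in lborel. (\<integral>\<^sup>+x. ennreal (h x * exp (- t * (norm x)\<^sup>2)) * ennreal (w t) \<partial>lborel)
       = ennreal C * ennreal (indicator {0..} t * t powr (\<alpha> - k - 1) * exp (- 1 * t))"
      using AE_lborel_singleton[of 0]
    proof eventually_elim
      case (elim t)
      show ?case
      proof (cases "t > 0")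
        case True
        have "(\<integral>\<^sup>+x. ennreal (h x * exp (- t * (norm x)\<^sup>2)) * ennreal (w t) \<partial>lborel) = ennreal (C * t powr (- k)) * ennreal (w t)"
          using gauss[OF True] by (simp add: nn_integral_multc)
        also have "\<dots> = ennreal C * ennreal (indicator {0..} t * t powr (\<alpha> - k - 1) * exp (- 1 * t))"
          using True C by (simp add: ennreal_mult[symmetric] w_def powr_add[symmetric] mult_ac algebra_simps)
        finally show ?thesis .
      qed (use elim in \<open>simp add: w_def\<close>)
    qed
  qed
  also have "\<dots> = ennreal (C * Gamma (\<alpha> - k))"
    using \<alpha> C G by (subst nn_integral_cmult) (simp_all only: Gamma_nn_integral_scaled ennreal_mult, simp_all)
  finally have *: "ennreal (Gamma \<alpha>) * (\<integral>\<^sup>+x. ennreal (h x * (1 + (norm x)\<^sup>2) powr (- \<alpha>)) \<partial>lborel) = ennreal (C * Gamma (\<alpha> - k))" .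
  have "(\<integral>\<^sup>+x. ennreal (h x * (1 + (norm x)\<^sup>2) powr (- \<alpha>)) \<partial>lborel)
      = ennreal (1 / Gamma \<alpha>) * (ennreal (Gamma \<alpha>) * (\<integral>\<^sup>+x. ennreal (h x * (1 + (norm x)\<^sup>2) powr (- \<alpha>)) \<partial>lborel))"
    using G by (simp add: mult.assoc[symmetric] ennreal_mult[symmetric])
  also have "\<dots> = ennreal (C * Gamma (\<alpha> - k) / Gamma \<alpha>)"
    unfolding * using G C by (simp add: ennreal_mult[symmetric])
  finally show ?thesis .
qed

section \<open>Radial moments of the Cauchy weights\<close>

lemma nn_integral_abs_inner_radial:
  fixes e i :: "'a::euclidean_space" and \<psi> :: "real \<Rightarrow> real"
  assumes e: "norm e = 1" and i: "i \<in> Basis" and [measurable]: "\<psi> \<in> borel_measurable borel"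
  shows "(\<integral>\<^sup>+x. ennreal (\<bar>x \<bullet> e\<bar> * \<psi> (norm x)) \<partial>lborel) = (\<integral>\<^sup>+x. ennreal (\<bar>x \<bullet> i\<bar> * \<psi> (norm x)) \<partial>lborel)"
proof -
  obtain f where f: "orthogonal_transformation f" "f i = e"
    using orthogonal_transformation_between_units[of i e] e i by auto
  have "(\<integral>\<^sup>+x. ennreal (\<bar>x \<bullet> e\<bar> * \<psi> (norm x)) \<partial>lborel) = (\<integral>\<^sup>+x. ennreal (\<bar>f x \<bullet> e\<bar> * \<psi> (norm (f x))) \<partial>lborel)"
    by (rule nn_integral_lborel_orthogonal[OF f(1), symmetric]) simp
  also have "\<dots> = (\<integral>\<^sup>+x. ennreal (\<bar>x \<bullet> i\<bar> * \<psi> (norm x)) \<partial>lborel)"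
  proof -
    have "f x \<bullet> e = x \<bullet> i" for x
      using f(1) unfolding f(2)[symmetric] orthogonal_transformation_def by blast
    moreover have "norm (f x) = norm x" for x
      using f(1) by (simp add: orthogonal_transformation)
    ultimately show ?thesis by simp
  qed
  finally show ?thesis .
qed

lemma gaussian_abs_inner_nn_integral:
  fixes s :: real and e :: "'a::euclidean_space"
  assumes s: "s > 0" and e: "norm e = 1"
  shows "(\<integral>\<^sup>+x. ennreal (\<bar>x \<bullet> e\<bar> * exp (- s * (norm x)\<^sup>2)) \<partial>lborel)
     = ennreal (pi powr ((real DIM('a) - 1) / 2) * s powr (- ((real DIM('a) - 1) / 2 + 1)))"
  using nn_integral_abs_inner_radial[OF e SOME_Basis, of "\<lambda>r. exp (- s * r\<^sup>2)"]
    gaussian_abs_coord_nn_integral[OF s SOME_Basis] by simp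

text \<open>Dividing by \<open>|x|\<^sup>2\<close> amounts to integrating the Gaussian over its parameter from \<open>s\<close> to infinity.\<close>

lemma gaussian_abs_inner_over_norm2_nn_integral:
  fixes s :: real and e :: "'a::euclidean_space"
  assumes s: "s > 0" and e: "norm e = 1" and dim: "DIM('a) \<ge> 2"
  defines "m \<equiv> (real DIM('a) - 1) / 2"
  shows "(\<integral>\<^sup>+x. ennreal (\<bar>x \<bullet> e\<bar> / (norm x)\<^sup>2 * exp (- s * (norm x)\<^sup>2)) \<partial>lborel)
     = ennreal (pi powr m / m * s powr (- m))"
proof -
  have m: "m > 0" using dim by (simp add: m_def)
  have "(\<integral>\<^sup>+x. ennreal (\<bar>x \<bullet> e\<bar> / (norm x)\<^sup>2 * exp (- s * (norm x)\<^sup>2)) \<partial>lborel)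
     = (\<integral>\<^sup>+x. \<integral>\<^sup>+t. ennreal (\<bar>x \<bullet> e\<bar> * exp (- t * (norm x)\<^sup>2)) * indicator {s..} t \<partial>lborel \<partial>lborel)"
  proof (rule nn_integral_cong_AE)
    show "AE x in lborel. ennreal (\<bar>x \<bullet> e\<bar> / (norm x)\<^sup>2 * exp (- s * (norm x)\<^sup>2))
        = (\<integral>\<^sup>+t. ennreal (\<bar>x \<bullet> e\<bar> * exp (- t * (norm x)\<^sup>2)) * indicator {s..} t \<partial>lborel)"
      using AE_lborel_singleton[of "0::'a"]
    proof eventually_elim
      case (elim x)
      define c where "c = (norm x)\<^sup>2"
      have c: "c > 0" using elim by (simp add: c_def)
      have "((\<lambda>t. - (\<bar>x \<bullet> e\<bar> * exp (- t * c) / c)) \<longlongrightarrow> - (\<bar>x \<bullet> e\<bar> * 0 / c)) at_top"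
      proof (intro tendsto_intros filterlim_compose[OF exp_at_bot])
        have "filterlim (\<lambda>t. t * c) at_top at_top"
          using filterlim_tendsto_pos_mult_at_top[OF tendsto_const c filterlim_ident]
          by (simp add: mult.commute)
        thus "filterlim (\<lambda>t. - t * c) at_bot at_top"
          by (simp add: filterlim_uminus_at_bot)
      qed (use c in auto)
      hence "(\<integral>\<^sup>+t. ennreal (\<bar>x \<bullet> e\<bar> * exp (- t * c)) * indicator {s..} t \<partial>lborel)
          = ennreal (- (\<bar>x \<bullet> e\<bar> * 0 / c) - - (\<bar>x \<bullet> e\<bar> * exp (- s * c) / c))"
        using c by (intro nn_integral_FTC_atLeast) (auto intro!: derivative_eq_intros)
      thus ?case by (simp add: c_def)
    qed
  qed
  also have "\<dots> = (\<integral>\<^sup>+t. \<integral>\<^sup>+x. ennreal (\<bar>x \<bullet> e\<bar> * exp (- t * (norm x)\<^sup>2)) * indicator {s..} t \<partial>lborel \<partial>lborel)"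
    by (rule lborel_pair.Fubini') simp
  also have "\<dots> = (\<integral>\<^sup>+t. ennreal (pi powr m * t powr (- (m + 1))) * indicator {s..} t \<partial>lborel)"
    using s gaussian_abs_inner_nn_integral[OF _ e]
    by (intro nn_integral_cong) (auto simp: nn_integral_multc m_def indicator_def)
  also have "\<dots> = ennreal (- (pi powr m / m * 0) - - (pi powr m / m * s powr (- m)))"
  proof (rule nn_integral_FTC_atLeast)
    show "((\<lambda>t. - (pi powr m / m * t powr (- m))) \<longlongrightarrow> - (pi powr m / m * 0)) at_top"
      using m by (intro tendsto_intros tendsto_neg_powr filterlim_ident) auto
  next
    fix t assume "s \<le> t"
    with s have t: "t > 0" by simp
    show "((\<lambda>t. - (pi powr m / m * t powr (- m))) has_real_derivative pi powr m * t powr (- (m + 1))) (at t)"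
    proof -
      have eq: "- (m + 1) = - m - 1" by simp
      show ?thesis unfolding eq using t m by (auto intro!: derivative_eq_intros)
    qed
  qed auto
  finally show ?thesis by simp
qed

lemma cauchy_weight_nn_integral:
  fixes \<alpha> :: real
  assumes \<alpha>: "\<alpha> > DIM('a::euclidean_space) / 2"
  shows "(\<integral>\<^sup>+(x::'a). ennreal ((1 + (norm x)\<^sup>2) powr (- \<alpha>)) \<partial>lborel)
     = ennreal (pi powr (DIM('a) / 2) * Gamma (\<alpha> - DIM('a) / 2) / Gamma \<alpha>)"
proof -
  have "(\<integral>\<^sup>+(x::'a). ennreal (1 * (1 + (norm x)\<^sup>2) powr (- \<alpha>)) \<partial>lborel)
     = ennreal (pi powr (DIM('a) / 2) * Gamma (\<alpha> - DIM('a) / 2) / Gamma \<alpha>)"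
  proof (rule nn_integral_inverse_power_weight)
    fix s :: real assume s: "s > 0"
    show "(\<integral>\<^sup>+(x::'a). ennreal (1 * exp (- s * (norm x)\<^sup>2)) \<partial>lborel) = ennreal (pi powr (DIM('a) / 2) * s powr (- (DIM('a) / 2)))"
      using gaussian_nn_integral[OF s, where 'a='a] s by (simp add: powr_divide powr_minus_divide)
  qed (use \<alpha> in \<open>auto intro: le_less_trans[rotated]\<close>)
  thus ?thesis by simp
qed

text \<open>For \<open>DIM('a) = 1\<close> the integral of \<open>|x \<bullet> e| / |x|\<^sup>2\<close> diverges at 0, whence \<open>B = 0\<close> there; then also
  \<open>m = 0\<close>, and \<open>B * \<beta> / m\<close> is 0.\<close>

lemma abs_inner_weight_nn_integral:
  fixes e :: "'a::euclidean_space" and \<beta> A B :: real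
  assumes e: "norm e = 1" and \<beta>: "\<beta> > 0" and AB: "A \<ge> 0" "B \<ge> 0" and B0: "DIM('a) = 1 \<Longrightarrow> B = 0"
  defines "m \<equiv> (real DIM('a) - 1) / 2"
  shows "(\<integral>\<^sup>+x. ennreal (\<bar>x \<bullet> e\<bar> * (A + B / (norm x)\<^sup>2) * (1 + (norm x)\<^sup>2) powr (- (\<beta> + m + 1))) \<partial>lborel)
     = ennreal (pi powr m * Gamma \<beta> / Gamma (\<beta> + m + 1) * (A + B * \<beta> / m))"
proof -
  have m0: "m \<ge> 0" using DIM_positive[where 'a='a] by (simp add: m_def Suc_leI)
  define b where "b = \<beta> + m + 1"
  have G: "Gamma \<beta> > 0" "Gamma b > 0" using \<beta> m0 by (auto simp: b_def intro!: Gamma_real_pos)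
  have I1: "(\<integral>\<^sup>+x. ennreal (\<bar>x \<bullet> e\<bar> * (1 + (norm x)\<^sup>2) powr (- b)) \<partial>lborel) = ennreal (pi powr m * Gamma (b - (m + 1)) / Gamma b)"
  proof (rule nn_integral_inverse_power_weight)
    show "(\<integral>\<^sup>+x. ennreal (\<bar>x \<bullet> e\<bar> * exp (- s * (norm x)\<^sup>2)) \<partial>lborel) = ennreal (pi powr m * s powr (- (m + 1)))"
      if "s > 0" for s
      unfolding m_def by (rule gaussian_abs_inner_nn_integral[OF that e])
  qed (use \<beta> m0 in \<open>auto simp: b_def\<close>)
  have I2: "(\<integral>\<^sup>+x. ennreal (B * (\<bar>x \<bullet> e\<bar> / (norm x)\<^sup>2 * (1 + (norm x)\<^sup>2) powr (- b))) \<partial>lborel)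
      = ennreal (pi powr m * Gamma \<beta> / Gamma b * (B * \<beta> / m))"
  proof (cases "DIM('a) = 1")
    case True
    thus ?thesis using B0 by simp
  next
    case False
    hence d: "DIM('a) \<ge> 2" using DIM_positive[where 'a='a] by linarith
    hence m: "m > 0" by (simp add: m_def)
    have "(\<integral>\<^sup>+x. ennreal (\<bar>x \<bullet> e\<bar> / (norm x)\<^sup>2 * (1 + (norm x)\<^sup>2) powr (- b)) \<partial>lborel) = ennreal (pi powr m / m * Gamma (b - m) / Gamma b)"
    proof (rule nn_integral_inverse_power_weight)
      show "(\<integral>\<^sup>+x. ennreal (\<bar>x \<bullet> e\<bar> / (norm x)\<^sup>2 * exp (- s * (norm x)\<^sup>2)) \<partial>lborel) = ennreal (pi powr m / m * s powr (- m))"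
        if "s > 0" for s
        unfolding m_def by (rule gaussian_abs_inner_over_norm2_nn_integral[OF that e d])
    qed (use \<beta> m in \<open>auto simp: b_def\<close>)
    moreover have "Gamma (b - m) = \<beta> * Gamma \<beta>"
    proof -
      have "Gamma (\<beta> + 1) = \<beta> * Gamma \<beta>"
        using \<beta> by (intro Gamma_plus1) (auto elim!: nonpos_Ints_cases)
      thus ?thesis by (simp add: b_def)
    qed
    ultimately have "ennreal B * (\<integral>\<^sup>+x. ennreal (\<bar>x \<bullet> e\<bar> / (norm x)\<^sup>2 * (1 + (norm x)\<^sup>2) powr (- b)) \<partial>lborel)
        = ennreal (pi powr m * Gamma \<beta> / Gamma b * (B * \<beta> / m))"
      using AB by (simp add: ennreal_mult'[symmetric] mult_ac)
    thus ?thesis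
      unfolding ennreal_mult'[OF AB(2)] by (subst nn_integral_cmult) simp_all
  qed
  have "(\<integral>\<^sup>+x. ennreal (\<bar>x \<bullet> e\<bar> * (A + B / (norm x)\<^sup>2) * (1 + (norm x)\<^sup>2) powr (- b)) \<partial>lborel)
      = (\<integral>\<^sup>+x. ennreal A * ennreal (\<bar>x \<bullet> e\<bar> * (1 + (norm x)\<^sup>2) powr (- b))
            + ennreal (B * (\<bar>x \<bullet> e\<bar> / (norm x)\<^sup>2 * (1 + (norm x)\<^sup>2) powr (- b))) \<partial>lborel)"
    using AB by (intro nn_integral_cong) (simp add: ennreal_mult[symmetric] ennreal_plus[symmetric] algebra_simps del: ennreal_plus)
  also have "\<dots> = ennreal A * ennreal (pi powr m * Gamma (b - (m + 1)) / Gamma b) + ennreal (pi powr m * Gamma \<beta> / Gamma b * (B * \<beta> / m))"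
    unfolding I1[symmetric] I2[symmetric] by (subst nn_integral_add) (simp_all add: nn_integral_cmult)
  also have "\<dots> = ennreal (pi powr m * Gamma \<beta> / Gamma b * (A + B * \<beta> / m))"
  proof -
    define X where "X = pi powr m * Gamma \<beta> / Gamma b"
    have "X \<ge> 0" using G by (simp add: X_def)
    hence "ennreal A * ennreal X + ennreal (X * (B * \<beta> / m)) = ennreal (X * (A + B * \<beta> / m))"
      using AB \<beta> m0 by (simp add: ennreal_mult[symmetric] ennreal_plus[symmetric] distrib_left mult.commute del: ennreal_plus)
    thus ?thesis by (simp add: X_def b_def)
  qed
  finally show ?thesis by (simp add: b_def)
qed

section \<open>Averaging the pair weight over a quarter turn\<close>

definition pair_weight :: "real \<Rightarrow> 'a::real_inner \<Rightarrow> 'a \<Rightarrow> real" where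
  "pair_weight b x y = ((1 + (norm x)\<^sup>2) * (1 + (norm y)\<^sup>2)) powr (- b)"

text \<open>Simultaneous rotation of the two components: position and velocity at time \<open>t\<close> of the path that
  starts at \<open>x\<close> with velocity \<open>y\<close>.\<close>

definition rot :: "real \<Rightarrow> 'a::real_vector \<times> 'a \<Rightarrow> 'a \<times> 'a" where
  "rot t = (\<lambda>(x, y). (cos t *\<^sub>R x + sin t *\<^sub>R y, cos t *\<^sub>R y - sin t *\<^sub>R x))"

text \<open>The weight with which \<open>(z, w)\<close> occurs as position and velocity, at any time of the quarter turn,
  when the end points are weighted by \<open>pair_weight\<close>.\<close>

definition turned_weight :: "real \<Rightarrow> 'a::real_inner \<times> 'a \<Rightarrow> ennreal" where
  "turned_weight b p = (\<integral>\<^sup>+t. ennreal (case rot (- t) p of (x, y) \<Rightarrow> pair_weight b x y) * indicator {0..pi/2} t \<partial>lborel)"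

lemma rot_norms:
  fixes z w :: "'a::real_inner" and t :: real
  defines "x \<equiv> fst (rot (- t) (z, w))" and "y \<equiv> snd (rot (- t) (z, w))"
    and "q \<equiv> (norm z)\<^sup>2 + (norm w)\<^sup>2"
    and "D \<equiv> ((norm z)\<^sup>2 - (norm w)\<^sup>2) / 2 * cos (2 * t) - (z \<bullet> w) * sin (2 * t)"
  shows "(norm x)\<^sup>2 = q / 2 + D" "(norm y)\<^sup>2 = q / 2 - D"
proof -
  have c2: "cos (2 * t) = (cos t)\<^sup>2 - (sin t)\<^sup>2" "sin (2 * t) = 2 * sin t * cos t"
    by (simp_all add: cos_double sin_double)
  have 1: "(cos t)\<^sup>2 + (sin t)\<^sup>2 = 1" by simp
  have x: "(norm x)\<^sup>2 = (cos t)\<^sup>2 * (norm z)\<^sup>2 + (sin t)\<^sup>2 * (norm w)\<^sup>2 - 2 * sin t * cos t * (z \<bullet> w)"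
    unfolding x_def rot_def power2_norm_eq_inner
    by (simp add: inner_add_left inner_add_right inner_diff_left inner_diff_right inner_commute power2_eq_square algebra_simps)
  have y: "(norm y)\<^sup>2 = (cos t)\<^sup>2 * (norm w)\<^sup>2 + (sin t)\<^sup>2 * (norm z)\<^sup>2 + 2 * sin t * cos t * (z \<bullet> w)"
    unfolding y_def rot_def power2_norm_eq_inner
    by (simp add: inner_add_left inner_add_right inner_diff_left inner_diff_right inner_commute power2_eq_square algebra_simps)
  show "(norm x)\<^sup>2 = q / 2 + D" "(norm y)\<^sup>2 = q / 2 - D"
    unfolding x y q_def D_def c2 using 1 by algebra+
qed

text \<open>By \<open>rot_norms\<close> the product of the two factors is \<open>(1 + q / 2)\<^sup>2 - D\<^sup>2\<close>, where \<open>D\<close> is a harmonic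
  oscillation in \<open>2 t\<close>. Its squared amplitude \<open>M\<^sup>2\<close> is at most \<open>q\<^sup>2 / 4\<close> by the Cauchy-Schwarz
  inequality. Only the phase \<open>c\<close> depends on more than \<open>q\<close>.\<close>

lemma pair_weight_rot_le:
  fixes z w :: "'a::real_inner"
  assumes b: "b \<ge> 0"
  defines "q \<equiv> (norm z)\<^sup>2 + (norm w)\<^sup>2"
  obtains c where "\<And>t. (case rot (- t) (z, w) of (x, y) \<Rightarrow> pair_weight b x y)
     \<le> (1 + q) powr (- b) * (1 + q\<^sup>2 / (4 * (1 + q)) * (sin (c + 2 * t))\<^sup>2) powr (- b)"
proof -
  define A B where "A = ((norm z)\<^sup>2 - (norm w)\<^sup>2) / 2" and "B = z \<bullet> w"
  have q: "q \<ge> 0" by (simp add: q_def)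
  define M where "M = cmod (Complex A B)"
  define c where "c = Arg (Complex A B)"
  have AB: "A = M * cos c" "B = M * sin c"
    using rcis_cmod_Arg[of "Complex A B"] unfolding M_def c_def rcis_def
    by (metis Re_complex_of_real Im_complex_of_real complex.sel Re_rcis Im_rcis rcis_def)+
  have M: "M\<^sup>2 \<le> q\<^sup>2 / 4"
  proof -
    have "M\<^sup>2 = A\<^sup>2 + B\<^sup>2" by (simp add: M_def cmod_power2)
    also have "B\<^sup>2 \<le> (norm z)\<^sup>2 * (norm w)\<^sup>2"
      unfolding B_def using Cauchy_Schwarz_ineq[of z w] by (simp add: power2_norm_eq_inner)
    finally show ?thesis unfolding A_def q_def by (simp add: power2_eq_square field_simps)
  qed
  show ?thesis
  proof (rule that[of c])
    fix t
    define x y where "x = fst (rot (- t) (z, w))" and "y = snd (rot (- t) (z, w))"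
    define D where "D = A * cos (2 * t) - B * sin (2 * t)"
    have xy: "(norm x)\<^sup>2 = q / 2 + D" "(norm y)\<^sup>2 = q / 2 - D"
      unfolding x_def y_def q_def D_def A_def B_def by (rule rot_norms)+
    have "D = M * cos (c + 2 * t)" unfolding D_def AB by (simp add: cos_add algebra_simps)
    hence "D\<^sup>2 = M\<^sup>2 * (cos (c + 2 * t))\<^sup>2" by (simp add: power_mult_distrib)
    also have "\<dots> \<le> q\<^sup>2 / 4 * (cos (c + 2 * t))\<^sup>2" using M by (intro mult_right_mono) auto
    finally have D: "D\<^sup>2 \<le> q\<^sup>2 / 4 * (1 - (sin (c + 2 * t))\<^sup>2)" by (simp add: cos_squared_eq)
    define S where "S = (sin (c + 2 * t))\<^sup>2"
    have S: "S \<ge> 0" by (simp add: S_def)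
    have "(1 + q) * (1 + q\<^sup>2 / (4 * (1 + q)) * S) = (1 + q) + q\<^sup>2 / 4 * S"
      using q by (simp add: field_simps)
    also have "\<dots> \<le> (1 + (norm x)\<^sup>2) * (1 + (norm y)\<^sup>2)"
      unfolding xy using D unfolding S_def[symmetric] by (simp add: power2_eq_square field_simps)
    finally have "((1 + (norm x)\<^sup>2) * (1 + (norm y)\<^sup>2)) powr (- b) \<le> ((1 + q) * (1 + q\<^sup>2 / (4 * (1 + q)) * S)) powr (- b)"
      using b q S by (intro powr_mono2') (auto intro!: mult_pos_pos add_pos_nonneg)
    also have "\<dots> = (1 + q) powr (- b) * (1 + q\<^sup>2 / (4 * (1 + q)) * S) powr (- b)"
      using q S by (simp add: powr_mult)
    finally show "(case rot (- t) (z, w) of (x, y) \<Rightarrow> pair_weight b x y)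
     \<le> (1 + q) powr (- b) * (1 + q\<^sup>2 / (4 * (1 + q)) * (sin (c + 2 * t))\<^sup>2) powr (- b)"
      by (simp add: pair_weight_def x_def y_def S_def case_prod_beta)
  qed
qed

text \<open>As \<open>t\<close> runs through \<open>{0..\<pi>/2}\<close>, the angle \<open>c + 2 t\<close> runs through an interval of length \<open>\<pi>\<close>, so the
  phase \<open>c\<close> disappears.\<close>

lemma turned_weight_le:
  fixes z w :: "'a::real_inner"
  assumes b: "b \<ge> 0" and ang: "angular_bound b A B" and AB: "A \<ge> 0" "B \<ge> 0"
  defines "q \<equiv> (norm z)\<^sup>2 + (norm w)\<^sup>2"
  assumes q: "q > 0"
  shows "turned_weight b (z, w) \<le> ennreal (pi / 2 * (1 + q) powr (- b) * (A + B / q))"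
proof -
  obtain c where c: "\<And>t. (case rot (- t) (z, w) of (x, y) \<Rightarrow> pair_weight b x y)
     \<le> (1 + q) powr (- b) * (1 + q\<^sup>2 / (4 * (1 + q)) * (sin (c + 2 * t))\<^sup>2) powr (- b)"
    using pair_weight_rot_le[OF b, of z w] unfolding q_def by blast
  define F where "F x = (1 + q\<^sup>2 / (4 * (1 + q)) * (sin x)\<^sup>2) powr (- b)" for x
  have [measurable]: "F \<in> borel_measurable borel" unfolding F_def by measurable
  have "turned_weight b (z, w) \<le> (\<integral>\<^sup>+t. ennreal ((1 + q) powr (- b)) * (ennreal (F (c + 2 * t)) * indicator {c..c+pi} (c + 2 * t)) \<partial>lborel)"
    unfolding turned_weight_def
  proof (rule nn_integral_mono)
    fix t
    show "ennreal (case rot (- t) (z, w) of (x, y) \<Rightarrow> pair_weight b x y) * indicator {0..pi/2} t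
       \<le> ennreal ((1 + q) powr (- b)) * (ennreal (F (c + 2 * t)) * indicator {c..c+pi} (c + 2 * t))"
      using c[of t] by (auto simp: F_def ennreal_mult[symmetric] indicator_def intro!: ennreal_leI)
  qed
  also have "\<dots> = ennreal ((1 + q) powr (- b)) * (\<integral>\<^sup>+t. (ennreal (F (c + 2 * t)) * indicator {c..c+pi} (c + 2 * t)) \<partial>lborel)"
    by (rule nn_integral_cmult) simp
  also have "(\<integral>\<^sup>+t. (ennreal (F (c + 2 * t)) * indicator {c..c+pi} (c + 2 * t)) \<partial>lborel)
      = ennreal (1/2) * (\<integral>\<^sup>+x. ennreal (F x) * indicator {c..c+pi} x \<partial>lborel)"
  proof -
    have "ennreal (1/2) * ennreal \<bar>2\<bar> = 1" by (subst ennreal_mult[symmetric]) auto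
    thus ?thesis
      by (subst nn_integral_real_affine[of "\<lambda>x. ennreal (F x) * indicator {c..c+pi} x" 2 c])
         (simp_all only: mult.assoc[symmetric], simp_all)
  qed
  also have "(\<integral>\<^sup>+x. ennreal (F x) * indicator {c..c+pi} x \<partial>lborel) = ennreal (integral {c..c+pi} F)"
  proof -
    have "F integrable_on {c..c+pi}" unfolding F_def using q by (intro one_plus_sin2_powr_integrable) auto
    hence "(F has_integral integral {c..c+pi} F) {c..c+pi}" by (rule integrable_integral)
    from nn_integral_has_integral_lebesgue[OF _ this]
    show ?thesis by (simp add: F_def mult.commute ennreal_mult'' ennreal_indicator)
  qed
  also have "integral {c..c+pi} F \<le> pi * (A + B / q)"
    using ang q unfolding angular_bound_def F_def by blast
  hence "ennreal ((1 + q) powr (- b)) * (ennreal (1/2) * ennreal (integral {c..c+pi} F))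
     \<le> ennreal ((1 + q) powr (- b)) * (ennreal (1/2) * ennreal (pi * (A + B / q)))"
    by (intro mult_left_mono ennreal_leI) auto
  also have "\<dots> = ennreal (pi / 2 * (1 + q) powr (- b) * (A + B / q))"
    unfolding ennreal_mult'[OF powr_ge_zero, symmetric] ennreal_mult'[of "1/2", symmetric, simplified]
    by (subst ennreal_mult'[symmetric], simp)+ (simp add: mult_ac)
  finally show ?thesis .
qed

lemma turned_weight_measurable [measurable]:
  "turned_weight b \<in> borel_measurable (borel :: ('a::euclidean_space \<times> 'a) measure)"
proof -
  have "(\<lambda>(p, t). ennreal (case rot (- t) p of (x, y) \<Rightarrow> pair_weight b x y) * indicator {0..pi/2} t)
     \<in> borel_measurable ((borel :: ('a \<times> 'a) measure) \<Otimes>\<^sub>M lborel)"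
    unfolding pair_weight_def rot_def case_prod_beta
    by (simp add: borel_prod[symmetric]) measurable
  from lborel.borel_measurable_nn_integral[OF this]
  show ?thesis unfolding turned_weight_def .
qed

text \<open>After the substitution \<open>w = \<rho> *\<^sub>R w'\<close> with \<open>\<rho>\<^sup>2 = 1 + |z|\<^sup>2\<close> one has
  \<open>1 + q = \<rho>\<^sup>2 (1 + |w'|\<^sup>2)\<close> and \<open>q \<ge> |w'|\<^sup>2\<close>. Thus the case \<open>z = 0\<close> is extremal, and what remains is
  the moment computed in \<open>abs_inner_weight_nn_integral\<close>.\<close>

lemma flux_bound:
  fixes e z :: "'a::euclidean_space" and \<beta> b A B :: real
  assumes e: "norm e = 1" and \<beta>: "\<beta> > 0" and AB: "A \<ge> 0" "B \<ge> 0" and B0: "DIM('a) = 1 \<Longrightarrow> B = 0"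
  defines "m \<equiv> (real DIM('a) - 1) / 2"
  assumes b: "b = \<beta> + m + 1" and ang: "angular_bound b A B"
  shows "(\<integral>\<^sup>+w. ennreal \<bar>w \<bullet> e\<bar> * turned_weight b (z, w) \<partial>lborel)
     \<le> ennreal ((1 + (norm z)\<^sup>2) powr (- \<beta>) * (pi / 2 * (pi powr m * Gamma \<beta> / Gamma b * (A + B * \<beta> / m))))"
proof -
  have m0: "m \<ge> 0" using DIM_positive[where 'a='a] by (simp add: m_def Suc_leI)
  have b0: "b \<ge> 0" using b \<beta> m0 by simp
  have G: "Gamma \<beta> > 0" "Gamma b > 0" using b \<beta> m0 by (auto intro!: Gamma_real_pos)
  define \<rho> where "\<rho> = sqrt (1 + (norm z)\<^sup>2)"
  have \<rho>: "\<rho> > 0" "\<rho>\<^sup>2 = 1 + (norm z)\<^sup>2" by (auto simp: \<rho>_def add_pos_nonneg)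
  have \<rho>1: "\<rho> \<ge> 1" by (simp add: \<rho>_def)
  define q where "q w = (norm z)\<^sup>2 + (norm w)\<^sup>2" for w :: 'a
  define H where "H = (\<lambda>w. \<bar>w \<bullet> e\<bar> * (pi / 2 * (1 + q w) powr (- b) * (A + B / q w)))"
  have [measurable]: "H \<in> borel_measurable borel" unfolding H_def q_def by measurable
  have "(\<integral>\<^sup>+w. ennreal \<bar>w \<bullet> e\<bar> * turned_weight b (z, w) \<partial>lborel) \<le> (\<integral>\<^sup>+w. ennreal (H w) \<partial>lborel)"
  proof (rule nn_integral_mono_AE)
    show "AE w in lborel. ennreal \<bar>w \<bullet> e\<bar> * turned_weight b (z, w) \<le> ennreal (H w)"
      using AE_lborel_singleton[of "0::'a"]
    proof eventually_elim
      case (elim w)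
      hence "q w > 0" by (simp add: q_def add_nonneg_pos)
      hence "turned_weight b (z, w) \<le> ennreal (pi / 2 * (1 + q w) powr (- b) * (A + B / q w))"
        using turned_weight_le[OF b0 ang AB, of z w] by (simp add: q_def)
      hence "ennreal \<bar>w \<bullet> e\<bar> * turned_weight b (z, w)
         \<le> ennreal \<bar>w \<bullet> e\<bar> * ennreal (pi / 2 * (1 + q w) powr (- b) * (A + B / q w))"
        by (intro mult_left_mono) auto
      also have "\<dots> = ennreal (H w)" unfolding H_def by (rule ennreal_mult'[symmetric]) simp
      finally show ?case .
    qed
  qed
  also have "\<dots> = ennreal (\<rho> ^ DIM('a)) * (\<integral>\<^sup>+w. ennreal (H (\<rho> *\<^sub>R w)) \<partial>lborel)"
    using \<rho> by (intro nn_integral_lborel_scale) auto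
  also have "(\<integral>\<^sup>+w. ennreal (H (\<rho> *\<^sub>R w)) \<partial>lborel)
     \<le> (\<integral>\<^sup>+w. ennreal (\<rho> * (\<rho>\<^sup>2) powr (- b) * (pi / 2)) * ennreal (\<bar>w \<bullet> e\<bar> * (A + B / (norm w)\<^sup>2) * (1 + (norm w)\<^sup>2) powr (- b)) \<partial>lborel)"
  proof (rule nn_integral_mono_AE)
    show "AE w in lborel. ennreal (H (\<rho> *\<^sub>R w)) \<le> ennreal (\<rho> * (\<rho>\<^sup>2) powr (- b) * (pi / 2)) * ennreal (\<bar>w \<bullet> e\<bar> * (A + B / (norm w)\<^sup>2) * (1 + (norm w)\<^sup>2) powr (- b))"
      using AE_lborel_singleton[of "0::'a"]
    proof eventually_elim
      case (elim w)
      define r where "r = (norm w)\<^sup>2"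
      have r: "r > 0" using elim by (simp add: r_def)
      have qw: "q (\<rho> *\<^sub>R w) = (norm z)\<^sup>2 + \<rho>\<^sup>2 * r"
        by (simp add: q_def r_def power_mult_distrib)
      have "r \<le> \<rho>\<^sup>2 * r" using \<rho>1 r by (simp add: power2_eq_square mult_le_cancel_right1 less_eq_real_def[symmetric] mult_ge1_I)
      hence rq: "r \<le> q (\<rho> *\<^sub>R w)" unfolding qw by (simp add: add_increasing)
      have "1 + q (\<rho> *\<^sub>R w) = \<rho>\<^sup>2 * (1 + r)" unfolding qw \<rho>(2) by (simp add: algebra_simps)
      hence pw: "(1 + q (\<rho> *\<^sub>R w)) powr (- b) = (\<rho>\<^sup>2) powr (- b) * (1 + r) powr (- b)"
        using r by (simp add: powr_mult)
      have "A + B / q (\<rho> *\<^sub>R w) \<le> A + B / r"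
        using rq r AB by (intro add_left_mono divide_left_mono) auto
      hence "H (\<rho> *\<^sub>R w) \<le> \<bar>(\<rho> *\<^sub>R w) \<bullet> e\<bar> * (pi / 2 * ((\<rho>\<^sup>2) powr (- b) * (1 + r) powr (- b)) * (A + B / r))"
        unfolding H_def pw by (intro mult_left_mono) auto
      also have "\<dots> = \<rho> * (\<rho>\<^sup>2) powr (- b) * (pi / 2) * (\<bar>w \<bullet> e\<bar> * (A + B / r) * (1 + r) powr (- b))"
        using \<rho> by (simp add: abs_mult)
      finally show ?case using \<rho> by (simp add: r_def ennreal_mult'[symmetric] ennreal_leI)
    qed
  qed
  also have "\<dots> = ennreal (\<rho> * (\<rho>\<^sup>2) powr (- b) * (pi / 2)) * ennreal (pi powr m * Gamma \<beta> / Gamma b * (A + B * \<beta> / m))"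
    unfolding m_def b using abs_inner_weight_nn_integral[OF e \<beta> AB B0]
    by (subst nn_integral_cmult) (simp_all add: m_def)
  also have "ennreal (\<rho> ^ DIM('a)) * \<dots>
      = ennreal (\<rho> ^ DIM('a) * (\<rho> * (\<rho>\<^sup>2) powr (- b) * (pi / 2) * (pi powr m * Gamma \<beta> / Gamma b * (A + B * \<beta> / m))))"
    using \<rho> G AB \<beta> m0 by (simp add: ennreal_mult'[symmetric] ennreal_mult''[symmetric])
  also have "\<rho> ^ DIM('a) * (\<rho> * (\<rho>\<^sup>2) powr (- b) * (pi / 2) * (pi powr m * Gamma \<beta> / Gamma b * (A + B * \<beta> / m)))
     = (\<rho> ^ (DIM('a) + 1) * (\<rho>\<^sup>2) powr (- b)) * (pi / 2 * (pi powr m * Gamma \<beta> / Gamma b * (A + B * \<beta> / m)))"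
    by simp
  also have "\<rho> ^ (DIM('a) + 1) * (\<rho>\<^sup>2) powr (- b) = (1 + (norm z)\<^sup>2) powr (- \<beta>)"
  proof -
    have "\<rho> ^ (DIM('a) + 1) = (1 + (norm z)\<^sup>2) powr (real (DIM('a) + 1) / 2)"
      unfolding \<rho>_def by (rule sqrt_powr_half) (simp add: add_pos_nonneg)
    thus ?thesis unfolding \<rho>(2) by (simp add: powr_add[symmetric] b m_def field_simps)
  qed
  finally show ?thesis by (simp add: mult_left_mono)
qed

section \<open>Differences along quarter turns\<close>

lemma rot_add: "rot s (rot t p) = rot (s + t) p"
  by (simp add: rot_def case_prod_beta sin_add cos_add algebra_simps)

lemma rot_zero [simp]: "rot 0 p = p"
  by (simp add: rot_def case_prod_beta)

lemma orthogonal_transformation_rot: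
  "orthogonal_transformation (rot t :: 'a::euclidean_space \<times> 'a \<Rightarrow> 'a \<times> 'a)"
  unfolding orthogonal_transformation_def
proof (intro conjI allI)
  show "linear (rot t :: 'a \<times> 'a \<Rightarrow> 'a \<times> 'a)"
    by (rule linearI) (auto simp: rot_def algebra_simps)
  show "rot t p \<bullet> rot t q = p \<bullet> q" for p q :: "'a \<times> 'a"
  proof -
    obtain x y u v where pq: "p = (x, y)" "q = (u, v)" by (cases p, cases q)
    define C S where "C = cos t" and "S = sin t"
    have "rot t p \<bullet> rot t q = (C\<^sup>2 + S\<^sup>2) * (x \<bullet> u + y \<bullet> v)"
      unfolding pq rot_def C_def[symmetric] S_def[symmetric]
      by (simp add: inner_add_left inner_add_right inner_diff_left inner_diff_right power2_eq_square algebra_simps)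
    thus ?thesis by (simp add: pq C_def S_def)
  qed
qed

lemma abs_cos_diff_le: "\<bar>cos s - cos t\<bar> \<le> \<bar>s - t\<bar>" for s t :: real
proof -
  have "\<bar>cos s - cos t\<bar> = 2 * \<bar>sin ((s + t) / 2)\<bar> * \<bar>sin ((t - s) / 2)\<bar>"
    by (simp add: cos_diff_cos abs_mult)
  also have "\<dots> \<le> 2 * 1 * \<bar>(t - s) / 2\<bar>"
    by (intro mult_mono abs_sin_x_le_abs_x) auto
  finally show ?thesis by simp
qed

lemma abs_sin_diff_le: "\<bar>sin s - sin t\<bar> \<le> \<bar>s - t\<bar>" for s t :: real
proof -
  have "\<bar>sin s - sin t\<bar> = 2 * \<bar>sin ((s - t) / 2)\<bar> * \<bar>cos ((s + t) / 2)\<bar>"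
    by (simp add: sin_diff_sin abs_mult)
  also have "\<dots> \<le> 2 * \<bar>(s - t) / 2\<bar> * 1"
    by (intro mult_mono mult_left_mono abs_sin_x_le_abs_x) auto
  finally show ?thesis by simp
qed

lemma norm_fst_rot_diff_le:
  "norm (fst (rot s p) - fst (rot t p)) \<le> \<bar>s - t\<bar> * (norm (fst p) + norm (snd p))"
  for p :: "'a::real_normed_vector \<times> 'a"
proof -
  have "fst (rot s p) - fst (rot t p) = (cos s - cos t) *\<^sub>R fst p + (sin s - sin t) *\<^sub>R snd p"
    by (simp add: rot_def case_prod_beta algebra_simps)
  also have "norm \<dots> \<le> \<bar>cos s - cos t\<bar> * norm (fst p) + \<bar>sin s - sin t\<bar> * norm (snd p)"
    by (rule order_trans[OF norm_triangle_ineq]) simp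
  also have "\<dots> \<le> \<bar>s - t\<bar> * norm (fst p) + \<bar>s - t\<bar> * norm (snd p)"
    by (intro add_mono mult_right_mono abs_cos_diff_le abs_sin_diff_le) auto
  finally show ?thesis by (simp add: algebra_simps)
qed

text \<open>A fundamental theorem of calculus for Lipschitz functions, with difference quotients for the
  derivative: the integral of \<open>G (t + \<delta>) - G t\<close> telescopes to the integrals of \<open>G\<close> over intervals of
  length \<open>\<delta>\<close> at the two ends.\<close>

lemma increment_le_average_increment:
  fixes G :: "real \<Rightarrow> real"
  assumes lip: "\<And>s t. \<bar>G s - G t\<bar> \<le> M * \<bar>s - t\<bar>" and M: "M \<ge> 0" and \<delta>: "\<delta> > 0" and ab: "a \<le> b"
  shows "\<bar>G b - G a\<bar> \<le> integral {a..b} (\<lambda>t. \<bar>G (t + \<delta>) - G t\<bar> / \<delta>) + 2 * M * \<delta>"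
proof -
  have contG: "continuous_on S G" for S
    using lip by (intro lipschitz_on_continuous_on[of M] lipschitz_onI) (auto simp: dist_real_def M)
  have intG: "G integrable_on {s..t}" for s t
    by (intro integrable_continuous_real contG)
  have int_shift: "(\<lambda>t. G (t + \<delta>)) integrable_on {a..b}"
    by (intro integrable_continuous_real continuous_on_compose2[OF contG] continuous_intros) auto
  have sh: "integral {a..b} (\<lambda>t. G (t + \<delta>)) = integral {a+\<delta>..b+\<delta>} G"
    using integral_shift_real_ivl[of "a + \<delta>" \<delta> "b + \<delta>" G] by simp
  have near: "\<bar>integral {c..c+\<delta>} G - \<delta> * G c\<bar> \<le> M * \<delta> * \<delta>" for c
  proof -
    have "integral {c..c+\<delta>} G - \<delta> * G c = integral {c..c+\<delta>} (\<lambda>t. G t - G c)"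
      using \<delta> by (subst integral_diff) (auto intro: intG)
    moreover have "norm (integral {c..c+\<delta>} (\<lambda>t. G t - G c)) \<le> M * \<delta> * (c + \<delta> - c)"
    proof (rule integral_bound)
      fix t assume "t \<in> {c..c+\<delta>}"
      hence "M * \<bar>t - c\<bar> \<le> M * \<delta>" using M by (intro mult_left_mono) auto
      thus "norm (G t - G c) \<le> M * \<delta>" using lip[of t c] by simp
    qed (use \<delta> in \<open>auto intro!: continuous_intros contG\<close>)
    ultimately show ?thesis by simp
  qed
  have "integral {a..b+\<delta>} G = integral {a..a+\<delta>} G + integral {a+\<delta>..b+\<delta>} G"
    using \<delta> ab by (intro Henstock_Kurzweil_Integration.integral_combine[symmetric] intG) auto
  moreover have "integral {a..b+\<delta>} G = integral {a..b} G + integral {b..b+\<delta>} G"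
    using \<delta> ab by (intro Henstock_Kurzweil_Integration.integral_combine[symmetric] intG) auto
  ultimately have "integral {a..b} (\<lambda>t. G (t + \<delta>) - G t) = integral {b..b+\<delta>} G - integral {a..a+\<delta>} G"
    using sh int_shift intG by (simp add: integral_diff)
  hence "\<delta> * (G b - G a) \<le> integral {a..b} (\<lambda>t. G (t + \<delta>) - G t) + 2 * (M * \<delta> * \<delta>)"
    "\<delta> * (G a - G b) \<le> - integral {a..b} (\<lambda>t. G (t + \<delta>) - G t) + 2 * (M * \<delta> * \<delta>)"
    using near[of a] near[of b] by (simp_all only: right_diff_distrib)
  moreover have "norm (integral {a..b} (\<lambda>t. G (t + \<delta>) - G t)) \<le> integral {a..b} (\<lambda>t. \<bar>G (t + \<delta>) - G t\<bar>)"
    by (rule integral_norm_bound_integral)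
       (auto intro!: integrable_diff int_shift intG integrable_continuous_real continuous_intros continuous_on_compose2[OF contG])
  moreover have "\<delta> * \<bar>G b - G a\<bar> \<le> integral {a..b} (\<lambda>t. \<bar>G (t + \<delta>) - G t\<bar>) + 2 * (M * \<delta> * \<delta>)"
  proof (cases "G a \<le> G b")
    case True
    hence "\<bar>G b - G a\<bar> = G b - G a" by simp
    thus ?thesis using calculation by (simp only: real_norm_def)
  next
    case False
    hence "\<bar>G b - G a\<bar> = G a - G b" by simp
    thus ?thesis using calculation by (simp only: real_norm_def)
  qed
  ultimately have "\<bar>G b - G a\<bar> \<le> (integral {a..b} (\<lambda>t. \<bar>G (t + \<delta>) - G t\<bar>) + 2 * (M * \<delta> * \<delta>)) / \<delta>"
    using \<delta> by (simp add: field_simps)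
  also have "\<dots> = integral {a..b} (\<lambda>t. \<bar>G (t + \<delta>) - G t\<bar> / \<delta>) + 2 * M * \<delta>"
    using \<delta> by (simp add: add_divide_distrib)
  finally show ?thesis .
qed

lemma pair_weight_le:
  assumes "b \<ge> 0"
  shows "pair_weight b (fst p) (snd p) \<le> (1 + (norm p)\<^sup>2) powr (- b)"
  unfolding pair_weight_def
proof (rule powr_mono2')
  have "(norm p)\<^sup>2 = (norm (fst p))\<^sup>2 + (norm (snd p))\<^sup>2" by (simp add: norm_prod_def)
  thus "1 + (norm p)\<^sup>2 \<le> (1 + (norm (fst p))\<^sup>2) * (1 + (norm (snd p))\<^sup>2)"
    by (simp add: algebra_simps)
qed (use assms in \<open>auto simp: add_pos_nonneg\<close>)

lemma turned_weight_le_radial: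
  fixes p :: "'a::euclidean_space \<times> 'a"
  assumes "b \<ge> 0" "p \<noteq> 0"
  shows "turned_weight b p \<le> ennreal (pi / 2 * (1 + (norm p)\<^sup>2) powr (- b))"
proof -
  obtain z w where p: "p = (z, w)" by (cases p)
  have q: "(norm p)\<^sup>2 = (norm z)\<^sup>2 + (norm w)\<^sup>2" by (simp add: p norm_Pair)
  have "(norm p)\<^sup>2 > 0" using assms by simp
  with turned_weight_le[OF assms(1) angular_bound_trivial[OF assms(1)], of z w]
  show ?thesis unfolding q p[symmetric] by simp
qed

lemma measurable_pair_weight [measurable]:
  "(\<lambda>p. pair_weight b (fst p) (snd p)) \<in> borel_measurable (borel :: ('a::euclidean_space \<times> 'a) measure)"
  unfolding pair_weight_def by (simp add: borel_prod[symmetric]) measurable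

lemma integrable_tail:
  fixes b :: real
  assumes "b > DIM('a::euclidean_space) + 1/2"
  shows "(\<integral>\<^sup>+p. ennreal ((norm (fst p) + norm (snd p)) * (1 + (norm p)\<^sup>2) powr (- b)) \<partial>(lborel :: ('a \<times> 'a) measure)) < \<infinity>"
proof -
  have "(\<integral>\<^sup>+p. ennreal ((norm (fst p) + norm (snd p)) * (1 + (norm p)\<^sup>2) powr (- b)) \<partial>(lborel :: ('a \<times> 'a) measure))
    \<le> (\<integral>\<^sup>+p. ennreal 2 * ennreal ((1 + (norm p)\<^sup>2) powr (- (b - 1/2))) \<partial>(lborel :: ('a \<times> 'a) measure))"
  proof (rule nn_integral_mono)
    fix p :: "'a \<times> 'a"
    have s: "norm p \<le> sqrt (1 + (norm p)\<^sup>2)" by (rule real_le_rsqrt) simp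
    have "norm (fst p) + norm (snd p) \<le> 2 * sqrt (1 + (norm p)\<^sup>2)"
      using norm_fst_le[of "fst p" "snd p", unfolded prod.collapse] norm_snd_le[of "snd p" "fst p", unfolded prod.collapse] s by linarith
    hence "(norm (fst p) + norm (snd p)) * (1 + (norm p)\<^sup>2) powr (- b) \<le> 2 * sqrt (1 + (norm p)\<^sup>2) * (1 + (norm p)\<^sup>2) powr (- b)"
      by (intro mult_right_mono) auto
    also have "\<dots> = 2 * (1 + (norm p)\<^sup>2) powr (- (b - 1/2))"
      by (simp add: powr_half_sqrt[symmetric] powr_add[symmetric])
    finally show "ennreal ((norm (fst p) + norm (snd p)) * (1 + (norm p)\<^sup>2) powr (- b)) \<le> ennreal 2 * ennreal ((1 + (norm p)\<^sup>2) powr (- (b - 1/2)))"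
      by (simp add: ennreal_mult'[symmetric] ennreal_leI del: ennreal_numeral)
  qed
  also have "\<dots> = ennreal 2 * (\<integral>\<^sup>+p. ennreal ((1 + (norm p)\<^sup>2) powr (- (b - 1/2))) \<partial>(lborel :: ('a \<times> 'a) measure))"
    by (rule nn_integral_cmult) simp
  also have "\<dots> < \<infinity>"
  proof -
    have "b - 1/2 > DIM('a \<times> 'a) / 2" using assms by simp
    from cauchy_weight_nn_integral[OF this] show ?thesis by (simp add: ennreal_mult_less_top del: minus_diff_eq)
  qed
  finally show ?thesis .
qed

text \<open>The slope hypothesis says that almost everywhere \<open>f\<close> has a gradient \<open>g z *\<^sub>R e\<close>, tested along
  short turns only. Difference quotients for the step \<open>1 / (k + 1)\<close> are moved to time 0 by a rotation
  and then \<open>k\<close> tends to infinity. The passage to the limit uses the reverse Fatou lemma, because \<open>e\<close>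
  need not depend measurably on \<open>z\<close>; the upper limit is then evaluated for one \<open>z\<close> at a time.\<close>

lemma pair_difference_le_gradient_flux:
  fixes f g :: "'a::euclidean_space \<Rightarrow> real" and \<beta> b A B L :: real
  assumes \<beta>: "\<beta> > DIM('a) / 2" and AB: "A \<ge> 0" "B \<ge> 0" and B0: "DIM('a) = 1 \<Longrightarrow> B = 0"
  defines "m \<equiv> (real DIM('a) - 1) / 2"
  assumes b: "b = \<beta> + m + 1" and ang: "angular_bound b A B"
    and lip: "\<And>x y. \<bar>f x - f y\<bar> \<le> L * norm (x - y)"
    and L: "L \<ge> 0"
    and g0: "\<And>x. g x \<ge> 0" and [measurable]: "g \<in> borel_measurable borel"
    and slope: "AE z in lborel. \<exists>e. norm e = 1 \<and> (\<forall>w. (\<lambda>k. \<bar>f (fst (rot (1 / Suc k) (z, w))) - f z\<bar> / (1 / Suc k))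
        \<longlonglongrightarrow> g z * \<bar>w \<bullet> e\<bar>)"
  shows "(\<integral>\<^sup>+p. ennreal (\<bar>f (fst p) - f (snd p)\<bar> * pair_weight b (fst p) (snd p)) \<partial>lborel)
    \<le> ennreal (pi / 2 * (pi powr m * Gamma \<beta> / Gamma b * (A + B * \<beta> / m))) *
       (\<integral>\<^sup>+z. ennreal (g z * (1 + (norm z)\<^sup>2) powr (- \<beta>)) \<partial>lborel)"
proof -
  have m0: "m \<ge> 0" using DIM_positive[where 'a='a] by (simp add: m_def Suc_leI)
  have \<beta>0: "\<beta> > 0" using \<beta> DIM_positive[where 'a='a] by (smt (verit) divide_pos_pos of_nat_0_less_iff)
  have bn: "b > DIM('a) + 1/2" using \<beta> by (simp add: b m_def field_simps)
  have b0: "b \<ge> 0" using bn by simp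
  define C where "C = pi / 2 * (pi powr m * Gamma \<beta> / Gamma b * (A + B * \<beta> / m))"
  have cont: "continuous_on UNIV f"
    using lip L by (intro lipschitz_on_continuous_on[of L] lipschitz_onI) (auto simp: dist_norm)
  define N where "N p = norm (fst p) + norm (snd p)" for p :: "'a \<times> 'a"
  define P where "P p = pair_weight b (fst p) (snd p)" for p :: "'a \<times> 'a"
  have P0: "P p \<ge> 0" for p by (simp add: P_def pair_weight_def)
  have N0: "N p \<ge> 0" for p by (simp add: N_def)
  have [measurable]: "f \<in> borel_measurable borel" using cont by (rule borel_measurable_continuous_onI)
  have [measurable]: "P \<in> borel_measurable borel"
    unfolding P_def by (rule measurable_pair_weight)
  have [measurable]: "N \<in> borel_measurable borel"
    unfolding N_def by (intro borel_measurable_continuous_onI continuous_intros)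
  define \<delta> where "\<delta> k = 1 / real (Suc k)" for k
  have \<delta>: "\<delta> k > 0" for k by (simp add: \<delta>_def)
  define u where "u k p = ennreal (\<bar>f (fst (rot (\<delta> k) p)) - f (fst p)\<bar> / \<delta> k) * turned_weight b p" for k p
  have [measurable]: "u k \<in> borel_measurable borel" for k
  proof -
    have [measurable]: "(\<lambda>p. \<bar>f (fst (rot (\<delta> k) p)) - f (fst p)\<bar> / \<delta> k) \<in> borel_measurable borel"
      unfolding rot_def case_prod_beta
      by (intro borel_measurable_continuous_onI continuous_intros continuous_on_compose2[OF cont]) (use \<delta>[of k] in auto)
    show ?thesis
      unfolding u_def by (intro borel_measurable_times_ennreal turned_weight_measurable) simp
  qed
  define E where "E = (\<integral>\<^sup>+p. ennreal (N p * P p) \<partial>lborel)"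
  have E: "E < \<infinity>"
  proof -
    have "E \<le> (\<integral>\<^sup>+p. ennreal ((norm (fst p) + norm (snd p)) * (1 + (norm p)\<^sup>2) powr (- b)) \<partial>(lborel :: ('a \<times> 'a) measure))"
      unfolding E_def N_def P_def
      by (intro nn_integral_mono ennreal_leI mult_left_mono pair_weight_le b0) auto
    also have "\<dots> < \<infinity>" using bn by (rule integrable_tail)
    finally show ?thesis .
  qed
  define I where "I = (\<integral>\<^sup>+p. ennreal (\<bar>f (fst p) - f (snd p)\<bar> * P p) \<partial>lborel)"
  \<comment> \<open>The error of replacing the increment by difference quotients is linear in the step.\<close>
  have step: "I \<le> (\<integral>\<^sup>+p. u k p \<partial>lborel) + ennreal (2 * L * \<delta> k) * E" for k
  proof -
    define d where "d = \<delta> k"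
    have d: "d > 0" using \<delta> by (simp add: d_def)
    define inc where "inc t p = \<bar>f (fst (rot (t + d) p)) - f (fst (rot t p))\<bar> / d" for t p
    have inc_meas: "(\<lambda>(p, t). ennreal (inc t p) * ennreal (P p) * indicator {0..pi/2} t) \<in> borel_measurable (lborel \<Otimes>\<^sub>M lborel)"
    proof -
      have "continuous_on UNIV (\<lambda>q :: ('a \<times> 'a) \<times> real. inc (snd q) (fst q))"
        unfolding inc_def rot_def case_prod_beta using d
        by (auto intro!: continuous_intros continuous_on_compose2[OF cont])
      hence [measurable]: "(\<lambda>q. inc (snd q) (fst q)) \<in> borel_measurable (borel \<Otimes>\<^sub>M borel)"
        by (simp add: borel_prod borel_measurable_continuous_onI)
      show ?thesis unfolding case_prod_beta by measurable
    qed
    have pw: "ennreal (\<bar>f (fst p) - f (snd p)\<bar> * P p)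
        \<le> (\<integral>\<^sup>+t. ennreal (inc t p) * ennreal (P p) * indicator {0..pi/2} t \<partial>lborel) + ennreal (2 * L * d) * ennreal (N p * P p)" for p
    proof -
      define G where "G t = f (fst (rot t p))" for t
      have "\<bar>G s - G t\<bar> \<le> (L * N p) * \<bar>s - t\<bar>" for s t
      proof -
        have "\<bar>G s - G t\<bar> \<le> L * norm (fst (rot s p) - fst (rot t p))" unfolding G_def by (rule lip)
        also have "\<dots> \<le> L * (\<bar>s - t\<bar> * N p)" unfolding N_def using L by (intro mult_left_mono norm_fst_rot_diff_le)
        finally show ?thesis by (simp add: mult_ac)
      qed
      from increment_le_average_increment[of G "L * N p" d 0 "pi/2", OF this]
      have "\<bar>G (pi/2) - G 0\<bar> \<le> integral {0..pi/2} (\<lambda>t. inc t p) + 2 * (L * N p) * d"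
        using L N0 d by (simp add: G_def inc_def)
      also have "\<bar>G (pi/2) - G 0\<bar> = \<bar>f (fst p) - f (snd p)\<bar>"
        by (simp add: G_def rot_def case_prod_beta abs_minus_commute)
      finally have 1: "\<bar>f (fst p) - f (snd p)\<bar> * P p \<le> integral {0..pi/2} (\<lambda>t. inc t p) * P p + 2 * L * d * (N p * P p)"
        using mult_right_mono[OF _ P0[of p]] by (fastforce simp: algebra_simps)
      have "(\<lambda>t. inc t p) integrable_on {0..pi/2}"
        unfolding inc_def rot_def case_prod_beta using d
        by (intro integrable_continuous_real continuous_intros continuous_on_compose2[OF cont]) auto
      hence "((\<lambda>t. inc t p) has_integral integral {0..pi/2} (\<lambda>t. inc t p)) {0..pi/2}" by (rule integrable_integral)
      from nn_integral_has_integral_lebesgue[OF _ this]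
      have "(\<integral>\<^sup>+t. ennreal (indicator {0..pi/2} t * inc t p) \<partial>lborel) = ennreal (integral {0..pi/2} (\<lambda>t. inc t p))"
        using d by (simp add: inc_def)
      moreover have "ennreal (indicator {0..pi/2} t * inc t p) = ennreal (inc t p) * indicator {0..pi/2} t" for t
        by (simp add: indicator_def)
      ultimately have 2: "(\<integral>\<^sup>+t. ennreal (inc t p) * indicator {0..pi/2} t \<partial>lborel) = ennreal (integral {0..pi/2} (\<lambda>t. inc t p))"
        by simp
      have [measurable]: "(\<lambda>t. inc t p) \<in> borel_measurable borel"
        unfolding inc_def rot_def case_prod_beta using d
        by (intro borel_measurable_continuous_onI continuous_intros continuous_on_compose2[OF cont]) auto
      have "(\<integral>\<^sup>+t. ennreal (inc t p) * ennreal (P p) * indicator {0..pi/2} t \<partial>lborel)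
          = (\<integral>\<^sup>+t. ennreal (P p) * (ennreal (inc t p) * indicator {0..pi/2} t) \<partial>lborel)"
        by (simp add: mult_ac)
      also have "\<dots> = ennreal (P p) * ennreal (integral {0..pi/2} (\<lambda>t. inc t p))"
        unfolding 2[symmetric] by (rule nn_integral_cmult) simp
      finally have 3: "(\<integral>\<^sup>+t. ennreal (inc t p) * ennreal (P p) * indicator {0..pi/2} t \<partial>lborel)
          = ennreal (integral {0..pi/2} (\<lambda>t. inc t p) * P p)"
        using P0 by (simp add: ennreal_mult'[symmetric] mult.commute)
      have "integral {0..pi/2} (\<lambda>t. inc t p) \<ge> 0"
        using d by (intro integral_nonneg \<open>(\<lambda>t. inc t p) integrable_on {0..pi/2}\<close>) (auto simp: inc_def)
      thus ?thesis unfolding 3 using ennreal_leI[OF 1] L d N0 P0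
        by (simp add: ennreal_plus ennreal_mult'[symmetric])
    qed
    have "I \<le> (\<integral>\<^sup>+p. ((\<integral>\<^sup>+t. ennreal (inc t p) * ennreal (P p) * indicator {0..pi/2} t \<partial>lborel) + ennreal (2 * L * d) * ennreal (N p * P p)) \<partial>lborel)"
      unfolding I_def by (intro nn_integral_mono pw)
    also have "\<dots> = (\<integral>\<^sup>+p. \<integral>\<^sup>+t. ennreal (inc t p) * ennreal (P p) * indicator {0..pi/2} t \<partial>lborel \<partial>lborel) + ennreal (2 * L * d) * E"
      unfolding E_def using lborel.borel_measurable_nn_integral_fst[OF inc_meas]
      by (subst nn_integral_add) (auto simp: nn_integral_cmult)
    also have "(\<integral>\<^sup>+p. \<integral>\<^sup>+t. ennreal (inc t p) * ennreal (P p) * indicator {0..pi/2} t \<partial>lborel \<partial>lborel)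
        = (\<integral>\<^sup>+t. \<integral>\<^sup>+p. ennreal (inc t p) * ennreal (P p) * indicator {0..pi/2} t \<partial>lborel \<partial>lborel)"
      using lborel_pair.Fubini'[OF inc_meas] by simp
    also have "\<dots> = (\<integral>\<^sup>+t. \<integral>\<^sup>+p. ennreal (inc 0 p) * ennreal (P (rot (- t) p)) * indicator {0..pi/2} t \<partial>lborel \<partial>lborel)"
    proof (rule nn_integral_cong)
      fix t :: real
      have [measurable]: "inc t \<in> borel_measurable borel"
        unfolding inc_def rot_def case_prod_beta using d
        by (intro borel_measurable_continuous_onI continuous_intros continuous_on_compose2[OF cont]) auto
      have "(\<integral>\<^sup>+p. ennreal (inc t p) * ennreal (P p) * indicator {0..pi/2} t \<partial>lborel)
        = (\<integral>\<^sup>+p. ennreal (inc t (rot (- t) p)) * ennreal (P (rot (- t) p)) * indicator {0..pi/2} t \<partial>lborel)"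
        by (rule nn_integral_lborel_orthogonal[OF orthogonal_transformation_rot, symmetric]) simp
      moreover have "inc t (rot (- t) p) = inc 0 p" for p
        by (simp add: inc_def rot_add)
      ultimately show "(\<integral>\<^sup>+p. ennreal (inc t p) * ennreal (P p) * indicator {0..pi/2} t \<partial>lborel)
        = (\<integral>\<^sup>+p. ennreal (inc 0 p) * ennreal (P (rot (- t) p)) * indicator {0..pi/2} t \<partial>lborel)"
        by simp
    qed
    also have "\<dots> = (\<integral>\<^sup>+p. \<integral>\<^sup>+t. ennreal (inc 0 p) * ennreal (P (rot (- t) p)) * indicator {0..pi/2} t \<partial>lborel \<partial>lborel)"
    proof -
      have "continuous_on UNIV (\<lambda>q :: ('a \<times> 'a) \<times> real. inc 0 (fst q))"
        unfolding inc_def rot_def case_prod_beta using d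
        by (auto intro!: continuous_intros continuous_on_compose2[OF cont])
      hence [measurable]: "(\<lambda>q :: ('a \<times> 'a) \<times> real. inc 0 (fst q)) \<in> borel_measurable (borel \<Otimes>\<^sub>M borel)"
        by (simp add: borel_prod borel_measurable_continuous_onI)
      have "continuous_on UNIV (\<lambda>q :: ('a \<times> 'a) \<times> real. P (rot (- snd q) (fst q)))"
        unfolding P_def pair_weight_def rot_def case_prod_beta
        by (intro continuous_intros) (auto simp: add_pos_nonneg less_imp_neq[symmetric])
      hence [measurable]: "(\<lambda>q :: ('a \<times> 'a) \<times> real. P (rot (- snd q) (fst q))) \<in> borel_measurable (borel \<Otimes>\<^sub>M borel)"
        by (simp add: borel_prod borel_measurable_continuous_onI)
      have "(\<lambda>(p, t). ennreal (inc 0 p) * ennreal (P (rot (- t) p)) * indicator {0..pi/2} t) \<in> borel_measurable (lborel \<Otimes>\<^sub>M lborel)"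
        unfolding case_prod_beta by measurable
      from lborel_pair.Fubini'[OF this] show ?thesis by simp
    qed
    also have "\<dots> = (\<integral>\<^sup>+p. u k p \<partial>lborel)"
    proof (rule nn_integral_cong)
      fix p :: "'a \<times> 'a"
      have [measurable]: "(\<lambda>t. P (rot (- t) p)) \<in> borel_measurable borel"
        unfolding P_def pair_weight_def rot_def case_prod_beta
        by (intro borel_measurable_continuous_onI continuous_intros) (auto simp: add_pos_nonneg less_imp_neq[symmetric])
      have "(\<integral>\<^sup>+t. ennreal (inc 0 p) * ennreal (P (rot (- t) p)) * indicator {0..pi/2} t \<partial>lborel)
        = ennreal (inc 0 p) * (\<integral>\<^sup>+t. ennreal (P (rot (- t) p)) * indicator {0..pi/2} t \<partial>lborel)"
        unfolding mult.assoc by (rule nn_integral_cmult) simp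
      also have "\<dots> = u k p"
        by (simp add: u_def turned_weight_def P_def case_prod_beta inc_def d_def)
      finally show "(\<integral>\<^sup>+t. ennreal (inc 0 p) * ennreal (P (rot (- t) p)) * indicator {0..pi/2} t \<partial>lborel) = u k p" .
    qed
    finally show ?thesis by (simp add: d_def)
  qed
  have small: "(\<lambda>k. ennreal (2 * L * \<delta> k) * E) \<longlonglongrightarrow> 0"
  proof -
    have "(\<lambda>k. 2 * L * \<delta> k) \<longlonglongrightarrow> 2 * L * 0"
      unfolding \<delta>_def by (intro tendsto_intros LIMSEQ_Suc lim_1_over_n)
    hence "(\<lambda>k. ennreal (2 * L * \<delta> k)) \<longlonglongrightarrow> ennreal 0"
      by (intro tendsto_ennrealI) simp
    from ennreal_tendsto_cmult[OF E[unfolded infinity_ennreal_def] this]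
    show ?thesis by (simp add: mult.commute)
  qed
  have "I \<le> limsup (\<lambda>k. \<integral>\<^sup>+p. u k p \<partial>lborel)"
  proof (rule ennreal_le_epsilon)
    fix \<eta> :: real assume \<eta>: "\<eta> > 0"
    have "\<forall>\<^sub>F k in sequentially. ennreal (2 * L * \<delta> k) * E < ennreal \<eta>"
      using \<eta> by (intro order_tendstoD(2)[OF small]) simp
    hence ev: "\<forall>\<^sub>F k in sequentially. I - ennreal \<eta> \<le> (\<integral>\<^sup>+p. u k p \<partial>lborel)"
    proof eventually_elim
      case (elim k)
      have "I \<le> (\<integral>\<^sup>+p. u k p \<partial>lborel) + ennreal \<eta>"
        using step[of k] elim by (meson add_left_mono less_imp_le order_trans)
      thus ?case by (simp add: ennreal_minus_le_iff add.commute)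
    qed
    have "I - ennreal \<eta> \<le> limsup (\<lambda>k. \<integral>\<^sup>+p. u k p \<partial>lborel)"
      using ev by (intro le_Limsup) auto
    thus "I \<le> limsup (\<lambda>k. \<integral>\<^sup>+p. u k p \<partial>lborel) + ennreal \<eta>"
      by (simp add: ennreal_minus_le_iff add.commute)
  qed
  also have "\<dots> \<le> (\<integral>\<^sup>+p. limsup (\<lambda>k. u k p) \<partial>lborel)"
  proof (rule nn_integral_limsup[where w="\<lambda>p. ennreal (L * pi / 2) * ennreal (N p * (1 + (norm p)\<^sup>2) powr (- b))"])
    fix k
    show "AE p in lborel. u k p \<le> ennreal (L * pi / 2) * ennreal (N p * (1 + (norm p)\<^sup>2) powr (- b))"
      using AE_lborel_singleton[of "0 :: 'a \<times> 'a"]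
    proof eventually_elim
      case (elim p)
      have "\<bar>f (fst (rot (\<delta> k) p)) - f (fst p)\<bar> \<le> L * norm (fst (rot (\<delta> k) p) - fst (rot 0 p))"
        using lip by simp
      also have "\<dots> \<le> L * (\<bar>\<delta> k - 0\<bar> * N p)"
        unfolding N_def using L by (intro mult_left_mono norm_fst_rot_diff_le)
      finally have "\<bar>f (fst (rot (\<delta> k) p)) - f (fst p)\<bar> / \<delta> k \<le> L * N p"
        using \<delta>[of k] by (simp add: field_simps)
      hence "u k p \<le> ennreal (L * N p) * ennreal (pi / 2 * (1 + (norm p)\<^sup>2) powr (- b))"
        unfolding u_def by (intro mult_mono ennreal_leI turned_weight_le_radial b0 elim) auto
      also have "\<dots> = ennreal (L * pi / 2) * ennreal (N p * (1 + (norm p)\<^sup>2) powr (- b))"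
        using L N0 by (simp add: ennreal_mult[symmetric] mult_ac)
      finally show ?case .
    qed
    show "(\<integral>\<^sup>+p. ennreal (L * pi / 2) * ennreal (N p * (1 + (norm p)\<^sup>2) powr (- b)) \<partial>lborel) < \<infinity>"
      using integrable_tail[OF bn] unfolding N_def[symmetric]
      by (subst nn_integral_cmult) (simp_all add: ennreal_mult_less_top)
  qed simp_all
  also have "\<dots> = (\<integral>\<^sup>+z. \<integral>\<^sup>+w. limsup (\<lambda>k. u k (z, w)) \<partial>lborel \<partial>lborel)"
    by (subst lborel_prod[symmetric], subst lborel.nn_integral_fst[symmetric]) (simp_all add: lborel_prod)
  also have "\<dots> \<le> (\<integral>\<^sup>+z. ennreal C * ennreal (g z * (1 + (norm z)\<^sup>2) powr (- \<beta>)) \<partial>lborel)"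
  proof (rule nn_integral_mono_AE, use slope in eventually_elim)
    case (elim z)
    then obtain e where e: "norm e = 1"
      and lim: "\<And>w. (\<lambda>k. \<bar>f (fst (rot (1 / Suc k) (z, w))) - f z\<bar> / (1 / Suc k)) \<longlonglongrightarrow> g z * \<bar>w \<bullet> e\<bar>"
      by blast
    have lims: "limsup (\<lambda>k. u k (z, w)) = ennreal (g z * \<bar>w \<bullet> e\<bar>) * turned_weight b (z, w)" if "(z, w) \<noteq> 0" for w
    proof -
      have "turned_weight b (z, w) < top"
        using turned_weight_le_radial[OF b0 that] by (metis ennreal_less_top le_less_trans)
      from ennreal_tendsto_cmult[OF this tendsto_ennrealI[OF lim[of w]]]
      have "(\<lambda>k. u k (z, w)) \<longlonglongrightarrow> ennreal (g z * \<bar>w \<bullet> e\<bar>) * turned_weight b (z, w)"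
        by (simp add: u_def \<delta>_def mult.commute)
      thus ?thesis by (intro lim_imp_Limsup) auto
    qed
    have "(\<integral>\<^sup>+w. limsup (\<lambda>k. u k (z, w)) \<partial>lborel) = (\<integral>\<^sup>+w. ennreal (g z) * (ennreal \<bar>w \<bullet> e\<bar> * turned_weight b (z, w)) \<partial>lborel)"
    proof (rule nn_integral_cong_AE, use AE_lborel_singleton[of "0::'a"] in eventually_elim)
      case (elim w)
      thus ?case using lims[of w] g0[of z] by (simp add: ennreal_mult mult.assoc zero_prod_def)
    qed
    also have "\<dots> = ennreal (g z) * (\<integral>\<^sup>+w. ennreal \<bar>w \<bullet> e\<bar> * turned_weight b (z, w) \<partial>lborel)"
      by (rule nn_integral_cmult) simp
    also have "\<dots> \<le> ennreal (g z) * ennreal ((1 + (norm z)\<^sup>2) powr (- \<beta>) * C)"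
      unfolding C_def m_def using flux_bound[OF e \<beta>0 AB B0 _ ang, of z] b
      by (intro mult_left_mono) (auto simp: m_def)
    also have "\<dots> = ennreal C * ennreal (g z * (1 + (norm z)\<^sup>2) powr (- \<beta>))"
      using g0[of z] by (simp add: ennreal_mult' ennreal_mult'' mult_ac)
    finally show ?case .
  qed
  also have "\<dots> = ennreal C * (\<integral>\<^sup>+z. ennreal (g z * (1 + (norm z)\<^sup>2) powr (- \<beta>)) \<partial>lborel)"
    by (rule nn_integral_cmult) simp
  finally show ?thesis by (simp add: I_def P_def C_def)
qed

section \<open>Ramps around finite sets\<close>

definition ramp :: "real \<Rightarrow> real \<Rightarrow> 'a::metric_space set \<Rightarrow> 'a \<Rightarrow> real" where
  "ramp r s F x = max 0 (min 1 ((s - infdist x F) / (s - r)))"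

lemma ramp_lipschitz:
  fixes F :: "'a::real_normed_vector set"
  assumes "r < s"
  shows "\<bar>ramp r s F x - ramp r s F y\<bar> \<le> 1 / (s - r) * norm (x - y)"
proof -
  have "\<bar>ramp r s F x - ramp r s F y\<bar> \<le> \<bar>(s - infdist x F) / (s - r) - (s - infdist y F) / (s - r)\<bar>"
    unfolding ramp_def by linarith
  also have "\<dots> = \<bar>infdist x F - infdist y F\<bar> / (s - r)"
    using assms by (simp add: diff_divide_distrib[symmetric] abs_divide abs_minus_commute)
  also have "\<dots> \<le> dist x y / (s - r)"
    using assms by (intro divide_right_mono infdist_triangle_abs) auto
  finally show ?thesis by (simp add: dist_norm)
qed

lemma null_sets_equidistant:
  fixes a b :: "'a::euclidean_space"
  assumes "a \<noteq> b"
  shows "{z. dist z a = dist z b} \<in> null_sets lborel"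
proof -
  have "{z. dist z a = dist z b} = {z. (2 *\<^sub>R (b - a)) \<bullet> z = b \<bullet> b - a \<bullet> a}"
  proof (intro Collect_cong)
    fix z
    have "dist z a = dist z b \<longleftrightarrow> (dist z a)\<^sup>2 = (dist z b)\<^sup>2" by simp
    also have "\<dots> \<longleftrightarrow> (2 *\<^sub>R (b - a)) \<bullet> z = b \<bullet> b - a \<bullet> a"
      by (auto simp: dist_norm power2_norm_eq_inner inner_diff_left inner_diff_right inner_commute algebra_simps)
    finally show "dist z a = dist z b \<longleftrightarrow> (2 *\<^sub>R (b - a)) \<bullet> z = b \<bullet> b - a \<bullet> a" .
  qed
  moreover have "negligible {z. (2 *\<^sub>R (b - a)) \<bullet> z = b \<bullet> b - a \<bullet> a}"
    using assms by (intro negligible_hyperplane) auto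
  moreover have "closed {z. dist z a = dist z b}"
    by (intro closed_Collect_eq continuous_intros)
  ultimately show ?thesis
    by (auto simp: null_sets_completion_iff negligible_iff_null_sets)
qed

lemma null_sets_sphere: "sphere (a::'a::euclidean_space) r \<in> null_sets lborel"
  using negligible_sphere[of a r] closed_sphere[of a r]
  by (auto simp: null_sets_completion_iff negligible_iff_null_sets)

lemma dist_rot_derivative:
  fixes z w a :: "'a::euclidean_space"
  assumes "z \<noteq> a"
  shows "(\<lambda>k. (dist (fst (rot (1 / Suc k) (z, w))) a - dist z a) / (1 / Suc k)) \<longlonglongrightarrow> w \<bullet> sgn (z - a)"
proof -
  define \<gamma> where "\<gamma> t = cos t *\<^sub>R z + sin t *\<^sub>R w - a" for t
  have "(\<gamma> has_derivative (\<lambda>h. h *\<^sub>R w)) (at 0)"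
  proof -
    have "((\<lambda>t. cos t *\<^sub>R z) has_derivative (\<lambda>h. 0)) (at 0)"
      "((\<lambda>t. sin t *\<^sub>R w) has_derivative (\<lambda>h. h *\<^sub>R w)) (at 0)"
      by (rule has_derivative_eq_rhs, (rule derivative_intros)+, simp add: fun_eq_iff)+
    from has_derivative_diff[OF has_derivative_add[OF this] has_derivative_const[of a]]
    show ?thesis by (simp add: \<gamma>_def[abs_def])
  qed
  moreover have "(norm has_derivative (\<lambda>h. h \<bullet> sgn (\<gamma> 0))) (at (\<gamma> 0))"
    using assms by (intro has_derivative_norm) (simp add: \<gamma>_def)
  ultimately have "((\<lambda>t. norm (\<gamma> t)) has_derivative (\<lambda>h. (h *\<^sub>R w) \<bullet> sgn (\<gamma> 0))) (at 0)"
    by (rule has_derivative_compose)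
  hence "((\<lambda>t. norm (\<gamma> t)) has_real_derivative (w \<bullet> sgn (z - a))) (at 0)"
  proof -
    have "(\<lambda>h. (h *\<^sub>R w) \<bullet> sgn (\<gamma> 0)) = (*) (w \<bullet> sgn (z - a))"
      by (auto simp: fun_eq_iff \<gamma>_def)
    thus "((\<lambda>t. norm (\<gamma> t)) has_derivative (\<lambda>h. (h *\<^sub>R w) \<bullet> sgn (\<gamma> 0))) (at 0) \<Longrightarrow> ?thesis"
      by (simp add: has_field_derivative_def)
  qed
  hence lim: "((\<lambda>h. (norm (\<gamma> h) - norm (\<gamma> 0)) / h) \<longlongrightarrow> w \<bullet> sgn (z - a)) (at 0)"
    by (simp add: has_field_derivative_iff)
  have "filterlim (\<lambda>k. 1 / real (Suc k)) (at 0) sequentially"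
    by (intro filterlim_atI LIMSEQ_Suc lim_1_over_n always_eventually) auto
  from filterlim_compose[OF lim this]
  show ?thesis by (simp add: \<gamma>_def rot_def dist_norm)
qed

lemma infdist_nearest_eventually:
  fixes F :: "'a::euclidean_space set"
  assumes F: "finite F" "a \<in> F" and near: "\<And>b. b \<in> F \<Longrightarrow> b \<noteq> a \<Longrightarrow> dist z a < dist z b"
    and x: "x \<longlonglongrightarrow> z"
  shows "\<forall>\<^sub>F k in sequentially. infdist (x k) F = dist (x k) a"
proof -
  have "\<forall>\<^sub>F k in sequentially. \<forall>b\<in>F - {a}. dist (x k) a < dist (x k) b"
  proof (intro eventually_ball_finite ballI)
    fix b assume b: "b \<in> F - {a}"
    have "(\<lambda>k. dist (x k) b - dist (x k) a) \<longlonglongrightarrow> dist z b - dist z a"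
      by (intro tendsto_intros x)
    moreover have "dist z b - dist z a > 0" using near b by simp
    ultimately have "\<forall>\<^sub>F k in sequentially. dist (x k) b - dist (x k) a > 0"
      by (rule order_tendstoD)
    thus "\<forall>\<^sub>F k in sequentially. dist (x k) a < dist (x k) b" by eventually_elim simp
  qed (use F in auto)
  thus ?thesis
  proof eventually_elim
    case (elim k)
    obtain b where b: "b \<in> F" "infdist (x k) F = dist (x k) b"
      using infdist_attains_inf[OF finite_imp_closed[OF F(1)], of "x k"] F(2) by (metis empty_iff)
    have "dist (x k) b \<le> dist (x k) a" using infdist_le[OF F(2), of "x k"] b by simp
    hence "b = a" using bspec[OF elim, of b] b by auto
    thus ?case using b by simp
  qed
qed

text \<open>If \<open>z\<close> lies outside \<open>F\<close>, off the spheres of radii \<open>r\<close> and \<open>s\<close> around its points and off the bisecting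
  hyperplanes, then near \<open>z\<close> the distance to \<open>F\<close> is the distance to a single point of \<open>F\<close>, and the ramp
  is constant or an affine function of that distance.\<close>

lemma ramp_slope:
  fixes F :: "'a::euclidean_space set"
  assumes F: "finite F" "F \<noteq> {}" and rs: "0 < r" "r < s"
  shows "AE z in lborel. \<exists>e. norm e = 1 \<and> (\<forall>w. (\<lambda>k. \<bar>ramp r s F (fst (rot (1 / Suc k) (z, w))) - ramp r s F z\<bar> / (1 / Suc k))
        \<longlonglongrightarrow> (indicator {x. r < infdist x F \<and> infdist x F < s} z / (s - r)) * \<bar>w \<bullet> e\<bar>)"
proof -
  have 1: "AE z in lborel. \<forall>a\<in>F. \<forall>b\<in>F. a \<noteq> b \<longrightarrow> dist z a \<noteq> dist z b"
  proof -
    have "AE z in lborel. a \<noteq> b \<longrightarrow> dist z a \<noteq> dist z b" for a b :: 'a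
      using AE_not_in[OF null_sets_equidistant[of a b]] by (cases "a = b") auto
    thus ?thesis using F by (simp add: AE_finite_all)
  qed
  have 2: "AE z in lborel. \<forall>a\<in>F. dist z a \<notin> {0, r, s}"
  proof -
    have "AE z in lborel. dist z a \<notin> {0, r, s}" for a :: 'a
      using AE_not_in[OF null_sets_sphere[of a 0]] AE_not_in[OF null_sets_sphere[of a r]] AE_not_in[OF null_sets_sphere[of a s]]
      by eventually_elim (auto simp: dist_commute)
    thus ?thesis using F by (simp add: AE_finite_all)
  qed
  show ?thesis using 1 2
  proof eventually_elim
    case (elim z)
    obtain a where a: "a \<in> F" "infdist z F = dist z a"
      using infdist_attains_inf[OF finite_imp_closed[OF F(1)] F(2), of z] by metis
    have na: "dist z a \<noteq> r" "dist z a \<noteq> s" "dist z a \<noteq> 0"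
      using bspec[OF elim(2) a(1)] by auto
    have near: "dist z a < dist z b" if "b \<in> F" "b \<noteq> a" for b
    proof -
      have "dist z a \<le> dist z b" using infdist_le[OF that(1), of z] a by simp
      moreover have "dist z a \<noteq> dist z b" using bspec[OF bspec[OF elim(1) a(1)] that(1)] that(2) by simp
      ultimately show ?thesis by simp
    qed
    define e where "e = sgn (z - a)"
    have za: "z \<noteq> a" using na(3) by simp
    have e: "norm e = 1" using za by (simp add: e_def norm_sgn)
    have lim: "(\<lambda>k. \<bar>ramp r s F (fst (rot (1 / Suc k) (z, w))) - ramp r s F z\<bar> / (1 / Suc k))
        \<longlonglongrightarrow> (indicator {x. r < infdist x F \<and> infdist x F < s} z / (s - r)) * \<bar>w \<bullet> e\<bar>" for w
    proof -
      define x where "x k = fst (rot (1 / Suc k) (z, w))" for k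
      have xz: "x \<longlonglongrightarrow> z"
      proof -
        have l: "(\<lambda>k. 1 / real (Suc k)) \<longlonglongrightarrow> 0" by (intro LIMSEQ_Suc lim_1_over_n)
        have "(\<lambda>k. cos (1 / real (Suc k)) *\<^sub>R z + sin (1 / real (Suc k)) *\<^sub>R w) \<longlonglongrightarrow> cos 0 *\<^sub>R z + sin 0 *\<^sub>R w"
          by (intro tendsto_intros l)
        moreover have "x = (\<lambda>k. cos (1 / real (Suc k)) *\<^sub>R z + sin (1 / real (Suc k)) *\<^sub>R w)"
          by (auto simp: x_def rot_def fun_eq_iff)
        ultimately show ?thesis by simp
      qed
      have ev: "\<forall>\<^sub>F k in sequentially. infdist (x k) F = dist (x k) a"
        using near by (intro infdist_nearest_eventually[OF F(1) a(1) _ xz]) auto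
      have dlim: "(\<lambda>k. dist (x k) a) \<longlonglongrightarrow> dist z a" by (intro tendsto_intros xz)
      have der: "(\<lambda>k. (dist (x k) a - dist z a) / (1 / Suc k)) \<longlonglongrightarrow> w \<bullet> e"
        unfolding x_def e_def by (rule dist_rot_derivative[OF za])
      consider "dist z a < r" | "r < dist z a" "dist z a < s" | "s < dist z a"
        using na by linarith
      hence "(\<lambda>k. \<bar>ramp r s F (x k) - ramp r s F z\<bar> / (1 / Suc k))
        \<longlonglongrightarrow> (indicator {x. r < infdist x F \<and> infdist x F < s} z / (s - r)) * \<bar>w \<bullet> e\<bar>"
      proof cases
        case 1
        have "\<forall>\<^sub>F k in sequentially. \<bar>ramp r s F (x k) - ramp r s F z\<bar> / (1 / Suc k) = 0"
          using ev order_tendstoD(2)[OF dlim 1]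
        proof eventually_elim
          case (elim k)
          have "ramp r s F (x k) = 1" "ramp r s F z = 1"
            using elim 1 a(2) rs by (simp_all add: ramp_def)
          thus ?case by simp
        qed
        moreover have "\<not> r < infdist z F" using 1 a by simp
        ultimately show ?thesis by (simp add: tendsto_eventually)
      next
        case 3
        have "\<forall>\<^sub>F k in sequentially. \<bar>ramp r s F (x k) - ramp r s F z\<bar> / (1 / Suc k) = 0"
          using ev order_tendstoD(1)[OF dlim 3]
        proof eventually_elim
          case (elim k)
          have "(s - dist (x k) a) / (s - r) \<le> 0" "(s - dist z a) / (s - r) \<le> 0"
            using elim(2) 3 rs by (simp_all add: divide_le_0_iff)
          hence "ramp r s F (x k) = 0" "ramp r s F z = 0"
            using elim(1) a(2) by (simp_all add: ramp_def)
          thus ?case by simp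
        qed
        moreover have "\<not> infdist z F < s" using 3 a by simp
        ultimately show ?thesis by (simp add: tendsto_eventually)
      next
        case 2
        have "\<forall>\<^sub>F k in sequentially. \<bar>ramp r s F (x k) - ramp r s F z\<bar> / (1 / Suc k)
            = 1 / (s - r) * \<bar>(dist (x k) a - dist z a) / (1 / Suc k)\<bar>"
          using ev order_tendstoD(1)[OF dlim 2(1)] order_tendstoD(2)[OF dlim 2(2)]
        proof eventually_elim
          case (elim k)
          have "ramp r s F (x k) = (s - dist (x k) a) / (s - r)" "ramp r s F z = (s - dist z a) / (s - r)"
            using elim 2 a(2) rs by (simp_all add: ramp_def)
          hence "ramp r s F (x k) - ramp r s F z = (dist z a - dist (x k) a) / (s - r)"
            by (simp add: diff_divide_distrib)
          hence "\<bar>ramp r s F (x k) - ramp r s F z\<bar> = \<bar>dist (x k) a - dist z a\<bar> / (s - r)"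
            using rs by (simp add: abs_divide abs_minus_commute)
          thus ?case using rs by (simp add: abs_divide abs_mult)
        qed
        moreover have "(\<lambda>k. 1 / (s - r) * \<bar>(dist (x k) a - dist z a) / (1 / Suc k)\<bar>) \<longlonglongrightarrow> 1 / (s - r) * \<bar>w \<bullet> e\<bar>"
          by (intro tendsto_intros der)
        ultimately have "(\<lambda>k. \<bar>ramp r s F (x k) - ramp r s F z\<bar> / (1 / Suc k)) \<longlonglongrightarrow> 1 / (s - r) * \<bar>w \<bullet> e\<bar>"
          by (simp only: tendsto_cong)
        moreover have "r < infdist z F" "infdist z F < s" using 2 a by auto
        ultimately show ?thesis by simp
      qed
      thus ?thesis by (simp add: x_def)
    qed
    show ?case by (intro exI[of _ e] conjI allI e lim)
  qed
qed

section \<open>From neighbourhoods to the perimeter\<close>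

text \<open>The Cauchy measure before normalisation.\<close>

definition weight_measure :: "real \<Rightarrow> 'a::euclidean_space measure" where
  "weight_measure \<alpha> = density lborel (\<lambda>x. ennreal ((1 + (norm x)\<^sup>2) powr (- \<alpha>)))"

lemma sets_weight_measure [simp, measurable_cong]: "sets (weight_measure \<alpha>) = sets borel"
  by (simp add: weight_measure_def)

lemma space_weight_measure [simp]: "space (weight_measure \<alpha>) = UNIV"
  by (simp add: weight_measure_def)

lemma emeasure_weight_measure:
  "A \<in> sets borel \<Longrightarrow> emeasure (weight_measure \<alpha>) A = (\<integral>\<^sup>+x. ennreal ((1 + (norm x)\<^sup>2) powr (- \<alpha>)) * indicator A x \<partial>lborel)"
  unfolding weight_measure_def by (subst emeasure_density) simp_all

lemma cauchy_const_pos: "\<alpha> > real n / 2 \<Longrightarrow> cauchy_const n \<alpha> > 0"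
  unfolding cauchy_const_def
  by (intro divide_pos_pos mult_pos_pos Gamma_real_pos) auto

lemma emeasure_weight_measure_UNIV:
  assumes "\<alpha> > DIM('a::euclidean_space) / 2"
  shows "emeasure (weight_measure \<alpha> :: 'a measure) UNIV = ennreal (cauchy_const DIM('a) \<alpha>)"
  using cauchy_weight_nn_integral[OF assms] by (simp add: emeasure_weight_measure cauchy_const_def)

lemma finite_measure_weight_measure:
  assumes "\<alpha> > DIM('a::euclidean_space) / 2"
  shows "finite_measure (weight_measure \<alpha> :: 'a measure)"
  by (rule finite_measureI) (simp add: emeasure_weight_measure_UNIV[OF assms])

lemma measure_weight_measure_UNIV:
  assumes "\<alpha> > DIM('a::euclidean_space) / 2"
  shows "measure (weight_measure \<alpha> :: 'a measure) UNIV = cauchy_const DIM('a) \<alpha>"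
  using cauchy_const_pos[OF assms] by (simp add: measure_def emeasure_weight_measure_UNIV[OF assms])

lemma emeasure_cauchy_measure:
  assumes \<alpha>: "\<alpha> > DIM('a::euclidean_space) / 2" and A: "A \<in> sets borel"
  shows "emeasure (cauchy_measure \<alpha> :: 'a measure) A
     = ennreal (1 / cauchy_const DIM('a) \<alpha>) * emeasure (weight_measure \<alpha>) A"
proof -
  define c where "c = cauchy_const DIM('a) \<alpha>"
  have c: "c > 0" using cauchy_const_pos[OF \<alpha>] by (simp add: c_def)
  have split: "ennreal (1 / c * y) = ennreal (1 / c) * ennreal y" for y
    using c by (intro ennreal_mult') simp
  have "emeasure (cauchy_measure \<alpha> :: 'a measure) A
      = (\<integral>\<^sup>+x. ennreal (1 / c) * (ennreal ((1 + (norm x)\<^sup>2) powr (- \<alpha>)) * indicator A x) \<partial>lborel)"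
    unfolding cauchy_measure_def c_def[symmetric] split using A
    by (subst emeasure_density) (auto simp: mult.assoc)
  also have "\<dots> = ennreal (1 / c) * emeasure (weight_measure \<alpha>) A"
    using A by (subst nn_integral_cmult) (auto simp: emeasure_weight_measure)
  finally show ?thesis by (simp add: c_def)
qed

lemma measure_cauchy_measure:
  assumes \<alpha>: "\<alpha> > DIM('a::euclidean_space) / 2" and A: "A \<in> sets borel"
  shows "measure (cauchy_measure \<alpha> :: 'a measure) A = measure (weight_measure \<alpha>) A / cauchy_const DIM('a) \<alpha>"
  using cauchy_const_pos[OF \<alpha>]
  by (simp add: measure_def emeasure_cauchy_measure[OF \<alpha> A] enn2real_mult)

lemma sets_cauchy_measure [simp, measurable_cong]: "sets (cauchy_measure \<alpha>) = sets borel"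
  by (simp add: cauchy_measure_def)

lemma space_cauchy_measure [simp]: "space (cauchy_measure \<alpha>) = UNIV"
  by (simp add: cauchy_measure_def)

lemma prob_space_cauchy_measure:
  assumes \<alpha>: "\<alpha> > DIM('a::euclidean_space) / 2"
  shows "prob_space (cauchy_measure \<alpha> :: 'a measure)"
  using cauchy_const_pos[OF \<alpha>]
  by (intro prob_spaceI)
     (simp add: emeasure_cauchy_measure[OF \<alpha>] emeasure_weight_measure_UNIV[OF \<alpha>] ennreal_mult'[symmetric])

lemma null_sets_cauchy_measure:
  assumes \<alpha>: "\<alpha> > DIM('a::euclidean_space) / 2"
  shows "null_sets (cauchy_measure \<alpha> :: 'a measure) = null_sets lborel"
proof (intro set_eqI)
  fix A :: "'a set"
  define h where "h x = 1 / cauchy_const DIM('a) \<alpha> * (1 + (norm x)\<^sup>2) powr (- \<alpha>)" for x :: 'a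
  have h: "\<not> h x \<le> 0" for x :: 'a
  proof -
    have "1 + (norm x)\<^sup>2 > 0" by (simp add: add_pos_nonneg)
    hence "h x > 0"
      using cauchy_const_pos[OF \<alpha>] unfolding h_def by (intro mult_pos_pos divide_pos_pos) auto
    thus ?thesis by simp
  qed
  have [measurable]: "h \<in> borel_measurable borel" unfolding h_def by measurable
  have "A \<in> null_sets (cauchy_measure \<alpha>) \<longleftrightarrow> A \<in> sets lborel \<and> (AE x in lborel. x \<notin> A)"
    unfolding cauchy_measure_def h_def[symmetric]
    by (subst null_sets_density_iff) (simp_all add: ennreal_eq_0_iff h)
  also have "\<dots> \<longleftrightarrow> A \<in> null_sets lborel"
    by (metis AE_iff_null_sets null_setsD2)
  finally show "A \<in> null_sets (cauchy_measure \<alpha>) \<longleftrightarrow> A \<in> null_sets lborel" .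
qed

lemma open_open_nbhd: "open (open_nbhd r A)"
  unfolding open_nbhd_def by auto

lemma open_nbhd_borel [measurable]: "open_nbhd r A \<in> sets borel"
  using open_open_nbhd by (rule borel_open)

lemma subset_open_nbhd: "r > 0 \<Longrightarrow> A \<subseteq> open_nbhd r A"
  unfolding open_nbhd_def by auto

lemma open_nbhd_mono: "r \<le> s \<Longrightarrow> A \<subseteq> B \<Longrightarrow> open_nbhd r A \<subseteq> open_nbhd s B"
  unfolding open_nbhd_def by force

lemma open_nbhd_iff_infdist:
  assumes "finite F" "F \<noteq> {}"
  shows "x \<in> open_nbhd r F \<longleftrightarrow> infdist x F < r"
proof
  assume "x \<in> open_nbhd r F"
  then obtain a where "a \<in> F" "dist a x < r" by (auto simp: open_nbhd_def)
  thus "infdist x F < r" using infdist_le[of a F x] by (simp add: dist_commute)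
next
  assume *: "infdist x F < r"
  have "Inf (dist x ` F) \<in> dist x ` F"
    using assms by (simp add: cInf_eq_Min)
  hence "infdist x F \<in> dist x ` F" using assms by (simp add: infdist_def)
  with * show "x \<in> open_nbhd r F" by (auto simp: open_nbhd_def dist_commute)
qed

text \<open>The ramp is 1 on the small neighbourhood and 0 outside the large one, so each pair of points from
  these two sets contributes 1, in both orders. Its gradient has norm \<open>1 / (s - r)\<close> between the two and vanishes elsewhere.\<close>

lemma finite_nbhd_inequality:
  fixes F :: "'a::euclidean_space set" and \<beta> b A B r s :: real
  assumes F: "finite F" "F \<noteq> {}" and rs: "0 < r" "r < s"
    and \<beta>: "\<beta> > DIM('a) / 2" and AB: "A \<ge> 0" "B \<ge> 0" and B0: "DIM('a) = 1 \<Longrightarrow> B = 0"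
  defines "m \<equiv> (real DIM('a) - 1) / 2"
  assumes b: "b = \<beta> + m + 1" and ang: "angular_bound b A B"
  defines "C \<equiv> pi / 2 * (pi powr m * Gamma \<beta> / Gamma b * (A + B * \<beta> / m))"
  shows "2 * measure (weight_measure b) (open_nbhd r F) * measure (weight_measure b) (- open_nbhd s F) * (s - r)
    \<le> C * (measure (weight_measure \<beta>) (open_nbhd s F) - measure (weight_measure \<beta>) (open_nbhd r F))"
proof -
  have m0: "m \<ge> 0" using DIM_positive[where 'a='a] by (simp add: m_def Suc_leI)
  have \<beta>0: "\<beta> > 0" using \<beta> by (smt (verit) of_nat_0_le_iff divide_nonneg_nonneg)
  have C0: "C \<ge> 0"
    unfolding C_def using AB \<beta>0 m0 b by (intro mult_nonneg_nonneg divide_nonneg_nonneg add_nonneg_nonneg less_imp_le[OF Gamma_real_pos]) auto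
  have b2: "b > DIM('a) / 2" using \<beta> m0 b by simp
  interpret \<mu>: finite_measure "weight_measure b :: 'a measure" by (rule finite_measure_weight_measure[OF b2])
  interpret M: finite_measure "weight_measure \<beta> :: 'a measure" by (rule finite_measure_weight_measure[OF \<beta>])
  define U V where "U = open_nbhd r F" and "V = - open_nbhd s F"
  have [measurable]: "U \<in> sets borel" "V \<in> sets borel" unfolding U_def V_def by auto
  have UV: "U \<inter> V = {}" using open_nbhd_mono[of r s F F] rs by (auto simp: U_def V_def)
  define f where "f = ramp r s F"
  define w where "w x = (1 + (norm x)\<^sup>2) powr (- b)" for x :: 'a
  have w0: "w x \<ge> 0" for x by (simp add: w_def)
  have [measurable]: "w \<in> borel_measurable borel" unfolding w_def by measurable
  define g where "g = (\<lambda>z. indicator {x. r < infdist x F \<and> infdist x F < s} z / (s - r))"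
  have [measurable]: "g \<in> borel_measurable borel"
  proof -
    have "{x. r < infdist x F \<and> infdist x F < s} = {x. r < infdist x F} \<inter> {x. infdist x F < s}" by auto
    also have "\<dots> \<in> sets borel"
      by (intro sets.Int borel_open open_Collect_less continuous_intros)
    finally show ?thesis unfolding g_def by measurable
  qed
  have prodint: "(\<integral>\<^sup>+p. ennreal (w (fst p) * w (snd p)) * indicator S (fst p) * indicator T (snd p) \<partial>lborel)
      = emeasure (weight_measure b) S * emeasure (weight_measure b) T" if [measurable]: "S \<in> sets borel" "T \<in> sets borel" for S T :: "'a set"
  proof -
    have "(\<integral>\<^sup>+p. ennreal (w (fst p) * w (snd p)) * indicator S (fst p) * indicator T (snd p) \<partial>(lborel :: ('a \<times> 'a) measure))
        = (\<integral>\<^sup>+x. \<integral>\<^sup>+y. ennreal (w x * w y) * indicator S x * indicator T y \<partial>lborel \<partial>lborel)"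
      by (subst lborel_prod[symmetric], subst lborel.nn_integral_fst[symmetric]) simp_all
    also have "\<dots> = (\<integral>\<^sup>+x. (ennreal (w x) * indicator S x) * (\<integral>\<^sup>+y. ennreal (w y) * indicator T y \<partial>lborel) \<partial>lborel)"
      using w0 by (intro nn_integral_cong, subst nn_integral_cmult[symmetric]) (auto simp: ennreal_mult mult_ac)
    also have "\<dots> = emeasure (weight_measure b) S * emeasure (weight_measure b) T"
      using that by (subst nn_integral_multc) (auto simp: emeasure_weight_measure w_def)
    finally show ?thesis .
  qed
  have "ennreal (2 * measure (weight_measure b) U * measure (weight_measure b) V)
      = emeasure (weight_measure b) U * emeasure (weight_measure b) V + emeasure (weight_measure b) V * emeasure (weight_measure b) U"
    by (simp add: \<mu>.emeasure_eq_measure ennreal_mult[symmetric] ennreal_plus[symmetric] mult_ac del: ennreal_plus)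
  also have "\<dots> = (\<integral>\<^sup>+p. ennreal (w (fst p) * w (snd p)) * indicator U (fst p) * indicator V (snd p)
        + ennreal (w (fst p) * w (snd p)) * indicator V (fst p) * indicator U (snd p) \<partial>lborel)"
    unfolding prodint[OF \<open>U \<in> sets borel\<close> \<open>V \<in> sets borel\<close>, symmetric] prodint[OF \<open>V \<in> sets borel\<close> \<open>U \<in> sets borel\<close>, symmetric]
    by (rule nn_integral_add[symmetric]) (simp_all add: lborel_prod[symmetric])
  also have "\<dots> \<le> (\<integral>\<^sup>+p. ennreal (\<bar>f (fst p) - f (snd p)\<bar> * pair_weight b (fst p) (snd p)) \<partial>lborel)"
  proof (rule nn_integral_mono)
    fix p :: "'a \<times> 'a"
    have f1: "f x = 1" if "x \<in> U" for x
      using that rs open_nbhd_iff_infdist[OF F] by (simp add: f_def ramp_def U_def)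
    have f0: "f x = 0" if "x \<in> V" for x
    proof -
      have "s - infdist x F \<le> 0" using that open_nbhd_iff_infdist[OF F] by (auto simp: V_def)
      hence "(s - infdist x F) / (s - r) \<le> 0" using rs by (simp add: divide_le_0_iff)
      thus ?thesis by (simp add: f_def ramp_def)
    qed
    have pw: "pair_weight b (fst p) (snd p) = w (fst p) * w (snd p)"
      unfolding pair_weight_def w_def by (rule powr_mult) 
    show "ennreal (w (fst p) * w (snd p)) * indicator U (fst p) * indicator V (snd p)
        + ennreal (w (fst p) * w (snd p)) * indicator V (fst p) * indicator U (snd p)
      \<le> ennreal (\<bar>f (fst p) - f (snd p)\<bar> * pair_weight b (fst p) (snd p))"
      unfolding pw using f1 f0 UV by (auto simp: indicator_def)
  qed
  also have "\<dots> \<le> ennreal C * (\<integral>\<^sup>+z. ennreal (g z * (1 + (norm z)\<^sup>2) powr (- \<beta>)) \<partial>lborel)"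
    unfolding C_def m_def f_def
  proof (rule pair_difference_le_gradient_flux[OF \<beta> AB B0 _ ang])
    show "b = \<beta> + (real DIM('a) - 1) / 2 + 1" using b by (simp add: m_def)
    show "\<bar>ramp r s F x - ramp r s F y\<bar> \<le> 1 / (s - r) * norm (x - y)" for x y
      by (rule ramp_lipschitz) fact
    show "AE z in lborel. \<exists>e. norm e = 1 \<and> (\<forall>w. (\<lambda>k. \<bar>ramp r s F (fst (rot (1 / Suc k) (z, w))) - ramp r s F z\<bar> / (1 / Suc k))
        \<longlonglongrightarrow> g z * \<bar>w \<bullet> e\<bar>)"
      unfolding g_def by (rule ramp_slope[OF F rs])
    show "g \<in> borel_measurable borel" by fact
    show "g x \<ge> 0" for x using rs by (simp add: g_def)
  qed (use rs in auto)
  also have "(\<integral>\<^sup>+z. ennreal (g z * (1 + (norm z)\<^sup>2) powr (- \<beta>)) \<partial>lborel)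
      \<le> (\<integral>\<^sup>+z. ennreal (1 / (s - r)) * (ennreal ((1 + (norm z)\<^sup>2) powr (- \<beta>)) * indicator (open_nbhd s F - U) z) \<partial>lborel)"
  proof (rule nn_integral_mono)
    fix z
    show "ennreal (g z * (1 + (norm z)\<^sup>2) powr (- \<beta>))
      \<le> ennreal (1 / (s - r)) * (ennreal ((1 + (norm z)\<^sup>2) powr (- \<beta>)) * indicator (open_nbhd s F - U) z)"
      using rs by (auto simp: g_def indicator_def U_def open_nbhd_iff_infdist[OF F] ennreal_mult'[symmetric])
  qed
  also have "\<dots> = ennreal (1 / (s - r)) * emeasure (weight_measure \<beta>) (open_nbhd s F - U)"
    by (subst nn_integral_cmult) (auto simp: emeasure_weight_measure)
  also have "emeasure (weight_measure \<beta>) (open_nbhd s F - U)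
     = ennreal (measure (weight_measure \<beta>) (open_nbhd s F) - measure (weight_measure \<beta>) U)"
    using open_nbhd_mono[of r s F F] rs
    by (simp add: M.emeasure_eq_measure M.finite_measure_Diff U_def)
  finally have "ennreal (2 * measure (weight_measure b) U * measure (weight_measure b) V)
     \<le> ennreal C * (ennreal (1 / (s - r)) * ennreal (measure (weight_measure \<beta>) (open_nbhd s F) - measure (weight_measure \<beta>) U))"
    by (simp add: mult_left_mono)
  also have "\<dots> = ennreal (C * (1 / (s - r) * (measure (weight_measure \<beta>) (open_nbhd s F) - measure (weight_measure \<beta>) U)))"
    using C0 rs by (simp add: ennreal_mult'[symmetric])
  finally have "2 * measure (weight_measure b) U * measure (weight_measure b) V
      \<le> C * (1 / (s - r) * (measure (weight_measure \<beta>) (open_nbhd s F) - measure (weight_measure \<beta>) U))"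
  proof (subst (asm) ennreal_le_iff)
    show "0 \<le> C * (1 / (s - r) * (measure (weight_measure \<beta>) (open_nbhd s F) - measure (weight_measure \<beta>) U))"
      using C0 rs open_nbhd_mono[of r s F F]
      by (intro mult_nonneg_nonneg) (auto simp: U_def intro!: M.finite_measure_mono)
  qed
  thus ?thesis using rs by (simp add: U_def V_def field_simps)
qed

lemma open_nbhd_approx_finite:
  fixes A :: "'a::euclidean_space set"
  assumes "A \<noteq> {}"
  obtains F where "\<And>k. finite (F k)" "\<And>k. F k \<noteq> {}" "incseq F" "\<And>r. open_nbhd r A = (\<Union>k::nat. open_nbhd r (F k))"
proof -
  obtain D where D: "countable D" "D \<subseteq> A" "A \<subseteq> closure D" using separable[of A] by blast
  have Dne: "D \<noteq> {}" using assms D(3) by auto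
  define F where "F k = from_nat_into D ` {..k}" for k :: nat
  have FD: "(\<Union>k. F k) = D"
  proof -
    have "(\<Union>k. F k) = from_nat_into D ` (\<Union>k. {..k})" unfolding F_def by blast
    also have "(\<Union>k::nat. {..k}) = UNIV" by auto
    finally show ?thesis using range_from_nat_into[OF Dne D(1)] by simp
  qed
  show ?thesis
  proof (rule that[of F])
    show "incseq F" unfolding F_def by (intro incseq_SucI) auto
    show "open_nbhd r A = (\<Union>k. open_nbhd r (F k))" for r
    proof -
      have "(\<Union>k. open_nbhd r (F k)) = open_nbhd r D" unfolding FD[symmetric] open_nbhd_def by auto
      also have "\<dots> = open_nbhd r A"
      proof
        show "open_nbhd r D \<subseteq> open_nbhd r A" by (rule open_nbhd_mono) (use D in auto)
        show "open_nbhd r A \<subseteq> open_nbhd r D"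
        proof
          fix x assume "x \<in> open_nbhd r A"
          then obtain a where a: "a \<in> A" "dist a x < r" by (auto simp: open_nbhd_def)
          hence "a \<in> closure D" using D by auto
          then obtain y where y: "y \<in> D" "dist y a < r - dist a x"
            using a(2) by (metis closure_approachable diff_gt_0_iff_gt)
          have "dist y x < r" using dist_triangle[of y x a] y by simp
          thus "x \<in> open_nbhd r D" using y by (auto simp: open_nbhd_def)
        qed
      qed
      finally show ?thesis ..
    qed
  qed (auto simp: F_def)
qed

text \<open>First \<open>F k\<close> increases to a dense subset of \<open>A\<close>, then the inner width \<open>r\<close> tends to 0.\<close>

lemma nbhd_inequality:
  fixes A :: "'a::euclidean_space set" and \<beta> b A' B s :: real
  assumes A: "A \<in> sets borel" and s: "0 < s"
    and \<beta>: "\<beta> > DIM('a) / 2" and AB: "A' \<ge> 0" "B \<ge> 0" and B0: "DIM('a) = 1 \<Longrightarrow> B = 0"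
  defines "m \<equiv> (real DIM('a) - 1) / 2"
  assumes b: "b = \<beta> + m + 1" and ang: "angular_bound b A' B"
  defines "C \<equiv> pi / 2 * (pi powr m * Gamma \<beta> / Gamma b * (A' + B * \<beta> / m))"
  shows "2 * measure (weight_measure b) A * (cauchy_const DIM('a) b - measure (weight_measure b) (open_nbhd s A)) * s
    \<le> C * (measure (weight_measure \<beta>) (open_nbhd s A) - measure (weight_measure \<beta>) A)"
proof (cases "A = {}")
  case True
  thus ?thesis by (simp add: open_nbhd_def)
next
  case False
  have m0: "m \<ge> 0" using DIM_positive[where 'a='a] by (simp add: m_def Suc_leI)
  have \<beta>0: "\<beta> > 0" using \<beta> by (smt (verit) of_nat_0_le_iff divide_nonneg_nonneg)
  have C0: "C \<ge> 0"
    unfolding C_def using AB \<beta>0 m0 b by (intro mult_nonneg_nonneg divide_nonneg_nonneg add_nonneg_nonneg less_imp_le[OF Gamma_real_pos]) auto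
  have b2: "b > DIM('a) / 2" using \<beta> m0 b by simp
  interpret \<mu>: finite_measure "weight_measure b :: 'a measure" by (rule finite_measure_weight_measure[OF b2])
  interpret M: finite_measure "weight_measure \<beta> :: 'a measure" by (rule finite_measure_weight_measure[OF \<beta>])
  obtain F where F: "\<And>k. finite (F k)" "\<And>k. F k \<noteq> {}" "incseq F" and FA: "\<And>r. open_nbhd r A = (\<Union>k::nat. open_nbhd r (F k))"
    using open_nbhd_approx_finite[OF False] by blast
  have inc: "incseq (\<lambda>k. open_nbhd r (F k))" for r
    using F(3) open_nbhd_mono[OF order_refl] unfolding incseq_def by blast
  have lim\<mu>: "(\<lambda>k. measure (weight_measure b) (open_nbhd r (F k))) \<longlonglongrightarrow> measure (weight_measure b) (open_nbhd r A)" for r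
    unfolding FA by (intro \<mu>.finite_Lim_measure_incseq inc) auto
  have limM: "(\<lambda>k. measure (weight_measure \<beta>) (open_nbhd r (F k))) \<longlonglongrightarrow> measure (weight_measure \<beta>) (open_nbhd r A)" for r
    unfolding FA by (intro M.finite_Lim_measure_incseq inc) auto
  define X where "X = 2 * measure (weight_measure b) A * (cauchy_const DIM('a) b - measure (weight_measure b) (open_nbhd s A))"
  define Y where "Y = C * (measure (weight_measure \<beta>) (open_nbhd s A) - measure (weight_measure \<beta>) A)"
  have XY: "X * (s - r) \<le> Y" if r: "0 < r" "r < s" for r
  proof -
    have "2 * measure (weight_measure b) (open_nbhd r A) * (cauchy_const DIM('a) b - measure (weight_measure b) (open_nbhd s A)) * (s - r)
       \<le> C * (measure (weight_measure \<beta>) (open_nbhd s A) - measure (weight_measure \<beta>) (open_nbhd r A))"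
    proof (rule LIMSEQ_le[of _ _ _ _])
      show "(\<lambda>k. 2 * measure (weight_measure b) (open_nbhd r (F k)) * (cauchy_const DIM('a) b - measure (weight_measure b) (open_nbhd s (F k))) * (s - r))
        \<longlonglongrightarrow> 2 * measure (weight_measure b) (open_nbhd r A) * (cauchy_const DIM('a) b - measure (weight_measure b) (open_nbhd s A)) * (s - r)"
        by (intro tendsto_intros lim\<mu>)
      show "(\<lambda>k. C * (measure (weight_measure \<beta>) (open_nbhd s (F k)) - measure (weight_measure \<beta>) (open_nbhd r (F k))))
        \<longlonglongrightarrow> C * (measure (weight_measure \<beta>) (open_nbhd s A) - measure (weight_measure \<beta>) (open_nbhd r A))"
        by (intro tendsto_intros limM)
      have "measure (weight_measure b) (- open_nbhd s (F k)) = cauchy_const DIM('a) b - measure (weight_measure b) (open_nbhd s (F k))" for k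
        using \<mu>.finite_measure_compl[of "open_nbhd s (F k)"] by (simp add: measure_weight_measure_UNIV[OF b2] Compl_eq_Diff_UNIV)
      thus "\<exists>N. \<forall>k\<ge>N. 2 * measure (weight_measure b) (open_nbhd r (F k)) * (cauchy_const DIM('a) b - measure (weight_measure b) (open_nbhd s (F k))) * (s - r)
        \<le> C * (measure (weight_measure \<beta>) (open_nbhd s (F k)) - measure (weight_measure \<beta>) (open_nbhd r (F k)))"
        using finite_nbhd_inequality[OF F(1,2) r \<beta> AB B0 b[unfolded m_def] ang] unfolding C_def m_def by simp
    qed
    moreover have "X * (s - r) \<le> 2 * measure (weight_measure b) (open_nbhd r A) * (cauchy_const DIM('a) b - measure (weight_measure b) (open_nbhd s A)) * (s - r)"
    proof -
      have "measure (weight_measure b) (open_nbhd s A) \<le> measure (weight_measure b :: 'a measure) UNIV"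
        by (intro \<mu>.finite_measure_mono) auto
      hence "cauchy_const DIM('a) b - measure (weight_measure b) (open_nbhd s A) \<ge> 0"
        by (simp add: measure_weight_measure_UNIV[OF b2])
      thus ?thesis unfolding X_def using r subset_open_nbhd[of r A]
        by (intro mult_right_mono mult_left_mono \<mu>.finite_measure_mono) auto
    qed
    moreover have "C * (measure (weight_measure \<beta>) (open_nbhd s A) - measure (weight_measure \<beta>) (open_nbhd r A)) \<le> Y"
      unfolding Y_def using r subset_open_nbhd[of r A] C0
      by (intro mult_left_mono diff_left_mono M.finite_measure_mono) auto
    ultimately show ?thesis by linarith
  qed
  have "X * (s - 0) \<le> Y"
  proof (rule tendsto_upperbound)
    show "((\<lambda>r. X * (s - r)) \<longlongrightarrow> X * (s - 0)) (at_right 0)" by (intro tendsto_intros)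
    show "\<forall>\<^sub>F r in at_right 0. X * (s - r) \<le> Y"
      using s XY by (auto simp: eventually_at_right_field intro!: exI[of _ s])
  qed simp
  thus ?thesis by (simp add: X_def Y_def)
qed

text \<open>As the width shrinks, the neighbourhoods decrease to the closure of \<open>A\<close>. If the closure has more
  mass than \<open>A\<close>, the perimeter is infinite. Otherwise closure and \<open>A\<close> differ by a Lebesgue null set, so
  they have the same mass for the other order as well.\<close>

lemma perimeter_ge_from_nbhds:
  fixes A :: "'a::euclidean_space set" and \<beta> b c :: real
  assumes A: "A \<in> sets borel" and \<beta>: "\<beta> > DIM('a) / 2" and b: "b > DIM('a) / 2" and c: "c \<ge> 0"
    and nbhd: "\<And>s. s > 0 \<Longrightarrow> c * measure (cauchy_measure b) A * (1 - measure (cauchy_measure b) (open_nbhd s A))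
       \<le> (measure (cauchy_measure \<beta>) (open_nbhd s A) - measure (cauchy_measure \<beta>) A) / s"
  shows "ereal (c * measure (cauchy_measure b) A * (1 - measure (cauchy_measure b) A)) \<le> perimeter (cauchy_measure \<beta>) A"
proof -
  interpret \<mu>: prob_space "cauchy_measure b :: 'a measure" by (rule prob_space_cauchy_measure[OF b])
  interpret M: prob_space "cauchy_measure \<beta> :: 'a measure" by (rule prob_space_cauchy_measure[OF \<beta>])
  define p where "p = measure (cauchy_measure b) A"
  define K where "K = c * p * (1 - p)"
  have p0: "p \<ge> 0" by (simp add: p_def)
  have cl: "closure A \<subseteq> open_nbhd s A" if "s > 0" for s
  proof
    fix x assume "x \<in> closure A"
    then obtain y where "y \<in> A" "dist y x < s" using \<open>s > 0\<close> closure_approachable by blast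
    thus "x \<in> open_nbhd s A" by (auto simp: open_nbhd_def)
  qed
  have clA: "closure A \<in> sets borel" by simp
  define q where "q s = (measure (cauchy_measure \<beta>) (open_nbhd s A) - measure (cauchy_measure \<beta>) A) / s" for s
  have ev: "\<forall>\<^sub>F s in at_right 0. y < q s" if y: "y < K" for y
  proof (cases "measure (cauchy_measure \<beta>) (closure A) = measure (cauchy_measure \<beta>) A")
    case False
    define \<kappa> where "\<kappa> = measure (cauchy_measure \<beta>) (closure A) - measure (cauchy_measure \<beta>) A"
    have "measure (cauchy_measure \<beta>) A \<le> measure (cauchy_measure \<beta>) (closure A)"
      by (intro M.finite_measure_mono closure_subset) simp
    hence \<kappa>: "\<kappa> > 0" using False by (simp add: \<kappa>_def)
    define s0 where "s0 = \<kappa> / (\<bar>y\<bar> + 1)"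
    have s0: "s0 > 0" using \<kappa> by (simp add: s0_def)
    have "y < q s" if s: "0 < s" "s < s0" for s
    proof -
      have "s * (\<bar>y\<bar> + 1) < \<kappa>" using s by (simp add: s0_def pos_less_divide_eq)
      moreover have "\<kappa> \<le> measure (cauchy_measure \<beta>) (open_nbhd s A) - measure (cauchy_measure \<beta>) A"
        unfolding \<kappa>_def using cl[OF s(1)] by (intro diff_right_mono M.finite_measure_mono) auto
      moreover have "s * y \<le> s * (\<bar>y\<bar> + 1)" using s by (intro mult_left_mono) auto
      ultimately have "y * s < measure (cauchy_measure \<beta>) (open_nbhd s A) - measure (cauchy_measure \<beta>) A"
        by (simp add: mult.commute)
      thus ?thesis using s by (simp add: q_def pos_less_divide_eq)
    qed
    thus ?thesis using s0 by (auto simp: eventually_at_right_field)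
  next
    case True
    have "measure (cauchy_measure \<beta>) (closure A - A) = 0"
      using True A closure_subset[of A] by (subst M.finite_measure_Diff) auto
    hence "closure A - A \<in> null_sets (cauchy_measure \<beta>)"
      using A by (intro null_setsI) (auto simp: M.emeasure_eq_measure)
    hence "closure A - A \<in> null_sets (cauchy_measure b)"
      by (simp add: null_sets_cauchy_measure[OF \<beta>] null_sets_cauchy_measure[OF b])
    hence "measure (cauchy_measure b) (closure A - A) = 0" by (simp add: measure_def null_setsD1)
    hence pcl: "measure (cauchy_measure b) (closure A) = p"
      using A closure_subset[of A] unfolding p_def by (subst (asm) \<mu>.finite_measure_Diff) auto
    define N where "N k = open_nbhd (1 / real (Suc k)) A" for k
    have Int: "(\<Inter>k. N k) = closure A"
    proof
      show "closure A \<subseteq> (\<Inter>k. N k)" unfolding N_def by (intro INT_greatest cl) simp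
      show "(\<Inter>k. N k) \<subseteq> closure A"
      proof
        fix x assume x: "x \<in> (\<Inter>k. N k)"
        show "x \<in> closure A" unfolding closure_approachable
        proof (intro allI impI)
          fix e :: real assume "e > 0"
          then obtain k where k: "1 / real (Suc k) < e" using nat_approx_posE by metis
          from x have "x \<in> N k" by blast
          then obtain y where "y \<in> A" "dist y x < 1 / real (Suc k)"
            by (auto simp: N_def open_nbhd_def simp del: of_nat_Suc)
          thus "\<exists>y\<in>A. dist y x < e" using k by (intro bexI[of _ y]) simp_all
        qed
      qed
    qed
    have Nb: "N k \<in> sets borel" for k by (simp add: N_def)
    have "decseq N" unfolding N_def decseq_def
      by (intro allI impI open_nbhd_mono) (auto intro!: divide_left_mono)
    hence "(\<lambda>k. measure (cauchy_measure b) (N k)) \<longlonglongrightarrow> measure (cauchy_measure b) (\<Inter>k. N k)"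
      using Nb by (intro \<mu>.finite_Lim_measure_decseq) auto
    hence "(\<lambda>k. c * p * (1 - measure (cauchy_measure b) (N k))) \<longlonglongrightarrow> c * p * (1 - p)"
      unfolding Int pcl by (intro tendsto_intros)
    from order_tendstoD(1)[OF this y[unfolded K_def]]
    obtain k where k: "y < c * p * (1 - measure (cauchy_measure b) (N k))"
      unfolding eventually_sequentially by auto
    have "y < q s" if s: "0 < s" "s < 1 / real (Suc k)" for s
    proof -
      have "measure (cauchy_measure b) (open_nbhd s A) \<le> measure (cauchy_measure b) (N k)"
        unfolding N_def using s by (intro \<mu>.finite_measure_mono open_nbhd_mono) auto
      hence "c * p * (1 - measure (cauchy_measure b) (N k)) \<le> c * p * (1 - measure (cauchy_measure b) (open_nbhd s A))"
        using c p0 by (intro mult_left_mono) auto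
      also have "\<dots> \<le> q s" unfolding q_def p_def by (rule nbhd) fact
      finally show ?thesis using k by linarith
    qed
    thus ?thesis unfolding eventually_at_right_field
      by (intro exI[of _ "1 / real (Suc k)"]) auto
  qed
  have "ereal K \<le> Liminf (at_right 0) (\<lambda>s. ereal (q s))"
  proof (subst le_Liminf_iff, intro allI impI)
    fix y assume y: "y < ereal K"
    show "\<forall>\<^sub>F s in at_right 0. y < ereal (q s)"
    proof (cases y)
      case (real r)
      with ev[of r] y show ?thesis by simp
    qed (use y in auto)
  qed
  thus ?thesis by (simp add: perimeter_def q_def K_def p_def)
qed

theorem corollary2p4:
  fixes \<beta> \<beta>' c d :: real and n :: nat
  assumes "n = CARD('n::finite)"
    and "\<beta> \<ge> (real n + 1) / 2"
    and "\<beta>' = \<beta> + (real n + 1) / 2"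
    and "d = (Gamma (\<beta>' - real n / 2))\<^sup>2 / (Gamma (\<beta>' - real n) * Gamma \<beta>')"
    and "c = d / sqrt pi * sqrt (2 * \<beta>)"
  shows "(\<forall>A :: (real ^ 'n) set. A \<in> sets borel \<longrightarrow>
            perimeter (cauchy_measure \<beta>) A
              \<ge> ereal (c * measure (cauchy_measure \<beta>') A * (1 - measure (cauchy_measure \<beta>') A)))
       \<and> (\<beta> \<ge> (real n)\<^sup>2 \<longrightarrow> c \<ge> 1 / sqrt (2 * pi) * sqrt \<beta>)"
proof (intro conjI allI impI)
  have n: "n \<ge> 1" using assms(1) by (simp add: Suc_leI)
  have \<beta>0: "\<beta> > 0" using assms(2) by simp
  define a where "a = \<beta> - n / 2"
  have a: "a > 0" using assms(2) by (simp add: a_def field_simps)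
  have arg: "\<beta>' - real n / 2 = \<beta> + 1/2" "\<beta>' - real n = a + 1/2"
    unfolding assms(3) a_def by (simp_all add: field_simps)
  have b0: "\<beta>' > 0" using assms(3) \<beta>0 by (simp add: add_pos_nonneg)
  have G: "Gamma \<beta> > 0" "Gamma \<beta>' > 0" "Gamma (\<beta> + 1/2) > 0" "Gamma (a + 1/2) > 0" "Gamma a > 0"
    using a \<beta>0 b0 by (auto intro!: Gamma_real_pos)
  have d: "d > 0" unfolding assms(4) arg using G by simp
  {
    assume big: "\<beta> \<ge> (real n)\<^sup>2"
    have eqs: "\<beta> + 1/2 + real n / 2 = \<beta>'" "\<beta> + 1/2 - real n / 2 = \<beta>' - real n"
      using assms(3) by (simp_all add: field_simps)
    have "d \<ge> 1/2"
      unfolding assms(4) arg(1) using Gamma_quotient_ge_half[OF n big] unfolding eqs .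
    hence "1/2 / sqrt pi * sqrt (2 * \<beta>) \<le> c"
      unfolding assms(5) using \<beta>0 by (intro mult_right_mono divide_right_mono) auto
    moreover have "1/2 / sqrt pi * sqrt (2 * \<beta>) = 1 / sqrt (2 * pi) * sqrt \<beta>"
      by (simp add: real_sqrt_mult field_simps)
    ultimately show "c \<ge> 1 / sqrt (2 * pi) * sqrt \<beta>" by simp
  next
    fix S :: "(real ^ 'n) set" assume S: "S \<in> sets borel"
    have dim: "DIM(real ^ 'n) = n" using assms(1) by simp
    have d1: "\<beta> > DIM(real ^ 'n) / 2" "\<beta>' > DIM(real ^ 'n) / 2"
      using a b0 assms(2,3) unfolding dim by (auto simp: a_def field_simps)
    define m where "m = (real n - 1) / 2"
    have bm: "\<beta>' = \<beta> + m + 1" using assms(3) by (simp add: m_def field_simps)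
    obtain A B where AB: "A \<ge> 0" "B \<ge> 0" "n = 1 \<Longrightarrow> B = 0" "angular_bound \<beta>' A B"
      and val: "sqrt (2 * \<beta>) * (A + B * \<beta> / m) \<le> 4 * (Gamma (a + 1/2) / Gamma a)"
      using angular_bound_sufficient[OF n assms(2,3)] unfolding m_def a_def by blast
    define C where "C = pi / 2 * (pi powr m * Gamma \<beta> / Gamma \<beta>' * (A + B * \<beta> / m))"
    define u v where "u = cauchy_const n \<beta>'" and "v = cauchy_const n \<beta>"
    have uv: "u > 0" "v > 0" using d1 unfolding dim u_def v_def by (auto intro!: cauchy_const_pos)
    have c0: "c \<ge> 0" unfolding assms(5) using d \<beta>0 by simp
    \<comment> \<open>\<open>d\<close> is \<open>u\<^sup>2\<close> divided by \<open>cauchy_const (2 * n) \<beta>'\<close>, and this divisor cancels.\<close>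
    have const: "c * C * v \<le> 2 * u\<^sup>2"
    proof -
      define Q where "Q = (Gamma (\<beta> + 1/2))\<^sup>2 / (Gamma (a + 1/2) * Gamma \<beta>')"
      have "c * C * v = Q / sqrt pi * (sqrt (2 * \<beta>) * (A + B * \<beta> / m)) * (pi / 2 * pi powr m * pi powr (n / 2) * Gamma a / Gamma \<beta>')"
        unfolding assms(5,4) arg Q_def C_def v_def cauchy_const_def a_def[symmetric] using G by (simp add: mult_ac)
      also have "\<dots> \<le> Q / sqrt pi * (4 * (Gamma (a + 1/2) / Gamma a)) * (pi / 2 * pi powr m * pi powr (n / 2) * Gamma a / Gamma \<beta>')"
        using G by (intro mult_right_mono mult_left_mono val) (auto simp: Q_def)
      also have "\<dots> = 2 * ((Gamma (\<beta> + 1/2))\<^sup>2 / (Gamma \<beta>')\<^sup>2) * (pi / sqrt pi * pi powr m * pi powr (n / 2))"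
        unfolding Q_def using G by (simp add: field_simps power2_eq_square)
      also have "pi / sqrt pi * pi powr m * pi powr (n / 2) = (pi powr (n / 2))\<^sup>2"
      proof -
        have "pi / sqrt pi = pi powr (1/2)" by (simp add: powr_half_sqrt real_div_sqrt)
        thus ?thesis by (simp add: powr_add[symmetric] m_def power2_eq_square add_divide_distrib[symmetric])
      qed
      also have "2 * ((Gamma (\<beta> + 1/2))\<^sup>2 / (Gamma \<beta>')\<^sup>2) * (pi powr (n / 2))\<^sup>2 = 2 * u\<^sup>2"
        unfolding u_def cauchy_const_def arg by (simp add: power_mult_distrib power_divide)
      finally show ?thesis .
    qed
    show "ereal (c * measure (cauchy_measure \<beta>') S * (1 - measure (cauchy_measure \<beta>') S)) \<le> perimeter (cauchy_measure \<beta>) S"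
    proof (rule perimeter_ge_from_nbhds[OF S d1 c0])
      fix s :: real assume s: "s > 0"
      interpret \<mu>: prob_space "cauchy_measure \<beta>' :: (real ^ 'n) measure" by (rule prob_space_cauchy_measure[OF d1(2)])
      define x y where "x = measure (cauchy_measure \<beta>') S" and "y = 1 - measure (cauchy_measure \<beta>') (open_nbhd s S)"
      define z where "z = measure (cauchy_measure \<beta>) (open_nbhd s S) - measure (cauchy_measure \<beta>) S"
      have xy: "x \<ge> 0" "y \<ge> 0" by (auto simp: x_def y_def)
      have "2 * measure (weight_measure \<beta>') S * (cauchy_const n \<beta>' - measure (weight_measure \<beta>') (open_nbhd s S)) * s
        \<le> C * (measure (weight_measure \<beta>) (open_nbhd s S) - measure (weight_measure \<beta>) S)"
        using nbhd_inequality[OF S s d1(1) AB(1,2) _ _ AB(4)] AB(3) bm unfolding dim C_def m_def by simp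
      moreover have "measure (weight_measure \<beta>') T = u * measure (cauchy_measure \<beta>') T"
        "measure (weight_measure \<beta>) T = v * measure (cauchy_measure \<beta>) T" if "T \<in> sets borel" for T :: "(real ^ 'n) set"
        unfolding measure_cauchy_measure[OF d1(2) that] measure_cauchy_measure[OF d1(1) that] dim u_def[symmetric] v_def[symmetric]
        using uv by simp_all
      ultimately have "2 * u\<^sup>2 * (x * y * s) \<le> C * v * z"
        using S by (simp add: x_def y_def z_def u_def[symmetric] algebra_simps power2_eq_square)
      hence "c * (2 * u\<^sup>2 * (x * y * s)) \<le> c * (C * v * z)"
        using c0 by (rule mult_left_mono)
      also have "\<dots> = (c * C * v) * z" by simp
      also have "\<dots> \<le> (2 * u\<^sup>2) * z"
      proof (rule mult_right_mono[OF const])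
        interpret M: prob_space "cauchy_measure \<beta> :: (real ^ 'n) measure" by (rule prob_space_cauchy_measure[OF d1(1)])
        show "z \<ge> 0" unfolding z_def using S subset_open_nbhd[OF s, of S] by (simp add: M.finite_measure_mono)
      qed
      finally have "(2 * u\<^sup>2) * (c * x * y * s) \<le> (2 * u\<^sup>2) * z" by (simp add: mult_ac)
      hence "c * x * y * s \<le> z" using uv by (subst (asm) mult_le_cancel_left_pos) auto
      thus "c * measure (cauchy_measure \<beta>') S * (1 - measure (cauchy_measure \<beta>') (open_nbhd s S))
         \<le> (measure (cauchy_measure \<beta>) (open_nbhd s S) - measure (cauchy_measure \<beta>) S) / s"
        using s by (simp add: x_def y_def z_def pos_le_divide_eq)
    qed
  }
qed

end
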